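(* Suppose that assumptions (FS1), (FS2), (FS3), (SS1) and (VA1) (written out in the context) hold. Then $$E\left(\left[A^{-2}n_I\left\{\hat V_{YG,A}(\hat\tau_\rho)-V_1(\hat\tau_\rho)-V_2(\hat\tau_\rho)\right\}\right]^2\right)=O(n_I^{-1}).$$ If in addition assumption (VA2) holds, then $$E\left(\left[A^{-2}n_I\left\{\hat V_{YG}(\hat\tau_\rho)-V(\hat\tau_\rho)\right\}\right]^2\right)=O(n_I^{-1})\qquad\text{and}\qquad\frac{\hat V_{YG}(\hat\tau_\rho)}{V(\hat\tau_\rho)}\longrightarrow1\ \text{ in probability.}$$
   Context: Setting. $\mathcal F\subset\mathbb R^d$ is a fixed bounded measurable set of Lebesgue measure $A>0$, and $\rho:\mathcal F\to\mathbb R$ is Lebesgue integrable, with $\tau_\rho=\int_{\mathcal F}\rho(x)\,dx$. We consider a sequence (index suppressed) of partitions of $\mathcal F$ into $N_I$ disjoint measurable sub-regions (primary sampling units, PSUs) forming $U_I=\{u_1,\dots,u_{N_I}\}$; $A_i$ is the measure of $u_i$. Asymptotics: $A$ is fixed, $N_I\to\infty$, the partition becomes increasingly fine (PSU diameters shrink to $0$), and $n_I\to\infty$. Constants in the assumptions do not depend on the position in the sequence; $O(\cdot)$ and limits are along this sequence. Sampling. First stage: a random sample $S_I\subset U_I$ of fixed size $n_I$ is selected (the Yates–Grundy estimator is used for fixed-size first-stage designs); $I_{Ii}$ is the indicator of $u_i\in S_I$, $\pi_{Ii}=E(I_{Ii})$, $\pi_{Iij}=E(I_{Ii}I_{Ij})$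 (so $\pi_{Iii}=\pi_{Ii}$), $\Delta_{Iij}=\pi_{Iij}-\pi_{Ii}\pi_{Ij}$. Second stage: conditionally on $S_I$, for each $u_i\in S_I$ a sample $S_{IIi}$ of $n_{IIi}$ points is drawn independently from a probability density $f_{IIi}$ supported on $u_i$; the second-stage mechanism does not depend on the realization of $S_I$, and the samples $S_{IIi}$ are conditionally independent across PSUs given $S_I$. Put $\pi_{IIi}(x)=n_{IIi}f_{IIi}(x)$ and $n_{II0}=N_I^{-1}\sum_{i=1}^{N_I}n_{IIi}$. Estimator and variance. $\tau_{\rho i}=\int_{u_i}\rho(x)\,dx$, $\hat\tau_{\rho i}=\sum_{x\in S_{IIi}}\rho(x)/\pi_{IIi}(x)$, $\hat\tau_\rho=\sum_{u_i\in S_I}\hat\tau_{\rho i}/\pi_{Ii}$. $V(\hat\tau_\rho)=V_1(\hat\tau_\rho)+V_2(\hat\tau_\rho)+V_3(\hat\tau_\rho)$ with $$V_1(\hat\tau_\rho)=\sum_{u_i\in U_I}\sum_{u_j\in U_I}\Delta_{Iij}\frac{\tau_{\rho i}}{\pi_{Ii}}\frac{\tau_{\rho j}}{\pi_{Ij}},\quad V_2(\hat\tau_\rho)=\sum_{u_i\in U_I}\frac{1-\pi_{Ii}}{\pi_{Ii}}V_i,\quad V_3(\hat\tau_\rho)=\sum_{u_i\in U_I}V_i,$$ $$V_i=\int_{u_i}\pi_{IIi}(x)\left\{\frac{\rho(x)}{\pi_{IIi}(x)}-\frac{\tau_{\rho i}}{n_{IIi}}\right\}^2dx.$$ Yates–Grundy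 variance estimator: $\hat V_{YG}(\hat\tau_\rho)=\hat V_{YG,A}(\hat\tau_\rho)+\hat V_B(\hat\tau_\rho)$ with $$\hat V_{YG,A}(\hat\tau_\rho)=-\frac12\sum_{u_i\neq u_j\in S_I}\frac{\Delta_{Iij}}{\pi_{Iij}}\left(\frac{\hat\tau_{\rho i}}{\pi_{Ii}}-\frac{\hat\tau_{\rho j}}{\pi_{Ij}}\right)^2,\quad \hat V_B(\hat\tau_\rho)=\sum_{u_i\in S_I}\frac{\hat V_i}{\pi_{Ii}},\quad \hat V_i=\frac{n_{IIi}}{n_{IIi}-1}\sum_{x\in S_{IIi}}\left\{\frac{\rho(x)}{\pi_{IIi}(x)}-\frac{\hat\tau_{\rho i}}{n_{IIi}}\right\}^2.$$ Assumptions. (FS1) There exist constants $f_{I0}<1$ and $0<c_{I1}\le C_{I1}<\infty$ with $n_I/N_I\le f_{I0}$ and $c_{I1}\le (N_I/n_I)\pi_{Ii}\le C_{I1}$ for all $i$. (FS2) There exist constants $C_{I2},C_{I3},C_{I4}>0$ such that, the maxima being over distinct indices in $\{1,\dots,N_I\}$, $\Delta_{I2}=\max|E\{(I_{Ii}-\pi_{Ii})(I_{Ij}-\pi_{Ij})\}|\le C_{I2}N_I^{-2}n_I$, $\Delta_{I3}=\max|E\{(I_{Ii}-\pi_{Ii})(I_{Ij}-\pi_{Ij})(I_{Ii'}-\pi_{Ii'})\}|\le C_{I3}N_I^{-3}n_I^2$, $\Delta_{I4}=\max|E\{(I_{Ii}-\pi_{Ii})(I_{Ij}-\pi_{Ij})(I_{Ii'}-\pi_{Ii'})(I_{Ij'}-\pi_{Ij'})\}|\le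 C_{I4}N_I^{-4}n_I^2$. (FS3) There exists $c_{I2}>0$ such that $c_{I2}N_I^{-2}n_I^2\le\pi_{Iij}$ for all $i\ne j$. (SS1) There exist constants $0<\lambda_1\le\Lambda_1<\infty$, $0<\phi_1\le\Phi_1<\infty$, $0<c_1\le C_1<\infty$ such that for every PSU $u_i$: $\lambda_1n_{II0}\le n_{IIi}\le\Lambda_1n_{II0}$; $\phi_1A/N_I\le A_i\le\Phi_1A/N_I$; $c_1/A_i\le f_{IIi}(x)\le C_1/A_i$ for all $x\in u_i$; and $n_{IIi}\ge2$. (VA1) There exist constants $m_1,M_1$ such that $A^{-1}\int_{\mathcal F}\rho(x)^4dx\le M_1$ and $|A^{-1}\int_{\mathcal F}\rho(x)\,dx|\ge m_1>0$. (VA2) There exists a constant $m_2$ such that $n_IA^{-2}V_1(\hat\tau_\rho)\ge m_2>0$. *)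

theory Defs
  imports "HOL-Probability.Probability" "HOL-Library.Landau_Symbols"
begin

section \<open>Two-stage sampling from a continuous population\<close>

text \<open>
  One element of the sequence of partitions and designs. The PSUs are labelled \<open>0, \<dots>, num_psu - 1\<close>
  and \<open>sample_I\<close> is the random set of labels of the selected PSUs. \<open>point D i l\<close> (for \<open>l < size_II D i\<close>)
  is the \<open>l\<close>-th point drawn in PSU \<open>i\<close>; it is meaningful only on the event that \<open>i\<close> is selected.
\<close>

record ('a, 'w) two_stage =
  prob_sp :: "'w measure"
  num_psu :: nat
  psu :: "nat \<Rightarrow> 'a set"
  size_I :: nat
  sample_I :: "'w \<Rightarrow> nat set"
  size_II :: "nat \<Rightarrow> nat"
  dens_II :: "nat \<Rightarrow> 'a \<Rightarrow> real"
  point :: "nat \<Rightarrow> nat \<Rightarrow> 'w \<Rightarrow> 'a"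

definition psu_partition :: "'a::euclidean_space set \<Rightarrow> ('a, 'w) two_stage \<Rightarrow> bool" where
  "psu_partition F D \<longleftrightarrow>
     (\<forall>i<num_psu D. psu D i \<in> sets lebesgue) \<and>
     disjoint_family_on (psu D) {..<num_psu D} \<and>
     (\<Union>i<num_psu D. psu D i) = F"

definition density_on :: "'a::euclidean_space set \<Rightarrow> ('a \<Rightarrow> real) \<Rightarrow> bool" where
  "density_on u f \<longleftrightarrow>
     f \<in> borel_measurable lebesgue \<and> (\<forall>x. 0 \<le> f x) \<and> (\<forall>x. x \<notin> u \<longrightarrow> f x = 0) \<and>
     integrable lebesgue f \<and> (LINT x|lebesgue. f x) = 1"

definition cond_first_stage :: "('a, 'w) two_stage \<Rightarrow> nat set \<Rightarrow> 'w measure" where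
  "cond_first_stage D s =
     uniform_measure (prob_sp D) {w \<in> space (prob_sp D). sample_I D w = s}"

text \<open>
  Given \<open>sample_I = s\<close>, all points drawn in the PSUs of \<open>s\<close> are independent, with a law and a
  number of draws per PSU that do not depend on \<open>s\<close>.
\<close>

definition two_stage_sampling :: "'a::euclidean_space set \<Rightarrow> ('a, 'w) two_stage \<Rightarrow> bool" where
  "two_stage_sampling F D \<longleftrightarrow>
     psu_partition F D \<and>
     prob_space (prob_sp D) \<and>
     sample_I D \<in> measurable (prob_sp D)
       (count_space {s. s \<subseteq> {..<num_psu D} \<and> card s = size_I D}) \<and>
     (\<forall>i<num_psu D. density_on (psu D i) (dens_II D i)) \<and>
     (\<forall>s. measure (prob_sp D) {w \<in> space (prob_sp D). sample_I D w = s} > 0 \<longrightarrow>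
        prob_space.indep_vars (cond_first_stage D s) (\<lambda>_. lebesgue)
          (\<lambda>(i, l). point D i l) (SIGMA i:s. {..<size_II D i}) \<and>
        (\<forall>i\<in>s. \<forall>l<size_II D i.
           distributed (cond_first_stage D s) lebesgue (point D i l) (\<lambda>x. ennreal (dens_II D i x))))"

subsection \<open>First- and second-stage inclusion quantities\<close>

definition incl_I :: "('a, 'w) two_stage \<Rightarrow> nat \<Rightarrow> 'w \<Rightarrow> real" where
  "incl_I D i w = indicator (sample_I D w) i"

definition pi_I :: "('a, 'w) two_stage \<Rightarrow> nat \<Rightarrow> real" where
  "pi_I D i = (LINT w|prob_sp D. incl_I D i w)"

definition pi_I2 :: "('a, 'w) two_stage \<Rightarrow> nat \<Rightarrow> nat \<Rightarrow> real" where
  "pi_I2 D i j = (LINT w|prob_sp D. incl_I D i w * incl_I D j w)"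

definition Delta_I :: "('a, 'w) two_stage \<Rightarrow> nat \<Rightarrow> nat \<Rightarrow> real" where
  "Delta_I D i j = pi_I2 D i j - pi_I D i * pi_I D j"

definition pi_II :: "('a, 'w) two_stage \<Rightarrow> nat \<Rightarrow> 'a \<Rightarrow> real" where
  "pi_II D i x = real (size_II D i) * dens_II D i x"

definition mean_size_II :: "('a, 'w) two_stage \<Rightarrow> real" where
  "mean_size_II D = (\<Sum>i<num_psu D. real (size_II D i)) / real (num_psu D)"

subsection \<open>Totals, variance and variance estimators\<close>

definition tau_psu :: "('a::euclidean_space \<Rightarrow> real) \<Rightarrow> ('a, 'w) two_stage \<Rightarrow> nat \<Rightarrow> real" where
  "tau_psu \<rho> D i = (LINT x:psu D i|lebesgue. \<rho> x)"

definition tau_psu_hat :: "('a \<Rightarrow> real) \<Rightarrow> ('a, 'w) two_stage \<Rightarrow> nat \<Rightarrow> 'w \<Rightarrow> real" where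
  "tau_psu_hat \<rho> D i w =
     (\<Sum>l<size_II D i. \<rho> (point D i l w) / pi_II D i (point D i l w))"

definition V_psu :: "('a::euclidean_space \<Rightarrow> real) \<Rightarrow> ('a, 'w) two_stage \<Rightarrow> nat \<Rightarrow> real" where
  "V_psu \<rho> D i =
     (LINT x:psu D i|lebesgue.
        pi_II D i x * (\<rho> x / pi_II D i x - tau_psu \<rho> D i / real (size_II D i))\<^sup>2)"

definition V1 :: "('a::euclidean_space \<Rightarrow> real) \<Rightarrow> ('a, 'w) two_stage \<Rightarrow> real" where
  "V1 \<rho> D =
     (\<Sum>i<num_psu D. \<Sum>j<num_psu D.
        Delta_I D i j * (tau_psu \<rho> D i / pi_I D i) * (tau_psu \<rho> D j / pi_I D j))"

definition V2 :: "('a::euclidean_space \<Rightarrow> real) \<Rightarrow> ('a, 'w) two_stage \<Rightarrow> real" where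
  "V2 \<rho> D = (\<Sum>i<num_psu D. (1 - pi_I D i) / pi_I D i * V_psu \<rho> D i)"

definition V3 :: "('a::euclidean_space \<Rightarrow> real) \<Rightarrow> ('a, 'w) two_stage \<Rightarrow> real" where
  "V3 \<rho> D = (\<Sum>i<num_psu D. V_psu \<rho> D i)"

definition V_total :: "('a::euclidean_space \<Rightarrow> real) \<Rightarrow> ('a, 'w) two_stage \<Rightarrow> real" where
  "V_total \<rho> D = V1 \<rho> D + V2 \<rho> D + V3 \<rho> D"

definition V_psu_hat :: "('a \<Rightarrow> real) \<Rightarrow> ('a, 'w) two_stage \<Rightarrow> nat \<Rightarrow> 'w \<Rightarrow> real" where
  "V_psu_hat \<rho> D i w =
     real (size_II D i) / (real (size_II D i) - 1) *
     (\<Sum>l<size_II D i.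
        (\<rho> (point D i l w) / pi_II D i (point D i l w)
          - tau_psu_hat \<rho> D i w / real (size_II D i))\<^sup>2)"

text \<open>The double sum runs over ordered pairs, which the factor \<open>1/2\<close> compensates.\<close>

definition VYGA_hat :: "('a \<Rightarrow> real) \<Rightarrow> ('a, 'w) two_stage \<Rightarrow> 'w \<Rightarrow> real" where
  "VYGA_hat \<rho> D w =
     - (1/2) * (\<Sum>i\<in>sample_I D w. \<Sum>j\<in>sample_I D w - {i}.
        Delta_I D i j / pi_I2 D i j *
        (tau_psu_hat \<rho> D i w / pi_I D i - tau_psu_hat \<rho> D j w / pi_I D j)\<^sup>2)"

definition VB_hat :: "('a \<Rightarrow> real) \<Rightarrow> ('a, 'w) two_stage \<Rightarrow> 'w \<Rightarrow> real" where
  "VB_hat \<rho> D w = (\<Sum>i\<in>sample_I D w. V_psu_hat \<rho> D i w / pi_I D i)"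

definition VYG_hat :: "('a \<Rightarrow> real) \<Rightarrow> ('a, 'w) two_stage \<Rightarrow> 'w \<Rightarrow> real" where
  "VYG_hat \<rho> D w = VYGA_hat \<rho> D w + VB_hat \<rho> D w"

section \<open>Asymptotic framework and assumptions\<close>

definition infill_asymptotics :: "(nat \<Rightarrow> ('a::euclidean_space, 'w) two_stage) \<Rightarrow> bool" where
  "infill_asymptotics D \<longleftrightarrow>
     filterlim (\<lambda>k. num_psu (D k)) at_top sequentially \<and>
     filterlim (\<lambda>k. size_I (D k)) at_top sequentially \<and>
     (\<lambda>k. Max ((\<lambda>i. diameter (psu (D k) i)) ` {..<num_psu (D k)})) \<longlonglongrightarrow> 0"

definition FS1 :: "(nat \<Rightarrow> ('a, 'w) two_stage) \<Rightarrow> bool" where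
  "FS1 D \<longleftrightarrow> (\<exists>f0 c C :: real. f0 < 1 \<and> 0 < c \<and> c \<le> C \<and>
     (\<forall>k. real (size_I (D k)) / real (num_psu (D k)) \<le> f0 \<and>
       (\<forall>i<num_psu (D k).
          c \<le> real (num_psu (D k)) / real (size_I (D k)) * pi_I (D k) i \<and>
          real (num_psu (D k)) / real (size_I (D k)) * pi_I (D k) i \<le> C)))"

text \<open>
  A maximum over tuples of distinct labels is bounded by stating the bound for each tuple; this
  leaves no condition when there are too few PSUs to form such a tuple.
\<close>

definition FS2 :: "(nat \<Rightarrow> ('a, 'w) two_stage) \<Rightarrow> bool" where
  "FS2 D \<longleftrightarrow> (\<exists>C2 C3 C4 :: real. 0 < C2 \<and> 0 < C3 \<and> 0 < C4 \<and> (\<forall>k.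
     let N = num_psu (D k); n = real (size_I (D k));
         e = (\<lambda>i w. incl_I (D k) i w - pi_I (D k) i)
     in
       (\<forall>i<N. \<forall>j<N. distinct [i, j] \<longrightarrow>
          \<bar>LINT w|prob_sp (D k). e i w * e j w\<bar> \<le> C2 * n / real N ^ 2) \<and>
       (\<forall>i<N. \<forall>j<N. \<forall>i'<N. distinct [i, j, i'] \<longrightarrow>
          \<bar>LINT w|prob_sp (D k). e i w * e j w * e i' w\<bar> \<le> C3 * n ^ 2 / real N ^ 3) \<and>
       (\<forall>i<N. \<forall>j<N. \<forall>i'<N. \<forall>j'<N. distinct [i, j, i', j'] \<longrightarrow>
          \<bar>LINT w|prob_sp (D k). e i w * e j w * e i' w * e j' w\<bar> \<le> C4 * n ^ 2 / real N ^ 4)))"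

definition FS3 :: "(nat \<Rightarrow> ('a, 'w) two_stage) \<Rightarrow> bool" where
  "FS3 D \<longleftrightarrow> (\<exists>c :: real. 0 < c \<and> (\<forall>k. \<forall>i<num_psu (D k). \<forall>j<num_psu (D k). i \<noteq> j \<longrightarrow>
     c * real (size_I (D k)) ^ 2 / real (num_psu (D k)) ^ 2 \<le> pi_I2 (D k) i j))"

definition SS1 :: "'a::euclidean_space set \<Rightarrow> (nat \<Rightarrow> ('a, 'w) two_stage) \<Rightarrow> bool" where
  "SS1 F D \<longleftrightarrow> (\<exists>l L p P c C :: real.
     0 < l \<and> l \<le> L \<and> 0 < p \<and> p \<le> P \<and> 0 < c \<and> c \<le> C \<and>
     (\<forall>k. \<forall>i<num_psu (D k).
        l * mean_size_II (D k) \<le> real (size_II (D k) i) \<and>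
        real (size_II (D k) i) \<le> L * mean_size_II (D k) \<and>
        p * measure lebesgue F / real (num_psu (D k)) \<le> measure lebesgue (psu (D k) i) \<and>
        measure lebesgue (psu (D k) i) \<le> P * measure lebesgue F / real (num_psu (D k)) \<and>
        (\<forall>x\<in>psu (D k) i.
           c / measure lebesgue (psu (D k) i) \<le> dens_II (D k) i x \<and>
           dens_II (D k) i x \<le> C / measure lebesgue (psu (D k) i)) \<and>
        2 \<le> size_II (D k) i))"

text \<open>Integrability is stated separately because the Bochner integral of a non-integrable function is 0.\<close>

definition VA1 :: "'a::euclidean_space set \<Rightarrow> ('a \<Rightarrow> real) \<Rightarrow> bool" where
  "VA1 F \<rho> \<longleftrightarrow> (\<exists>m M :: real. 0 < m \<and>
     set_integrable lebesgue F (\<lambda>x. \<rho> x ^ 4) \<and>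
     (LINT x:F|lebesgue. \<rho> x ^ 4) / measure lebesgue F \<le> M \<and>
     m \<le> \<bar>(LINT x:F|lebesgue. \<rho> x) / measure lebesgue F\<bar>)"

definition VA2 ::
  "'a::euclidean_space set \<Rightarrow> ('a \<Rightarrow> real) \<Rightarrow> (nat \<Rightarrow> ('a, 'w) two_stage) \<Rightarrow> bool" where
  "VA2 F \<rho> D \<longleftrightarrow> (\<exists>m :: real. 0 < m \<and>
     (\<forall>k. m \<le> real (size_I (D k)) / (measure lebesgue F)\<^sup>2 * V1 \<rho> (D k)))"

text \<open>
  The random variables may live on different probability spaces; measurability is included because
  \<open>measure\<close> is 0 on non-measurable sets.
\<close>

definition tendsto_in_probability ::
  "(nat \<Rightarrow> 'w measure) \<Rightarrow> (nat \<Rightarrow> 'w \<Rightarrow> real) \<Rightarrow> real \<Rightarrow> bool" where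
  "tendsto_in_probability M Y c \<longleftrightarrow>
     (\<forall>k. Y k \<in> borel_measurable (M k)) \<and>
     (\<forall>\<epsilon>>0. (\<lambda>k. measure (M k) {w \<in> space (M k). \<bar>Y k w - c\<bar> > \<epsilon>}) \<longlonglongrightarrow> 0)"

end

theory Submission
  imports Defs
begin

text \<open>
  Conditionally on the first-stage sample the estimated PSU totals are independent, with moments
  that do not depend on the sample. Hence the expectation of a product of terms attached to a set
  \<open>A\<close> of PSUs is the joint inclusion probability of \<open>A\<close> times a product of second-stage moments.
  Up to a factor, the Yates--Grundy estimator is a sum over the pairs of distinct PSUs of terms of
  size \<open>n\<^sup>-\<^sup>3\<close>, where \<open>n\<close> and \<open>N\<close> are the numbers of sampled and of all PSUs. Two disjoint pairs
  contribute the difference between a fourth order inclusion probability and a product of second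
  order ones, which is \<open>O(n\<^sup>3 / N\<^sup>4)\<close> after an expansion into centered moments; overlapping pairs are
  few enough to be bounded crudely. The second-stage term is a Horvitz--Thompson estimator, and
  the ratio statement is Chebyshev's inequality.
\<close>

section \<open>Inclusion probabilities of the first stage\<close>

text \<open>\<open>\<rho>\<close> has a fourth moment only over the whole region, so one PSU may
  carry far more than its share. What is controlled at the right order is the sum over all PSUs of
  the fourth moments of the estimated totals, \<open>A ^ 4 / N ^ 3\<close>. Products are therefore
  always bounded by sums of the moments of the PSUs involved, and covariances are summed by rows,
  instead of multiplying a uniform bound by a count.

  The delicate case is that of disjoint pairs: there are about \<open>N ^ 4\<close> of them, and the
  trivial bound \<open>(n / N) ^ 4\<close> for the covariance of their inclusion would leave a
  normalized error of order one. Centering gains exactly one factor \<open>n\<close>, which brings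
  them to the order of the overlapping pairs.

  Conditional statements are made only for samples of positive probability that contain the PSUs in
  question, because the points of unselected PSUs have no prescribed law. All bounds concern one
  design and have constants that do not mention it; the sequence matters only for the final
  limit.\<close>

locale first_stage =
  fixes D :: "('a::euclidean_space, 'w) two_stage"
  assumes prob_space_D: "prob_space (prob_sp D)"
    and sample_measurable:
      "sample_I D \<in> measurable (prob_sp D)
         (count_space {s. s \<subseteq> {..<num_psu D} \<and> card s = size_I D})"
begin

sublocale prob_space "prob_sp D"
  by (fact prob_space_D)

definition samples :: "nat set set" where
  "samples = {s. s \<subseteq> {..<num_psu D} \<and> card s = size_I D}"

definition sample_event :: "nat set \<Rightarrow> 'w set" where
  "sample_event s = {w \<in> space (prob_sp D). sample_I D w = s}"

definition sample_prob :: "nat set \<Rightarrow> real" where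
  "sample_prob s = prob (sample_event s)"

text \<open>A finite sum over samples instead of an integral: relations between inclusion
  probabilities of different orders then reduce to algebra under the sum.\<close>

definition incl_prob :: "nat set \<Rightarrow> real" where
  "incl_prob A = (\<Sum>s\<in>samples. sample_prob s * of_bool (A \<subseteq> s))"

lemma finite_samples [simp]: "finite samples"
  unfolding samples_def by (rule finite_subset[of _ "Pow {..<num_psu D}"]) auto

lemma sample_in_samples: "w \<in> space (prob_sp D) \<Longrightarrow> sample_I D w \<in> samples"
  using measurable_space[OF sample_measurable] by (auto simp: samples_def)

lemma sample_finite: "s \<in> samples \<Longrightarrow> finite s"
  unfolding samples_def using finite_subset by blast

lemma sample_event_sets [measurable]: "sample_event s \<in> sets (prob_sp D)"
proof (cases "s \<in> samples")
  case True
  have "sample_event s = sample_I D -` {s} \<inter> space (prob_sp D)"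
    unfolding sample_event_def by auto
  then show ?thesis
    using measurable_sets[OF sample_measurable, of "{s}"] True by (auto simp: samples_def)
next
  case False
  then have "sample_event s = {}"
    using sample_in_samples unfolding sample_event_def by auto
  then show ?thesis by simp
qed

lemma sample_function_measurable [measurable]:
  "(\<lambda>w. \<phi> (sample_I D w) :: real) \<in> borel_measurable (prob_sp D)"
  using measurable_compose[OF sample_measurable, of \<phi> borel] by simp

lemma sample_prob_nonneg [simp]: "0 \<le> sample_prob s"
  by (simp add: sample_prob_def)

lemma incl_prob_nonneg [simp]: "0 \<le> incl_prob A"
  unfolding incl_prob_def by (intro sum_nonneg) auto

lemma indicator_sample_event_sum:
  fixes f :: "'w \<Rightarrow> real"
  assumes "w \<in> space (prob_sp D)"
  shows "f w = (\<Sum>s\<in>samples. indicator (sample_event s) w * f w)"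
proof -
  have "(\<Sum>s\<in>samples. indicator (sample_event s) w * f w)
      = (\<Sum>s\<in>samples. if s = sample_I D w then f w else 0)"
    by (intro sum.cong) (auto simp: sample_event_def assms)
  also have "\<dots> = f w"
    using sample_in_samples[OF assms] by simp
  finally show ?thesis by simp
qed

section \<open>Conditioning on the first-stage sample\<close>

lemma cond_first_stage_eq_density:
  assumes "sample_prob s > 0"
  shows "cond_first_stage D s =
    density (prob_sp D) (\<lambda>w. ennreal (indicator (sample_event s) w / sample_prob s))"
proof -
  have "indicator (sample_event s) w / emeasure (prob_sp D) (sample_event s)
      = ennreal (indicator (sample_event s) w / sample_prob s)" for w
    using assms by (simp add: sample_prob_def emeasure_eq_measure divide_ennreal
        flip: ennreal_indicator)
  then show ?thesis
    unfolding cond_first_stage_def uniform_measure_def sample_event_def[symmetric] by simp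
qed

lemma cond_prob_space:
  assumes "sample_prob s > 0"
  shows "prob_space (cond_first_stage D s)"
  unfolding cond_first_stage_def sample_event_def[symmetric]
  using assms by (intro prob_space_uniform_measure)
    (auto simp: sample_prob_def emeasure_eq_measure)

lemma sets_cond [simp, measurable_cong]: "sets (cond_first_stage D s) = sets (prob_sp D)"
  by (simp add: cond_first_stage_def)

lemma space_cond [simp]: "space (cond_first_stage D s) = space (prob_sp D)"
  by (simp add: cond_first_stage_def)

lemma AE_cond: "AE w in cond_first_stage D s. sample_I D w = s"
  unfolding cond_first_stage_def sample_event_def[symmetric]
  using sample_event_sets[of s] by (rule AE_uniform_measureI) (simp add: sample_event_def)

text \<open>The factor \<open>sample_prob s\<close> stays on the left, so that the identities can be
  added up over all samples in the law of total expectation.\<close>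

lemma
  fixes f :: "'w \<Rightarrow> real"
  assumes [measurable]: "f \<in> borel_measurable (prob_sp D)" and pos: "sample_prob s > 0"
  shows integrable_cond_iff: "integrable (cond_first_stage D s) f \<longleftrightarrow>
      integrable (prob_sp D) (\<lambda>w. indicator (sample_event s) w * f w)"
    and integral_cond: "sample_prob s * integral\<^sup>L (cond_first_stage D s) f =
      (LINT w|prob_sp D. indicator (sample_event s) w * f w)"
proof -
  have "integrable (cond_first_stage D s) f \<longleftrightarrow>
      integrable (prob_sp D) (\<lambda>w. (indicator (sample_event s) w * f w) / sample_prob s)"
    unfolding cond_first_stage_eq_density[OF pos]
    by (subst integrable_density) auto
  also have "\<dots> \<longleftrightarrow> integrable (prob_sp D) (\<lambda>w. indicator (sample_event s) w * f w)"
    using pos integrable_mult_left_iff[of "prob_sp D" "1 / sample_prob s"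
        "\<lambda>w. indicator (sample_event s) w * f w"] by (simp add: divide_inverse ac_simps)
  finally show "integrable (cond_first_stage D s) f \<longleftrightarrow>
      integrable (prob_sp D) (\<lambda>w. indicator (sample_event s) w * f w)" .
  have "integral\<^sup>L (cond_first_stage D s) f =
      (LINT w|prob_sp D. (indicator (sample_event s) w * f w) / sample_prob s)"
    unfolding cond_first_stage_eq_density[OF pos]
    by (subst integral_density) auto
  then show "sample_prob s * integral\<^sup>L (cond_first_stage D s) f =
      (LINT w|prob_sp D. indicator (sample_event s) w * f w)"
    using pos by simp
qed

text \<open>The space splits into the finitely many events of a fixed sample. Integrability is asked
  only for samples of positive probability, the ones whose conditional law the design
  prescribes.\<close>

lemma
  fixes f :: "'w \<Rightarrow> real"
  assumes [measurable]: "f \<in> borel_measurable (prob_sp D)"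
    and int: "\<And>s. s \<in> samples \<Longrightarrow> sample_prob s > 0 \<Longrightarrow> integrable (cond_first_stage D s) f"
  shows total_integrable: "integrable (prob_sp D) f"
    and total_expectation: "expectation f =
      (\<Sum>s\<in>samples. sample_prob s * integral\<^sup>L (cond_first_stage D s) f)"
proof -
  have *: "integrable (prob_sp D) (\<lambda>w. indicator (sample_event s) w * f w) \<and>
      (LINT w|prob_sp D. indicator (sample_event s) w * f w)
        = sample_prob s * integral\<^sup>L (cond_first_stage D s) f" if "s \<in> samples" for s
  proof (cases "sample_prob s > 0")
    case True
    then show ?thesis
      using integrable_cond_iff[of f s] integral_cond[of f s] int that by simp
  next
    \<comment> \<open>On a null event the restricted function vanishes almost everywhere, and the
      weight zero removes the conditional integral whatever its value is.\<close>
    case False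
    then have p0: "sample_prob s = 0"
      using sample_prob_nonneg[of s] by linarith
    then have "AE w in prob_sp D. w \<notin> sample_event s"
      by (intro AE_not_in null_setsI) (auto simp: sample_prob_def emeasure_eq_measure)
    then have ae: "AE w in prob_sp D. indicator (sample_event s) w * f w = 0"
      by eventually_elim simp
    have "integrable (prob_sp D) (\<lambda>w. indicator (sample_event s) w * f w)"
      using ae by (subst integrable_cong_AE[where g = "\<lambda>_. 0"]) auto
    moreover have "(LINT w|prob_sp D. indicator (sample_event s) w * f w) = 0"
      using ae by (subst integral_cong_AE[where g = "\<lambda>_. 0"]) auto
    ultimately show ?thesis using p0 by simp
  qed
  have "integrable (prob_sp D) f \<longleftrightarrow>
      integrable (prob_sp D) (\<lambda>w. \<Sum>s\<in>samples. indicator (sample_event s) w * f w)"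
    by (rule Bochner_Integration.integrable_cong) (simp_all only: indicator_sample_event_sum[symmetric])
  also have "\<dots>" using * by (intro Bochner_Integration.integrable_sum) blast
  finally show "integrable (prob_sp D) f" by blast
  have "expectation f = (LINT w|prob_sp D. (\<Sum>s\<in>samples. indicator (sample_event s) w * f w))"
    by (rule Bochner_Integration.integral_cong) (simp_all only: indicator_sample_event_sum[symmetric])
  then show "expectation f =
      (\<Sum>s\<in>samples. sample_prob s * integral\<^sup>L (cond_first_stage D s) f)"
    using * by (subst (asm) Bochner_Integration.integral_sum) auto
qed

lemma expectation_sample_function:
  fixes \<phi> :: "nat set \<Rightarrow> real"
  shows "expectation (\<lambda>w. \<phi> (sample_I D w)) = (\<Sum>s\<in>samples. sample_prob s * \<phi> s)"
proof -
  have *: "integrable (cond_first_stage D s) (\<lambda>w. \<phi> (sample_I D w)) \<and>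
      integral\<^sup>L (cond_first_stage D s) (\<lambda>w. \<phi> (sample_I D w)) = \<phi> s"
    if "sample_prob s > 0" for s
  proof -
    interpret C: prob_space "cond_first_stage D s" by (rule cond_prob_space[OF that])
    have ae: "AE w in cond_first_stage D s. \<phi> (sample_I D w) = \<phi> s"
      using AE_cond[of s] by eventually_elim simp
    have "integrable (cond_first_stage D s) (\<lambda>w. \<phi> (sample_I D w))"
      using ae by (subst integrable_cong_AE[where g = "\<lambda>_. \<phi> s"]) auto
    moreover have "integral\<^sup>L (cond_first_stage D s) (\<lambda>w. \<phi> (sample_I D w)) = \<phi> s"
      using ae C.prob_space by (subst integral_cong_AE[where g = "\<lambda>_. \<phi> s"]) auto
    ultimately show ?thesis by simp
  qed
  have "expectation (\<lambda>w. \<phi> (sample_I D w)) =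
     (\<Sum>s\<in>samples. sample_prob s * integral\<^sup>L (cond_first_stage D s) (\<lambda>w. \<phi> (sample_I D w)))"
    using * by (intro total_expectation) auto
  also have "\<dots> = (\<Sum>s\<in>samples. sample_prob s * \<phi> s)"
  proof (intro sum.cong refl)
    fix s
    show "sample_prob s * integral\<^sup>L (cond_first_stage D s) (\<lambda>w. \<phi> (sample_I D w))
        = sample_prob s * \<phi> s"
      using *[of s] sample_prob_nonneg[of s] by (cases "sample_prob s = 0") auto
  qed
  finally show ?thesis .
qed

text \<open>The source of all moments below: when the conditional integral is the same for every
  sample containing \<open>A\<close>, it factors out of the sum that defines
  \<open>incl_prob A\<close>. No moment is asked of \<open>f\<close> on samples missing a member of
  \<open>A\<close>, where the drawn points have no meaning; the indicator removes them.\<close>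

lemma
  fixes f :: "'w \<Rightarrow> real" and c :: real
  assumes [measurable]: "f \<in> borel_measurable (prob_sp D)"
    and int: "\<And>s. s \<in> samples \<Longrightarrow> sample_prob s > 0 \<Longrightarrow> A \<subseteq> s \<Longrightarrow>
      integrable (cond_first_stage D s) f"
  shows integrable_incl: "integrable (prob_sp D) (\<lambda>w. of_bool (A \<subseteq> sample_I D w) * f w)"
    and expectation_incl_eq:
      "(\<And>s. s \<in> samples \<Longrightarrow> sample_prob s > 0 \<Longrightarrow> A \<subseteq> s \<Longrightarrow>
         integral\<^sup>L (cond_first_stage D s) f = c) \<Longrightarrow>
       expectation (\<lambda>w. of_bool (A \<subseteq> sample_I D w) * f w) = incl_prob A * c"
    and expectation_incl_le:
      "(\<And>s. s \<in> samples \<Longrightarrow> sample_prob s > 0 \<Longrightarrow> A \<subseteq> s \<Longrightarrow>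
         integral\<^sup>L (cond_first_stage D s) f \<le> c) \<Longrightarrow>
       expectation (\<lambda>w. of_bool (A \<subseteq> sample_I D w) * f w) \<le> incl_prob A * c"
proof -
  let ?f = "\<lambda>w. of_bool (A \<subseteq> sample_I D w) * f w"
  have [measurable]: "?f \<in> borel_measurable (prob_sp D)"
    using sample_function_measurable[of "\<lambda>s. of_bool (A \<subseteq> s)"] by measurable
  have *: "integrable (cond_first_stage D s) ?f \<and>
      integral\<^sup>L (cond_first_stage D s) ?f = of_bool (A \<subseteq> s) * integral\<^sup>L (cond_first_stage D s) f"
    if s: "s \<in> samples" "sample_prob s > 0" for s
  proof -
    have ae: "AE w in cond_first_stage D s. ?f w = of_bool (A \<subseteq> s) * f w"
      using AE_cond[of s] by eventually_elim simp
    have "integrable (cond_first_stage D s) (\<lambda>w. of_bool (A \<subseteq> s) * f w)"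
      using int[OF s] by (cases "A \<subseteq> s") auto
    then have "integrable (cond_first_stage D s) ?f"
      using ae by (subst integrable_cong_AE[where g = "\<lambda>w. of_bool (A \<subseteq> s) * f w"]) auto
    moreover have "integral\<^sup>L (cond_first_stage D s) ?f =
        integral\<^sup>L (cond_first_stage D s) (\<lambda>w. of_bool (A \<subseteq> s) * f w)"
      using ae by (intro integral_cong_AE) auto
    ultimately show ?thesis by simp
  qed
  show "integrable (prob_sp D) ?f"
    using * by (intro total_integrable) auto
  have E: "expectation ?f =
      (\<Sum>s\<in>samples. sample_prob s * (of_bool (A \<subseteq> s) * integral\<^sup>L (cond_first_stage D s) f))"
  proof -
    have "expectation ?f = (\<Sum>s\<in>samples. sample_prob s * integral\<^sup>L (cond_first_stage D s) ?f)"
      using * by (intro total_expectation) auto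
    also have "\<dots> = (\<Sum>s\<in>samples.
        sample_prob s * (of_bool (A \<subseteq> s) * integral\<^sup>L (cond_first_stage D s) f))"
    proof (intro sum.cong refl)
      fix s assume "s \<in> samples"
      then show "sample_prob s * integral\<^sup>L (cond_first_stage D s) ?f
          = sample_prob s * (of_bool (A \<subseteq> s) * integral\<^sup>L (cond_first_stage D s) f)"
        using *[of s] sample_prob_nonneg[of s] by (cases "sample_prob s = 0") auto
    qed
    finally show ?thesis .
  qed
  {
    assume c: "\<And>s. s \<in> samples \<Longrightarrow> sample_prob s > 0 \<Longrightarrow> A \<subseteq> s \<Longrightarrow>
         integral\<^sup>L (cond_first_stage D s) f = c"
    have "sample_prob s * (of_bool (A \<subseteq> s) * integral\<^sup>L (cond_first_stage D s) f)
        = sample_prob s * of_bool (A \<subseteq> s) * c" if "s \<in> samples" for s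
      using c[OF that] sample_prob_nonneg[of s] by (cases "sample_prob s = 0") auto
    then show "expectation ?f = incl_prob A * c"
      unfolding E incl_prob_def sum_distrib_right by (intro sum.cong refl) blast
  next
    assume c: "\<And>s. s \<in> samples \<Longrightarrow> sample_prob s > 0 \<Longrightarrow> A \<subseteq> s \<Longrightarrow>
         integral\<^sup>L (cond_first_stage D s) f \<le> c"
    have "sample_prob s * (of_bool (A \<subseteq> s) * integral\<^sup>L (cond_first_stage D s) f)
        \<le> sample_prob s * of_bool (A \<subseteq> s) * c" if "s \<in> samples" for s
      using c[OF that] sample_prob_nonneg[of s]
      by (cases "sample_prob s = 0") (auto intro!: mult_left_mono)
    then show "expectation ?f \<le> incl_prob A * c"
      unfolding E incl_prob_def sum_distrib_right by (intro sum_mono) blast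
  }
qed

section \<open>Inclusion probabilities as expectations\<close>

lemma incl_I_eq: "incl_I D i w = of_bool (i \<in> sample_I D w)"
  by (simp add: incl_I_def indicator_def)

lemma pi_I_eq: "pi_I D i = incl_prob {i}"
  unfolding pi_I_def incl_I_eq
  using expectation_sample_function[of "\<lambda>s. of_bool (i \<in> s)"] by (simp add: incl_prob_def)

lemma pi_I2_eq: "pi_I2 D i j = incl_prob {i, j}"
  unfolding pi_I2_def incl_I_eq
  using expectation_sample_function[of "\<lambda>s. of_bool (i \<in> s) * of_bool (j \<in> s)"]
  by (simp add: incl_prob_def flip: of_bool_conj)

lemma sum_sample_prob: "(\<Sum>s\<in>samples. sample_prob s) = 1"
  using expectation_sample_function[of "\<lambda>_. 1"] by (simp add: prob_space)

lemma incl_prob_le_1: "incl_prob A \<le> 1"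
proof -
  have "incl_prob A \<le> (\<Sum>s\<in>samples. sample_prob s)"
    unfolding incl_prob_def by (intro sum_mono) auto
  then show ?thesis by (simp add: sum_sample_prob)
qed

text \<open>Every sample has exactly \<open>size_I D\<close> labels, and summing the indicators over
  \<open>j\<close> counts them. Labels \<open>j\<close> already in \<open>A\<close> take part in the
  count and contribute \<open>incl_prob A\<close> itself.\<close>

lemma sum_incl_prob_insert:
  "(\<Sum>j<num_psu D. incl_prob (insert j A)) = real (size_I D) * incl_prob A"
proof -
  have "(\<Sum>j<num_psu D. incl_prob (insert j A))
      = (\<Sum>s\<in>samples. \<Sum>j<num_psu D. sample_prob s * of_bool (insert j A \<subseteq> s))"
    unfolding incl_prob_def by (rule sum.swap)
  also have "\<dots> = (\<Sum>s\<in>samples. real (size_I D) * (sample_prob s * of_bool (A \<subseteq> s)))"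
  proof (intro sum.cong refl)
    fix s assume "s \<in> samples"
    then have s: "s \<subseteq> {..<num_psu D}" "card s = size_I D" by (auto simp: samples_def)
    have "(\<Sum>j<num_psu D. sample_prob s * of_bool (insert j A \<subseteq> s))
        = sample_prob s * of_bool (A \<subseteq> s) * (\<Sum>j<num_psu D. of_bool (j \<in> s))"
      by (cases "A \<subseteq> s") (simp_all add: sum_distrib_left)
    also have "(\<Sum>j<num_psu D. of_bool (j \<in> s) :: real) = real (card s)"
      using s(1) by (simp add: of_bool_def sum.If_cases Int_absorb1 Int_absorb2)
    finally show "(\<Sum>j<num_psu D. sample_prob s * of_bool (insert j A \<subseteq> s))
        = real (size_I D) * (sample_prob s * of_bool (A \<subseteq> s))"
      by (simp only: s(2) ac_simps)
  qed
  also have "\<dots> = real (size_I D) * incl_prob A"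
    unfolding incl_prob_def sum_distrib_left ..
  finally show ?thesis .
qed

text \<open>Serves to derive unconditional facts, such as measurability or inequalities between
  moments, from hypotheses on conditional laws: they are evaluated on one suitable sample.\<close>

lemma incl_prob_pos_sample:
  assumes "0 < incl_prob A"
  obtains s where "s \<in> samples" "sample_prob s > 0" "A \<subseteq> s"
proof -
  have "\<exists>s\<in>samples. sample_prob s * of_bool (A \<subseteq> s) \<noteq> 0"
  proof (rule ccontr)
    assume "\<not> ?thesis"
    then have "incl_prob A = 0" unfolding incl_prob_def by (intro sum.neutral) blast
    with assms show False by simp
  qed
  then obtain s where s: "s \<in> samples" "sample_prob s \<noteq> 0" "A \<subseteq> s" by auto
  with sample_prob_nonneg[of s] that[of s] show ?thesis by (auto simp: less_le)
qed

section \<open>Centered moments of the inclusion indicators\<close>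

lemma centered_moment2:
  "expectation (\<lambda>w. (incl_I D i w - pi_I D i) * (incl_I D j w - pi_I D j))
   = incl_prob {i, j} - incl_prob {i} * incl_prob {j}"
proof -
  let ?a = "incl_prob {i}" and ?b = "incl_prob {j}"
  have "expectation (\<lambda>w. (incl_I D i w - pi_I D i) * (incl_I D j w - pi_I D j))
    = (\<Sum>s\<in>samples. sample_prob s * ((of_bool (i \<in> s) - ?a) * (of_bool (j \<in> s) - ?b)))"
    unfolding incl_I_eq pi_I_eq by (rule expectation_sample_function)
  also have "\<dots> = (\<Sum>s\<in>samples. sample_prob s * of_bool ({i, j} \<subseteq> s)
      - ?b * (sample_prob s * of_bool ({i} \<subseteq> s))
      - ?a * (sample_prob s * of_bool ({j} \<subseteq> s)) + ?a * ?b * sample_prob s)"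
    by (intro sum.cong refl) (simp add: of_bool_conj algebra_simps)
  also have "\<dots> = incl_prob {i, j} - incl_prob {i} * incl_prob {j}"
    unfolding sum.distrib sum_subtractf sum_distrib_left[symmetric] incl_prob_def[symmetric]
      sum_sample_prob by (simp add: algebra_simps)
  finally show ?thesis .
qed

lemma centered_moment3:
  "expectation (\<lambda>w. (incl_I D i w - pi_I D i) * (incl_I D j w - pi_I D j) *
      (incl_I D k w - pi_I D k))
   = incl_prob {i, j, k} - incl_prob {i} * incl_prob {j, k} - incl_prob {j} * incl_prob {i, k}
     - incl_prob {k} * incl_prob {i, j} + 2 * incl_prob {i} * incl_prob {j} * incl_prob {k}"
proof -
  let ?a = "incl_prob {i}" and ?b = "incl_prob {j}" and ?c = "incl_prob {k}"
  let ?p = "\<lambda>A s. sample_prob s * of_bool (A \<subseteq> s)"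
  have "expectation (\<lambda>w. (incl_I D i w - pi_I D i) * (incl_I D j w - pi_I D j) *
      (incl_I D k w - pi_I D k))
    = (\<Sum>s\<in>samples. sample_prob s * ((of_bool (i \<in> s) - ?a) * (of_bool (j \<in> s) - ?b) *
        (of_bool (k \<in> s) - ?c)))"
    unfolding incl_I_eq pi_I_eq by (rule expectation_sample_function)
  also have "\<dots> = (\<Sum>s\<in>samples. ?p {i, j, k} s
      - ?a * ?p {j, k} s - ?b * ?p {i, k} s - ?c * ?p {i, j} s
      + ?b * ?c * ?p {i} s + ?a * ?c * ?p {j} s + ?a * ?b * ?p {k} s - ?a * ?b * ?c * sample_prob s)"
    by (intro sum.cong refl) (simp add: of_bool_conj algebra_simps)
  also have "\<dots> = incl_prob {i, j, k} - incl_prob {i} * incl_prob {j, k}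
     - incl_prob {j} * incl_prob {i, k}
     - incl_prob {k} * incl_prob {i, j} + 2 * incl_prob {i} * incl_prob {j} * incl_prob {k}"
    unfolding sum.distrib sum_subtractf sum_distrib_left[symmetric] incl_prob_def[symmetric]
      sum_sample_prob by (simp add: algebra_simps)
  finally show ?thesis .
qed

lemma centered_moment4:
  "expectation (\<lambda>w. (incl_I D i w - pi_I D i) * (incl_I D j w - pi_I D j) *
      (incl_I D k w - pi_I D k) * (incl_I D l w - pi_I D l))
   = incl_prob {i, j, k, l}
     - incl_prob {i} * incl_prob {j, k, l} - incl_prob {j} * incl_prob {i, k, l}
     - incl_prob {k} * incl_prob {i, j, l} - incl_prob {l} * incl_prob {i, j, k}
     + incl_prob {i} * incl_prob {j} * incl_prob {k, l}
     + incl_prob {i} * incl_prob {k} * incl_prob {j, l}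
     + incl_prob {i} * incl_prob {l} * incl_prob {j, k}
     + incl_prob {j} * incl_prob {k} * incl_prob {i, l}
     + incl_prob {j} * incl_prob {l} * incl_prob {i, k}
     + incl_prob {k} * incl_prob {l} * incl_prob {i, j}
     - 3 * incl_prob {i} * incl_prob {j} * incl_prob {k} * incl_prob {l}"
  (is "?L = ?R")
proof -
  let ?a = "incl_prob {i}" and ?b = "incl_prob {j}" and ?c = "incl_prob {k}"
    and ?d = "incl_prob {l}"
  let ?p = "\<lambda>A s. sample_prob s * of_bool (A \<subseteq> s)"
  have "?L
    = (\<Sum>s\<in>samples. sample_prob s * ((of_bool (i \<in> s) - ?a) * (of_bool (j \<in> s) - ?b) *
        (of_bool (k \<in> s) - ?c) * (of_bool (l \<in> s) - ?d)))"
    unfolding incl_I_eq pi_I_eq by (rule expectation_sample_function)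
  also have "\<dots> = (\<Sum>s\<in>samples. ?p {i, j, k, l} s
      - ?a * ?p {j, k, l} s - ?b * ?p {i, k, l} s - ?c * ?p {i, j, l} s - ?d * ?p {i, j, k} s
      + ?a * ?b * ?p {k, l} s + ?a * ?c * ?p {j, l} s + ?a * ?d * ?p {j, k} s
      + ?b * ?c * ?p {i, l} s + ?b * ?d * ?p {i, k} s + ?c * ?d * ?p {i, j} s
      - ?b * ?c * ?d * ?p {i} s - ?a * ?c * ?d * ?p {j} s - ?a * ?b * ?d * ?p {k} s
      - ?a * ?b * ?c * ?p {l} s + ?a * ?b * ?c * ?d * sample_prob s)"
    by (intro sum.cong refl) (simp add: of_bool_conj algebra_simps)
  \<comment> \<open>Each of the four terms with a single indicator integrates to minus the product
    of all first order probabilities, and the constant term adds that product once: this is the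
    coefficient -3.\<close>
  also have "\<dots> = ?R"
    unfolding sum.distrib sum_subtractf sum_distrib_left[symmetric] incl_prob_def[symmetric]
      sum_sample_prob by (simp add: algebra_simps)
  finally show ?thesis .
qed

end

lemma (in prob_space)
  fixes T :: "'i \<Rightarrow> 'a \<Rightarrow> real"
  assumes int: "\<And>p. p \<in> P \<Longrightarrow> integrable M (T p)"
    and int2: "\<And>p q. p \<in> P \<Longrightarrow> q \<in> P \<Longrightarrow> integrable M (\<lambda>w. T p w * T q w)"
  shows integrable_sum_centered_square:
      "integrable M (\<lambda>w. ((\<Sum>p\<in>P. T p w) - (\<Sum>p\<in>P. expectation (T p)))\<^sup>2)"
    and expectation_sum_centered_square:
      "expectation (\<lambda>w. ((\<Sum>p\<in>P. T p w) - (\<Sum>p\<in>P. expectation (T p)))\<^sup>2) =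
       (\<Sum>p\<in>P. \<Sum>q\<in>P. expectation (\<lambda>w. T p w * T q w) - expectation (T p) * expectation (T q))"
proof -
  have eq: "((\<Sum>p\<in>P. T p w) - (\<Sum>p\<in>P. expectation (T p)))\<^sup>2 =
      (\<Sum>p\<in>P. \<Sum>q\<in>P. T p w * T q w - expectation (T q) * T p w
        - expectation (T p) * T q w + expectation (T p) * expectation (T q))" for w
    by (simp add: power2_eq_square sum_subtractf[symmetric] sum_product algebra_simps)
  have int3: "integrable M (\<lambda>w. T p w * T q w - expectation (T q) * T p w
        - expectation (T p) * T q w + expectation (T p) * expectation (T q))"
    if "p \<in> P" "q \<in> P" for p q
    using int int2 that by simp
  show "integrable M (\<lambda>w. ((\<Sum>p\<in>P. T p w) - (\<Sum>p\<in>P. expectation (T p)))\<^sup>2)"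
    unfolding eq using int3 by (intro Bochner_Integration.integrable_sum)
  have "expectation (\<lambda>w. ((\<Sum>p\<in>P. T p w) - (\<Sum>p\<in>P. expectation (T p)))\<^sup>2) =
    (\<Sum>p\<in>P. \<Sum>q\<in>P. expectation (\<lambda>w. T p w * T q w - expectation (T q) * T p w
        - expectation (T p) * T q w + expectation (T p) * expectation (T q)))"
    unfolding eq using int3
    by (subst Bochner_Integration.integral_sum)
      (auto intro!: sum.cong Bochner_Integration.integral_sum Bochner_Integration.integrable_sum)
  also have "\<dots> = (\<Sum>p\<in>P. \<Sum>q\<in>P.
      expectation (\<lambda>w. T p w * T q w) - expectation (T p) * expectation (T q))"
    using int int2 by (intro sum.cong refl) (simp add: prob_space)
  finally show "expectation (\<lambda>w. ((\<Sum>p\<in>P. T p w) - (\<Sum>p\<in>P. expectation (T p)))\<^sup>2) =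
       (\<Sum>p\<in>P. \<Sum>q\<in>P. expectation (\<lambda>w. T p w * T q w) - expectation (T p) * expectation (T q))" .
qed

section \<open>Orders of magnitude of the inclusion probabilities\<close>

locale first_stage_bounds = first_stage D for D :: "('a::euclidean_space, 'w) two_stage" +
  fixes cL cU C2 C3 C4 c2 :: real
  assumes num_psu_pos: "0 < num_psu D"
    and size_I_pos: "0 < size_I D"
    and size_I_le: "size_I D \<le> num_psu D"
    and const_pos: "0 < cL" "0 < cU" "0 < C2" "0 < C3" "0 < C4" "0 < c2"
    and pi_lower: "i < num_psu D \<Longrightarrow> cL * (real (size_I D) / real (num_psu D)) \<le> pi_I D i"
    and pi_upper: "i < num_psu D \<Longrightarrow> pi_I D i \<le> cU * (real (size_I D) / real (num_psu D))"
    and moment2: "i < num_psu D \<Longrightarrow> j < num_psu D \<Longrightarrow> i \<noteq> j \<Longrightarrow>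
      \<bar>expectation (\<lambda>w. (incl_I D i w - pi_I D i) * (incl_I D j w - pi_I D j))\<bar>
        \<le> C2 * real (size_I D) / real (num_psu D) ^ 2"
    and moment3: "i < num_psu D \<Longrightarrow> j < num_psu D \<Longrightarrow> k < num_psu D \<Longrightarrow>
      distinct [i, j, k] \<Longrightarrow>
      \<bar>expectation (\<lambda>w. (incl_I D i w - pi_I D i) * (incl_I D j w - pi_I D j) *
          (incl_I D k w - pi_I D k))\<bar>
        \<le> C3 * real (size_I D) ^ 2 / real (num_psu D) ^ 3"
    and moment4: "i < num_psu D \<Longrightarrow> j < num_psu D \<Longrightarrow> k < num_psu D \<Longrightarrow> l < num_psu D \<Longrightarrow>
      distinct [i, j, k, l] \<Longrightarrow>
      \<bar>expectation (\<lambda>w. (incl_I D i w - pi_I D i) * (incl_I D j w - pi_I D j) *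
          (incl_I D k w - pi_I D k) * (incl_I D l w - pi_I D l))\<bar>
        \<le> C4 * real (size_I D) ^ 2 / real (num_psu D) ^ 4"
    and pi2_lower: "i < num_psu D \<Longrightarrow> j < num_psu D \<Longrightarrow> i \<noteq> j \<Longrightarrow>
      c2 * real (size_I D) ^ 2 / real (num_psu D) ^ 2 \<le> pi_I2 D i j"
begin

definition rate :: real where
  "rate = real (size_I D) / real (num_psu D)"

text \<open>\<open>K2\<close> adds the covariance bound to the product of first order bounds;
  \<open>K3\<close> adds to the third centered moment three products of a first and a second order
  probability. \<open>K4\<close> counts the ten terms of the expansion in
  \<open>incl4_bound\<close>: one fourth moment, four third moments times a probability, four
  covariances times two probabilities, one product of covariances.\<close>

definition K2 :: real where "K2 = cU\<^sup>2 + C2"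
definition K3 :: real where "K3 = C3 + 3 * cU * K2"
definition K4 :: real where "K4 = C4 + 4 * cU * C3 + 4 * cU\<^sup>2 * C2 + C2\<^sup>2"

lemma rate_pos: "0 < rate" and rate_le_1: "rate \<le> 1"
  using num_psu_pos size_I_pos size_I_le by (auto simp: rate_def)

lemma K_pos: "0 < K2" "0 < K3" "0 < K4"
  using const_pos by (auto simp: K2_def K3_def K4_def add_pos_pos)

lemma incl_lower: "i < num_psu D \<Longrightarrow> cL * rate \<le> incl_prob {i}"
  and incl_upper: "i < num_psu D \<Longrightarrow> incl_prob {i} \<le> cU * rate"
  using pi_lower pi_upper by (auto simp: rate_def pi_I_eq)

lemma incl_pos: "i < num_psu D \<Longrightarrow> 0 < incl_prob {i}"
  using incl_lower const_pos rate_pos by (meson less_le_trans mult_pos_pos)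

lemma incl2_pos:
  assumes "i < num_psu D" "j < num_psu D" "i \<noteq> j"
  shows "0 < incl_prob {i, j}"
proof -
  have "0 < c2 * real (size_I D) ^ 2 / real (num_psu D) ^ 2"
    using const_pos num_psu_pos size_I_pos by simp
  then show ?thesis using pi2_lower[OF assms] by (simp add: pi_I2_eq)
qed

lemma cov2_bound:
  assumes "i < num_psu D" "j < num_psu D" "i \<noteq> j"
  shows "\<bar>incl_prob {i, j} - incl_prob {i} * incl_prob {j}\<bar> \<le> C2 * (rate\<^sup>2 / real (size_I D))"
  using moment2[OF assms] size_I_pos
  by (simp add: centered_moment2 rate_def power2_eq_square)

lemma rate_powers:
  "real (size_I D) ^ 2 / real (num_psu D) ^ 3 = rate ^ 3 / real (size_I D)"
  "real (size_I D) ^ 2 / real (num_psu D) ^ 4 = rate ^ 4 / real (size_I D) ^ 2"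
  using size_I_pos num_psu_pos by (auto simp: rate_def field_simps eval_nat_numeral)

lemma incl2_bound:
  assumes "i < num_psu D" "j < num_psu D" "i \<noteq> j"
  shows "incl_prob {i, j} \<le> K2 * rate\<^sup>2"
proof -
  have "incl_prob {i} * incl_prob {j} \<le> (cU * rate) * (cU * rate)"
    using assms incl_upper const_pos rate_pos by (intro mult_mono) auto
  moreover have "rate\<^sup>2 / real (size_I D) \<le> rate\<^sup>2"
    using size_I_pos by (simp add: divide_le_eq mult_le_cancel_left1)
  then have "C2 * (rate\<^sup>2 / real (size_I D)) \<le> C2 * rate\<^sup>2"
    using const_pos by (intro mult_left_mono) auto
  ultimately show ?thesis
    using cov2_bound[OF assms] unfolding K2_def by (simp add: power2_eq_square algebra_simps)
qed

lemma incl3_bound: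
  assumes "i < num_psu D" "j < num_psu D" "k < num_psu D" "distinct [i, j, k]"
  shows "incl_prob {i, j, k} \<le> K3 * rate ^ 3"
proof -
  have ne: "i \<noteq> j" "i \<noteq> k" "j \<noteq> k" using assms(4) by auto
  have "rate ^ 3 / real (size_I D) \<le> rate ^ 3"
    using size_I_pos rate_pos by (simp add: divide_le_eq mult_le_cancel_left1)
  then have C3: "C3 * (rate ^ 3 / real (size_I D)) \<le> C3 * rate ^ 3"
    using const_pos by (intro mult_left_mono) auto
  have prod: "incl_prob {x} * incl_prob {y, z} \<le> (cU * rate) * (K2 * rate\<^sup>2)"
    if "x < num_psu D" "y < num_psu D" "z < num_psu D" "y \<noteq> z" for x y z
    using that incl_upper incl2_bound const_pos rate_pos K_pos by (intro mult_mono) auto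
  have "0 \<le> 2 * incl_prob {i} * incl_prob {j} * incl_prob {k}" by simp
  moreover have "incl_prob {i, j, k} - incl_prob {i} * incl_prob {j, k}
      - incl_prob {j} * incl_prob {i, k} - incl_prob {k} * incl_prob {i, j}
      + 2 * incl_prob {i} * incl_prob {j} * incl_prob {k} \<le> C3 * (rate ^ 3 / real (size_I D))"
    using moment3[OF assms] by (simp add: centered_moment3 rate_powers flip: times_divide_eq_right)
  ultimately have "incl_prob {i, j, k} \<le> C3 * rate ^ 3 + 3 * ((cU * rate) * (K2 * rate\<^sup>2))"
    using C3 prod[OF assms(1,2,3) ne(3)] prod[OF assms(2,1,3) ne(2)] prod[OF assms(3,1,2) ne(1)]
    by linarith
  also have "\<dots> = K3 * rate ^ 3" by (simp add: K3_def power2_eq_square power3_eq_cube algebra_simps)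
  finally show ?thesis .
qed

text \<open>Since \<open>rate ^ 3 / N = rate ^ 4 / n\<close>, this gains a factor \<open>n\<close>
  over the crude order. Every term that survives the expansion contains a centered moment, and by
  the assumed bounds each of these is smaller than the matching product of probabilities by at least
  a factor \<open>n\<close>.\<close>

lemma incl4_bound:
  assumes "i < num_psu D" "j < num_psu D" "k < num_psu D" "l < num_psu D" "distinct [i, j, k, l]"
  shows "\<bar>incl_prob {i, j, k, l} - incl_prob {i, j} * incl_prob {k, l}\<bar>
    \<le> K4 * (rate ^ 3 / real (num_psu D))"
proof -
  define N n where "N = real (num_psu D)" and "n = real (size_I D)"
  have N: "N \<ge> 1" "n \<ge> 1" "n \<le> N" using num_psu_pos size_I_pos size_I_le by (auto simp: N_def n_def)
  have rn: "rate = n / N" by (simp add: rate_def N_def n_def)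
  let ?p = incl_prob
  define e2 where "e2 x y = ?p {x, y} - ?p {x} * ?p {y}" for x y
  define e3 where "e3 x y z = expectation (\<lambda>w. (incl_I D x w - pi_I D x) *
      (incl_I D y w - pi_I D y) * (incl_I D z w - pi_I D z))" for x y z
  define e4 where "e4 = expectation (\<lambda>w. (incl_I D i w - pi_I D i) * (incl_I D j w - pi_I D j) *
      (incl_I D k w - pi_I D k) * (incl_I D l w - pi_I D l))"
  define B where "B = n ^ 3 / N ^ 4"
  have B: "rate ^ 3 / real (num_psu D) = B"
    by (simp add: B_def rn N_def power_divide eval_nat_numeral)
  \<comment> \<open>Of the six covariances in the fourth order probability, those of
    \<open>(i, j)\<close> and \<open>(k, l)\<close> cancel against
    \<open>?p {i, j} * ?p {k, l}\<close>, as does the product of the four first order probabilities.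
    The four cross covariances remain, and \<open>e2 i j * e2 k l\<close> is what is left of the
    subtracted product.\<close>
  have id: "?p {i, j, k, l} - ?p {i, j} * ?p {k, l} =
      e4 + (?p {i} * e3 j k l + ?p {j} * e3 i k l + ?p {k} * e3 i j l + ?p {l} * e3 i j k)
      + (?p {i} * ?p {k} * e2 j l + ?p {i} * ?p {l} * e2 j k
         + ?p {j} * ?p {k} * e2 i l + ?p {j} * ?p {l} * e2 i k) - e2 i j * e2 k l"
    unfolding e2_def e3_def e4_def centered_moment3 centered_moment4 by algebra
  have e2: "\<bar>e2 x y\<bar> \<le> C2 * (n / N\<^sup>2)" if "x < num_psu D" "y < num_psu D" "x \<noteq> y" for x y
    using moment2[OF that] by (simp add: centered_moment2 e2_def N_def n_def)
  have e3: "\<bar>e3 x y z\<bar> \<le> C3 * (n\<^sup>2 / N ^ 3)"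
    if "x < num_psu D" "y < num_psu D" "z < num_psu D" "distinct [x, y, z]" for x y z
    using moment3[OF that] by (simp add: e3_def N_def n_def)
  have p1: "\<bar>?p {x}\<bar> \<le> cU * (n / N)" if "x < num_psu D" for x
    using incl_upper[OF that] by (simp add: rn)
  have "n\<^sup>2 \<le> n ^ 3" using N by (intro power_increasing) auto
  then have nB: "n\<^sup>2 / N ^ 4 \<le> B" unfolding B_def using N by (intro divide_right_mono) auto
  \<comment> \<open>Like the product of two covariances below, this term is of order
    \<open>n\<^sup>2 / N ^ 4\<close>, one power of \<open>n\<close> better than the others; it is
    weakened to the common bound \<open>B\<close>.\<close>
  have e4: "\<bar>e4\<bar> \<le> C4 * B"
  proof -
    have "\<bar>e4\<bar> \<le> C4 * (n\<^sup>2 / N ^ 4)"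
      using moment4[OF assms] by (simp add: e4_def N_def n_def)
    also have "\<dots> \<le> C4 * B" using nB const_pos by (intro mult_left_mono) auto
    finally show ?thesis .
  qed
  have t3: "\<bar>?p {u} * e3 x y z\<bar> \<le> cU * C3 * B"
    if "u < num_psu D" "x < num_psu D" "y < num_psu D" "z < num_psu D" "distinct [x, y, z]" for u x y z
  proof -
    have "\<bar>?p {u} * e3 x y z\<bar> \<le> (cU * (n / N)) * (C3 * (n\<^sup>2 / N ^ 3))"
      unfolding abs_mult using that const_pos N by (intro mult_mono p1 e3) auto
    also have "\<dots> = cU * C3 * B" by (simp add: B_def eval_nat_numeral)
    finally show ?thesis .
  qed
  have t2: "\<bar>?p {u} * ?p {v} * e2 x y\<bar> \<le> cU\<^sup>2 * C2 * B"
    if "u < num_psu D" "v < num_psu D" "x < num_psu D" "y < num_psu D" "x \<noteq> y" for u v x y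
  proof -
    have "\<bar>?p {u} * ?p {v} * e2 x y\<bar> \<le> (cU * (n / N)) * (cU * (n / N)) * (C2 * (n / N\<^sup>2))"
      unfolding abs_mult using that const_pos N by (intro mult_mono p1 e2) auto
    also have "\<dots> = cU\<^sup>2 * C2 * B" by (simp add: B_def ac_simps eval_nat_numeral)
    finally show ?thesis .
  qed
  have t22: "\<bar>e2 i j * e2 k l\<bar> \<le> C2\<^sup>2 * B"
  proof -
    have "\<bar>e2 i j * e2 k l\<bar> \<le> (C2 * (n / N\<^sup>2)) * (C2 * (n / N\<^sup>2))"
      unfolding abs_mult using assms const_pos N by (intro mult_mono e2) auto
    also have "\<dots> = C2\<^sup>2 * (n\<^sup>2 / N ^ 4)" by (simp add: ac_simps eval_nat_numeral)
    also have "\<dots> \<le> C2\<^sup>2 * B" using nB by (intro mult_left_mono) auto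
    finally show ?thesis .
  qed
  have ne: "i \<noteq> k" "i \<noteq> l" "j \<noteq> k" "j \<noteq> l" "distinct [j, k, l]" "distinct [i, k, l]"
      "distinct [i, j, l]" "distinct [i, j, k]"
    using assms(5) by auto
  have triangle: "\<bar>a + (b1 + b2 + b3 + b4) + (c1 + c2 + c3 + c4) - d\<bar> \<le> A + 4 * B' + 4 * C + E"
    if "\<bar>a\<bar> \<le> A" "\<bar>b1\<bar> \<le> B'" "\<bar>b2\<bar> \<le> B'" "\<bar>b3\<bar> \<le> B'" "\<bar>b4\<bar> \<le> B'"
      "\<bar>c1\<bar> \<le> C" "\<bar>c2\<bar> \<le> C" "\<bar>c3\<bar> \<le> C" "\<bar>c4\<bar> \<le> C" "\<bar>d\<bar> \<le> E"
    for a b1 b2 b3 b4 c1 c2 c3 c4 d A B' C E :: real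
    using that unfolding abs_le_iff by linarith
  have "\<bar>?p {i, j, k, l} - ?p {i, j} * ?p {k, l}\<bar> \<le>
      C4 * B + 4 * (cU * C3 * B) + 4 * (cU\<^sup>2 * C2 * B) + C2\<^sup>2 * B"
    unfolding id
    by (intro triangle e4 t22 t3[OF assms(1,2,3,4) ne(5)] t3[OF assms(2,1,3,4) ne(6)]
      t3[OF assms(3,1,2,4) ne(7)] t3[OF assms(4,1,2,3) ne(8)]
      t2[OF assms(1,3,2,4) ne(4)] t2[OF assms(1,4,2,3) ne(3)]
      t2[OF assms(2,3,1,4) ne(2)] t2[OF assms(2,4,1,3) ne(1)])
  also have "\<dots> = K4 * B" by (simp add: K4_def algebra_simps)
  finally show ?thesis by (simp only: B)
qed

text \<open>The numerator is of order \<open>n / N\<^sup>2\<close>, and the lower bound on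
  \<open>pi_I2\<close> keeps the denominator at order \<open>n\<^sup>2 / N\<^sup>2\<close>: each
  weight gains its factor \<open>1 / n\<close> here.\<close>

lemma weight_bound:
  assumes "i < num_psu D" "j < num_psu D" "i \<noteq> j"
  shows "\<bar>Delta_I D i j / pi_I2 D i j\<bar> \<le> (C2 / c2) / real (size_I D)"
proof -
  define N n where "N = real (num_psu D)" and "n = real (size_I D)"
  have N: "N \<ge> 1" "n \<ge> 1" using num_psu_pos size_I_pos by (auto simp: N_def n_def)
  have lo: "0 < c2 * n\<^sup>2 / N\<^sup>2" "c2 * n\<^sup>2 / N\<^sup>2 \<le> pi_I2 D i j"
    using N const_pos pi2_lower[OF assms] by (auto simp: N_def n_def)
  have "\<bar>Delta_I D i j / pi_I2 D i j\<bar> = \<bar>Delta_I D i j\<bar> / pi_I2 D i j"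
    using lo by simp
  also have "\<dots> \<le> (C2 * n / N\<^sup>2) / (c2 * n\<^sup>2 / N\<^sup>2)"
    using lo moment2[OF assms, unfolded centered_moment2] const_pos N
    by (intro frac_le) (auto simp: Delta_I_def pi_I2_eq pi_I_eq N_def n_def)
  also have "\<dots> = (C2 / c2) / n" using N const_pos by (simp add: field_simps power2_eq_square)
  finally show ?thesis by (simp add: n_def)
qed

text \<open>The row sum is the covariance of one inclusion indicator with the sample size, which is
  constant.\<close>

lemma sum_Delta_I:
  assumes "i < num_psu D"
  shows "(\<Sum>j<num_psu D. Delta_I D i j) = 0"
proof -
  have "(\<Sum>j<num_psu D. incl_prob {j, i}) = real (size_I D) * incl_prob {i}"
    by (rule sum_incl_prob_insert)
  moreover have "(\<Sum>j<num_psu D. incl_prob {j}) = real (size_I D)"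
    using sum_incl_prob_insert[of "{}"] by (simp add: incl_prob_def sum_sample_prob)
  ultimately show ?thesis
    unfolding Delta_I_def pi_I2_eq pi_I_eq sum_subtractf
    by (simp add: insert_commute flip: sum_distrib_left)
qed

lemma Delta_I_commute: "Delta_I D i j = Delta_I D j i"
  by (simp add: Delta_I_def pi_I2_eq insert_commute)

lemma Delta_I_self: "Delta_I D i i = pi_I D i - (pi_I D i)\<^sup>2"
  by (simp add: Delta_I_def pi_I2_eq pi_I_eq power2_eq_square)

end

section \<open>The Yates--Grundy estimator\<close>

lemma (in finite_measure) integrable_power_le:
  fixes X :: "'a \<Rightarrow> real"
  assumes X: "X \<in> borel_measurable M" and int: "integrable M (\<lambda>w. X w ^ n)" and "even n" "k \<le> n"
  shows "integrable M (\<lambda>w. X w ^ k)"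
proof (rule Bochner_Integration.integrable_bound)
  show "integrable M (\<lambda>w. 1 + X w ^ n)" using int by simp
  show "(\<lambda>w. X w ^ k) \<in> borel_measurable M" using X by measurable
  show "AE w in M. norm (X w ^ k) \<le> norm (1 + X w ^ n)"
  proof (rule AE_I2)
    fix w
    have "\<bar>X w\<bar> ^ k \<le> 1 + \<bar>X w\<bar> ^ n"
    proof (cases "\<bar>X w\<bar> \<le> 1")
      case True
      then show ?thesis by (intro order_trans[OF power_le_one]) auto
    next
      case False
      then have "\<bar>X w\<bar> ^ k \<le> \<bar>X w\<bar> ^ n" using assms(4) by (intro power_increasing) auto
      then show ?thesis by simp
    qed
    then show "norm (X w ^ k) \<le> norm (1 + X w ^ n)"
      using \<open>even n\<close> by (simp add: power_abs power_even_abs)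
  qed
qed

lemma (in prob_space) power2_expectation_le:
  fixes X :: "'a \<Rightarrow> real"
  assumes "X \<in> borel_measurable M" "integrable M (\<lambda>w. (X w)\<^sup>2)"
  shows "(expectation X)\<^sup>2 \<le> expectation (\<lambda>w. (X w)\<^sup>2)"
proof -
  have "integrable M X" using assms by (rule square_integrable_imp_integrable)
  then have "variance X = expectation (\<lambda>w. (X w)\<^sup>2) - (expectation X)\<^sup>2"
    using assms by (intro variance_eq)
  then show ?thesis using variance_positive[of X] by linarith
qed

lemma (in prob_space)
  fixes X :: "'i \<Rightarrow> 'a \<Rightarrow> real"
  assumes X: "indep_vars (\<lambda>_. borel) X I" "A \<inter> B = {}" "A \<subseteq> I" "B \<subseteq> I"
    and gh: "g \<in> borel_measurable (PiM A (\<lambda>_. borel))" "h \<in> borel_measurable (PiM B (\<lambda>_. borel))"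
    and int: "integrable M (\<lambda>w. g (restrict (\<lambda>i. X i w) A) :: real)"
      "integrable M (\<lambda>w. h (restrict (\<lambda>i. X i w) B) :: real)"
  shows integrable_indep_blocks:
      "integrable M (\<lambda>w. g (restrict (\<lambda>i. X i w) A) * h (restrict (\<lambda>i. X i w) B))"
    and expectation_indep_blocks:
      "expectation (\<lambda>w. g (restrict (\<lambda>i. X i w) A) * h (restrict (\<lambda>i. X i w) B)) =
        expectation (\<lambda>w. g (restrict (\<lambda>i. X i w) A)) * expectation (\<lambda>w. h (restrict (\<lambda>i. X i w) B))"
proof -
  have "indep_var borel (g \<circ> (\<lambda>w. restrict (\<lambda>i. X i w) A)) borel (h \<circ> (\<lambda>w. restrict (\<lambda>i. X i w) B))"
    using indep_var_restrict[OF X] gh by (rule indep_var_compose)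
  then have ind: "indep_var borel (\<lambda>w. g (restrict (\<lambda>i. X i w) A)) borel (\<lambda>w. h (restrict (\<lambda>i. X i w) B))"
    by (simp add: comp_def)
  show "integrable M (\<lambda>w. g (restrict (\<lambda>i. X i w) A) * h (restrict (\<lambda>i. X i w) B))"
    by (rule indep_var_integrable[OF ind int])
  show "expectation (\<lambda>w. g (restrict (\<lambda>i. X i w) A) * h (restrict (\<lambda>i. X i w) B)) =
        expectation (\<lambda>w. g (restrict (\<lambda>i. X i w) A)) * expectation (\<lambda>w. h (restrict (\<lambda>i. X i w) B))"
    by (rule indep_var_lebesgue_integral[OF ind int])
qed

lemma (in prob_space)
  fixes X :: "'i \<Rightarrow> 'a \<Rightarrow> real"
  assumes X: "indep_vars (\<lambda>_. borel) X I" and ij: "i \<in> I" "j \<in> I" "i \<noteq> j"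
    and int: "integrable M (X i)" "integrable M (X j)"
  shows integrable_indep_mult: "integrable M (\<lambda>w. X i w * X j w)"
    and expectation_indep_mult: "expectation (\<lambda>w. X i w * X j w) = expectation (X i) * expectation (X j)"
  using integrable_indep_blocks[OF X, of "{i}" "{j}" "\<lambda>f. f i" "\<lambda>f. f j"]
    expectation_indep_blocks[OF X, of "{i}" "{j}" "\<lambda>f. f i" "\<lambda>f. f j"] ij int by auto

text \<open>The two-term inequality for squares is applied twice, first to \<open>a - b\<close> and
  then to the sum of squares, which gives the constant \<open>2\<^sup>2 * 2\<close>. It bounds the
  fourth moment of a difference without mixed moments.\<close>

lemma power4_diff_le: "(a - b) ^ 4 \<le> 8 * (a ^ 4 + b ^ 4)" for a b :: real
proof -
  have 1: "(x - y)\<^sup>2 \<le> 2 * (x\<^sup>2 + y\<^sup>2)" for x y :: real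
    using zero_le_power2[of "x + y"] by (simp add: power2_eq_square algebra_simps)
  have 2: "(x + y)\<^sup>2 \<le> 2 * (x\<^sup>2 + y\<^sup>2)" for x y :: real
    using zero_le_power2[of "x - y"] by (simp add: power2_eq_square algebra_simps)
  have "((a - b)\<^sup>2)\<^sup>2 \<le> (2 * (a\<^sup>2 + b\<^sup>2))\<^sup>2"
    by (intro power_mono 1) auto
  also have "\<dots> = 4 * (a\<^sup>2 + b\<^sup>2)\<^sup>2" by (simp add: power2_eq_square algebra_simps)
  also have "\<dots> \<le> 4 * (2 * ((a\<^sup>2)\<^sup>2 + (b\<^sup>2)\<^sup>2))" by (intro mult_left_mono 2) auto
  finally show ?thesis by (simp flip: power_mult)
qed

text \<open>An abstract second stage: \<open>Y i\<close> stands for the estimated total of PSU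
  \<open>i\<close>, with mean \<open>\<mu> i\<close>, variance \<open>v i\<close> and a bound
  \<open>b i\<close> for the fourth moment. That these numbers do not depend on \<open>s\<close>
  expresses the invariance of the second stage.\<close>

locale second_stage = first_stage_bounds D cL cU C2 C3 C4 c2
  for D :: "('a::euclidean_space, 'w) two_stage" and cL cU C2 C3 C4 c2 +
  fixes Y :: "nat \<Rightarrow> 'w \<Rightarrow> real" and \<mu> v b :: "nat \<Rightarrow> real"
  assumes Y_measurable: "i < num_psu D \<Longrightarrow> Y i \<in> borel_measurable (prob_sp D)"
    and Y_indep: "s \<in> samples \<Longrightarrow> sample_prob s > 0 \<Longrightarrow>
      prob_space.indep_vars (cond_first_stage D s) (\<lambda>_. borel) Y s"
    and Y_integrable4: "s \<in> samples \<Longrightarrow> sample_prob s > 0 \<Longrightarrow> i \<in> s \<Longrightarrow>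
      integrable (cond_first_stage D s) (\<lambda>w. Y i w ^ 4)"
    and Y_mean: "s \<in> samples \<Longrightarrow> sample_prob s > 0 \<Longrightarrow> i \<in> s \<Longrightarrow>
      integral\<^sup>L (cond_first_stage D s) (Y i) = \<mu> i"
    and Y_moment2: "s \<in> samples \<Longrightarrow> sample_prob s > 0 \<Longrightarrow> i \<in> s \<Longrightarrow>
      integral\<^sup>L (cond_first_stage D s) (\<lambda>w. (Y i w)\<^sup>2) = v i + (\<mu> i)\<^sup>2"
    and Y_moment4: "s \<in> samples \<Longrightarrow> sample_prob s > 0 \<Longrightarrow> i \<in> s \<Longrightarrow>
      integral\<^sup>L (cond_first_stage D s) (\<lambda>w. Y i w ^ 4) \<le> b i"
    and b_nonneg: "0 \<le> b i"
begin

definition dsq :: "nat \<times> nat \<Rightarrow> 'w \<Rightarrow> real" where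
  "dsq p w = (Y (fst p) w / pi_I D (fst p) - Y (snd p) w / pi_I D (snd p))\<^sup>2"

definition mean_dsq :: "nat \<times> nat \<Rightarrow> real" where
  "mean_dsq p = v (fst p) / (pi_I D (fst p))\<^sup>2 + v (snd p) / (pi_I D (snd p))\<^sup>2
     + (\<mu> (fst p) / pi_I D (fst p) - \<mu> (snd p) / pi_I D (snd p))\<^sup>2"

definition moment4 :: "nat \<Rightarrow> real" where
  "moment4 i = b i / pi_I D i ^ 4"

definition pair_moment4 :: "nat \<times> nat \<Rightarrow> real" where
  "pair_moment4 p = moment4 (fst p) + moment4 (snd p)"

definition pairs :: "(nat \<times> nat) set" where
  "pairs = {p. fst p < num_psu D \<and> snd p < num_psu D \<and> fst p \<noteq> snd p}"

definition members :: "nat \<times> nat \<Rightarrow> nat set" where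
  "members p = {fst p, snd p}"

definition weight :: "nat \<times> nat \<Rightarrow> real" where
  "weight p = Delta_I D (fst p) (snd p) / pi_I2 D (fst p) (snd p)"

lemma pairs_subset: "pairs \<subseteq> {..<num_psu D} \<times> {..<num_psu D}"
  by (auto simp: pairs_def)

lemma finite_pairs [simp]: "finite pairs"
  using pairs_subset by (rule finite_subset) auto

lemma moment4_nonneg: "0 \<le> moment4 i"
  by (simp add: moment4_def b_nonneg)

lemma pair_moment4_nonneg: "0 \<le> pair_moment4 p"
  by (simp add: pair_moment4_def moment4_nonneg)

lemma dsq_measurable [measurable]: "p \<in> pairs \<Longrightarrow> dsq p \<in> borel_measurable (prob_sp D)"
  using Y_measurable[of "fst p"] Y_measurable[of "snd p"]
  unfolding dsq_def pairs_def by auto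

lemma dsq_nonneg [simp]: "0 \<le> dsq p w"
  by (simp add: dsq_def)

section \<open>Second-stage moments given a sample\<close>

context
  fixes s assumes s: "s \<in> samples" "sample_prob s > 0"
begin

interpretation C: prob_space "cond_first_stage D s"
  by (rule cond_prob_space[OF s(2)])

lemma s_less: "i \<in> s \<Longrightarrow> i < num_psu D"
  using s by (auto simp: samples_def)

lemma Y_cond_measurable: "i \<in> s \<Longrightarrow> Y i \<in> borel_measurable (cond_first_stage D s)"
  using Y_measurable[OF s_less] by simp

lemma Y_cond_integrable: "i \<in> s \<Longrightarrow> integrable (cond_first_stage D s) (Y i)"
  using C.integrable_power_le[OF Y_cond_measurable Y_integrable4[OF s], of i 1] by simp

lemma Y_cond_integrable2: "i \<in> s \<Longrightarrow> integrable (cond_first_stage D s) (\<lambda>w. (Y i w)\<^sup>2)"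
  using C.integrable_power_le[OF Y_cond_measurable Y_integrable4[OF s], of i 2] by simp

lemma
  assumes p: "p \<in> pairs" "members p \<subseteq> s"
  shows dsq_integrable2: "integrable (cond_first_stage D s) (\<lambda>w. (dsq p w)\<^sup>2)"
    and dsq_moment2: "integral\<^sup>L (cond_first_stage D s) (\<lambda>w. (dsq p w)\<^sup>2) \<le> 8 * pair_moment4 p"
    and dsq_integrable: "integrable (cond_first_stage D s) (dsq p)"
    and dsq_mean: "integral\<^sup>L (cond_first_stage D s) (dsq p) = mean_dsq p"
proof -
  obtain i j where p_eq: "p = (i, j)" by (cases p)
  have ij: "i \<in> s" "j \<in> s" "i \<noteq> j" using p by (auto simp: p_eq members_def pairs_def)
  let ?B = "\<lambda>w. 8 * (Y i w ^ 4 / pi_I D i ^ 4 + Y j w ^ 4 / pi_I D j ^ 4)"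
  have le: "(dsq p w)\<^sup>2 \<le> ?B w" for w
    using power4_diff_le[of "Y i w / pi_I D i" "Y j w / pi_I D j"]
    by (simp add: dsq_def p_eq power_divide flip: power_mult)
  have intB: "integrable (cond_first_stage D s) ?B"
    using Y_integrable4[OF s] ij by simp
  have meas: "dsq p \<in> borel_measurable (cond_first_stage D s)"
    using dsq_measurable[OF p(1)] by simp
  show int2: "integrable (cond_first_stage D s) (\<lambda>w. (dsq p w)\<^sup>2)"
    using intB meas le by (intro Bochner_Integration.integrable_bound[OF intB]) (auto intro: order_trans[OF le])
  show "integrable (cond_first_stage D s) (dsq p)"
    using meas int2 by (rule C.square_integrable_imp_integrable)
  have "integral\<^sup>L (cond_first_stage D s) (\<lambda>w. (dsq p w)\<^sup>2) \<le> integral\<^sup>L (cond_first_stage D s) ?B"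
    using int2 intB le by (intro integral_mono) auto
  also have "\<dots> = 8 * (integral\<^sup>L (cond_first_stage D s) (\<lambda>w. Y i w ^ 4) / pi_I D i ^ 4
      + integral\<^sup>L (cond_first_stage D s) (\<lambda>w. Y j w ^ 4) / pi_I D j ^ 4)"
    using Y_integrable4[OF s] ij by simp
  also have "\<dots> \<le> 8 * pair_moment4 p"
    unfolding pair_moment4_def moment4_def p_eq fst_conv snd_conv
    using Y_moment4[OF s] ij by (intro mult_left_mono add_mono divide_right_mono) auto
  finally show "integral\<^sup>L (cond_first_stage D s) (\<lambda>w. (dsq p w)\<^sup>2) \<le> 8 * pair_moment4 p" .
  have eq: "dsq p = (\<lambda>w. (Y i w)\<^sup>2 / (pi_I D i)\<^sup>2 + (Y j w)\<^sup>2 / (pi_I D j)\<^sup>2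
      - 2 * (Y i w * Y j w) / (pi_I D i * pi_I D j))"
    by (simp add: dsq_def p_eq fun_eq_iff power2_diff power_divide)
  have prod: "integrable (cond_first_stage D s) (\<lambda>w. Y i w * Y j w)"
      "integral\<^sup>L (cond_first_stage D s) (\<lambda>w. Y i w * Y j w) = \<mu> i * \<mu> j"
    using C.integrable_indep_mult[OF Y_indep[OF s] ij] C.expectation_indep_mult[OF Y_indep[OF s] ij]
      Y_cond_integrable ij Y_mean[OF s] by auto
  show "integral\<^sup>L (cond_first_stage D s) (dsq p) = mean_dsq p"
    unfolding eq using prod Y_cond_integrable2 ij Y_moment2[OF s]
    by (simp add: mean_dsq_def p_eq power2_diff power_divide add_divide_distrib)
qed

text \<open>The bound \<open>2 * x * y \<le> x\<^sup>2 + y\<^sup>2\<close> replaces the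
  Cauchy--Schwarz inequality, so the result stays linear in the moments of the pairs and can be
  summed; it halves the constant 8. The pairs may overlap, hence independence cannot be
  invoked.\<close>

lemma
  assumes p: "p \<in> pairs" "members p \<subseteq> s" and q: "q \<in> pairs" "members q \<subseteq> s"
  shows dsq_mult_integrable: "integrable (cond_first_stage D s) (\<lambda>w. dsq p w * dsq q w)"
    and dsq_mult_le: "integral\<^sup>L (cond_first_stage D s) (\<lambda>w. dsq p w * dsq q w)
      \<le> 4 * (pair_moment4 p + pair_moment4 q)"
proof -
  let ?B = "\<lambda>w. ((dsq p w)\<^sup>2 + (dsq q w)\<^sup>2) / 2"
  have le: "dsq p w * dsq q w \<le> ?B w" for w
    using sum_squares_bound[of "dsq p w" "dsq q w"] by simp
  have intB: "integrable (cond_first_stage D s) ?B"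
    using dsq_integrable2 p q by simp
  show int: "integrable (cond_first_stage D s) (\<lambda>w. dsq p w * dsq q w)"
  proof (rule Bochner_Integration.integrable_bound[OF intB])
    show "(\<lambda>w. dsq p w * dsq q w) \<in> borel_measurable (cond_first_stage D s)"
      using dsq_measurable[OF p(1)] dsq_measurable[OF q(1)] by simp
    show "AE w in cond_first_stage D s. norm (dsq p w * dsq q w) \<le> norm (?B w)"
    proof (rule AE_I2)
      fix w
      show "norm (dsq p w * dsq q w) \<le> norm (?B w)" using le[of w] by simp
    qed
  qed
  have "integral\<^sup>L (cond_first_stage D s) (\<lambda>w. dsq p w * dsq q w) \<le> integral\<^sup>L (cond_first_stage D s) ?B"
    using int intB le by (intro integral_mono) auto
  also have "\<dots> \<le> 4 * (pair_moment4 p + pair_moment4 q)"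
    using dsq_integrable2 dsq_moment2[OF p] dsq_moment2[OF q] p q by simp
  finally show "integral\<^sup>L (cond_first_stage D s) (\<lambda>w. dsq p w * dsq q w)
      \<le> 4 * (pair_moment4 p + pair_moment4 q)" .
qed

lemma dsq_mult_eq:
  assumes p: "p \<in> pairs" "members p \<subseteq> s" and q: "q \<in> pairs" "members q \<subseteq> s"
    and disj: "members p \<inter> members q = {}"
  shows "integral\<^sup>L (cond_first_stage D s) (\<lambda>w. dsq p w * dsq q w) = mean_dsq p * mean_dsq q"
proof -
  \<comment> \<open>\<open>dsq p\<close> as a function of the family \<open>Y\<close> restricted to
    the members of \<open>p\<close>, the form required by independence of disjoint blocks.\<close>
  define g where "g p f = (f (fst p) / pi_I D (fst p) - f (snd p) / pi_I D (snd p))\<^sup>2"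
    for p :: "nat \<times> nat" and f :: "nat \<Rightarrow> real"
  have meas: "g p \<in> borel_measurable (PiM (members p) (\<lambda>_. borel))" for p
    unfolding g_def members_def by measurable
  have dsq_eq: "dsq p w = g p (restrict (\<lambda>i. Y i w) (members p))" for p w
    by (simp add: dsq_def g_def members_def)
  show ?thesis
    using C.expectation_indep_blocks[OF Y_indep[OF s] disj p(2) q(2) meas meas]
      dsq_integrable[OF p] dsq_integrable[OF q] dsq_mean[OF p] dsq_mean[OF q]
    by (simp flip: dsq_eq)
qed

end

lemma members_incl_pos: "p \<in> pairs \<Longrightarrow> 0 < incl_prob (members p)"
  using incl2_pos by (auto simp: pairs_def members_def)

text \<open>Jensen's inequality under the conditional law of one sample containing the pair; such a
  sample exists because second order inclusion probabilities are positive.\<close>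

lemma mean_dsq_square:
  assumes "p \<in> pairs"
  shows "(mean_dsq p)\<^sup>2 \<le> 8 * pair_moment4 p"
proof -
  obtain s where s: "s \<in> samples" "sample_prob s > 0" "members p \<subseteq> s"
    using incl_prob_pos_sample[OF members_incl_pos[OF assms]] by blast
  interpret C: prob_space "cond_first_stage D s"
    by (rule cond_prob_space[OF s(2)])
  have "(mean_dsq p)\<^sup>2 \<le> integral\<^sup>L (cond_first_stage D s) (\<lambda>w. (dsq p w)\<^sup>2)"
    using C.power2_expectation_le[of "dsq p"] dsq_measurable[OF assms]
      dsq_integrable2[OF s(1,2) assms s(3)] dsq_mean[OF s(1,2) assms s(3)] by simp
  also have "\<dots> \<le> 8 * pair_moment4 p" by (rule dsq_moment2[OF s(1,2) assms s(3)])
  finally show ?thesis .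
qed

lemma mean_dsq_mult:
  assumes "p \<in> pairs" "q \<in> pairs"
  shows "\<bar>mean_dsq p * mean_dsq q\<bar> \<le> 4 * (pair_moment4 p + pair_moment4 q)"
proof -
  have "2 * \<bar>mean_dsq p * mean_dsq q\<bar> \<le> (mean_dsq p)\<^sup>2 + (mean_dsq q)\<^sup>2"
    using sum_squares_bound[of "\<bar>mean_dsq p\<bar>" "\<bar>mean_dsq q\<bar>"] by (simp add: abs_mult mult.assoc)
  then show ?thesis using mean_dsq_square[OF assms(1)] mean_dsq_square[OF assms(2)]
    unfolding distrib_left by linarith
qed

text \<open>The indicator turns the double sum over the random sample into a sum over a fixed index
  set, and it removes the values of \<open>Y\<close> at unselected PSUs.\<close>

definition pair_term :: "nat \<times> nat \<Rightarrow> 'w \<Rightarrow> real" where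
  "pair_term p w = of_bool (members p \<subseteq> sample_I D w) * (weight p * dsq p w)"

lemma
  assumes p: "p \<in> pairs"
  shows pair_term_integrable: "integrable (prob_sp D) (pair_term p)"
    and pair_term_mean: "expectation (pair_term p) = weight p * (incl_prob (members p) * mean_dsq p)"
proof -
  have [measurable]: "dsq p \<in> borel_measurable (prob_sp D)" using p by simp
  have *: "integrable (cond_first_stage D s) (\<lambda>w. weight p * dsq p w)"
    "integral\<^sup>L (cond_first_stage D s) (\<lambda>w. weight p * dsq p w) = weight p * mean_dsq p"
    if "s \<in> samples" "sample_prob s > 0" "members p \<subseteq> s" for s
    using dsq_integrable[OF that(1,2) p that(3)] dsq_mean[OF that(1,2) p that(3)] by auto
  show "integrable (prob_sp D) (pair_term p)"
    unfolding pair_term_def using * by (intro integrable_incl) auto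
  show "expectation (pair_term p) = weight p * (incl_prob (members p) * mean_dsq p)"
    unfolding pair_term_def using * by (subst expectation_incl_eq[where c = "weight p * mean_dsq p"]) auto
qed

lemma
  assumes p: "p \<in> pairs" and q: "q \<in> pairs"
  shows pair_term_mult_integrable: "integrable (prob_sp D) (\<lambda>w. pair_term p w * pair_term q w)"
    and pair_term_mult_le: "\<bar>expectation (\<lambda>w. pair_term p w * pair_term q w)\<bar> \<le> \<bar>weight p * weight q\<bar> *
      (incl_prob (members p \<union> members q) * (4 * (pair_moment4 p + pair_moment4 q)))"
    and pair_term_mult_eq: "members p \<inter> members q = {} \<Longrightarrow>
      expectation (\<lambda>w. pair_term p w * pair_term q w) =
      weight p * weight q * (incl_prob (members p \<union> members q) * (mean_dsq p * mean_dsq q))"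
proof -
  let ?A = "members p \<union> members q"
  have [measurable]: "dsq p \<in> borel_measurable (prob_sp D)" "dsq q \<in> borel_measurable (prob_sp D)"
    using p q by simp_all
  \<comment> \<open>Both pairs are sampled exactly when the union of their members is. For
    overlapping pairs this is an inclusion event of order two or three.\<close>
  have eq: "(\<lambda>w. pair_term p w * pair_term q w) = (\<lambda>w. weight p * weight q *
      (of_bool (?A \<subseteq> sample_I D w) * (dsq p w * dsq q w)))"
    by (auto simp: pair_term_def fun_eq_iff)
  have int: "integrable (cond_first_stage D s) (\<lambda>w. dsq p w * dsq q w)"
    if "s \<in> samples" "sample_prob s > 0" "?A \<subseteq> s" for s
    using that p q by (intro dsq_mult_integrable) auto
  have int': "integrable (prob_sp D) (\<lambda>w. of_bool (?A \<subseteq> sample_I D w) * (dsq p w * dsq q w))"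
    using int by (intro integrable_incl) auto
  then show "integrable (prob_sp D) (\<lambda>w. pair_term p w * pair_term q w)"
    unfolding eq by simp
  have "expectation (\<lambda>w. of_bool (?A \<subseteq> sample_I D w) * (dsq p w * dsq q w))
      \<le> incl_prob ?A * (4 * (pair_moment4 p + pair_moment4 q))"
    using int p q by (intro expectation_incl_le dsq_mult_le) auto
  \<comment> \<open>As \<open>dsq\<close> is nonnegative, the upper bound is also a bound for the
    absolute value; the weights may have either sign.\<close>
  moreover have "0 \<le> expectation (\<lambda>w. of_bool (?A \<subseteq> sample_I D w) * (dsq p w * dsq q w))"
    by (intro Bochner_Integration.integral_nonneg) auto
  ultimately show "\<bar>expectation (\<lambda>w. pair_term p w * pair_term q w)\<bar> \<le> \<bar>weight p * weight q\<bar> *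
      (incl_prob ?A * (4 * (pair_moment4 p + pair_moment4 q)))"
    unfolding eq by (simp add: abs_mult mult_left_mono)
  show "expectation (\<lambda>w. pair_term p w * pair_term q w) =
      weight p * weight q * (incl_prob ?A * (mean_dsq p * mean_dsq q))"
    if disj: "members p \<inter> members q = {}"
  proof -
    have "expectation (\<lambda>w. of_bool (?A \<subseteq> sample_I D w) * (dsq p w * dsq q w))
        = incl_prob ?A * (mean_dsq p * mean_dsq q)"
      using int p q disj by (intro expectation_incl_eq dsq_mult_eq) auto
    then show ?thesis unfolding eq by simp
  qed
qed

end

section \<open>Covariances of the pair terms\<close>

context second_stage
begin

definition weight_const :: real where
  "weight_const = C2 / c2"

text \<open>One constant for all kinds of pairs of pairs: the sum in parentheses dominates what each
  case requires, and 4 is the constant in the bounds for products of two \<open>dsq\<close> or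
  \<open>mean_dsq\<close>.\<close>

definition cov_const :: real where
  "cov_const = 4 * weight_const\<^sup>2 * (K2 + K3 + K4 + K2\<^sup>2)"

text \<open>The summands are the orders for disjoint pairs, for pairs sharing a label and for pairs
  with the same labels. They are added with indicators rather than separated by cases, so that
  summing over one argument is a matter of counting.\<close>

definition cov_factor :: "nat \<times> nat \<Rightarrow> nat \<times> nat \<Rightarrow> real" where
  "cov_factor p q = cov_const / (real (size_I D))\<^sup>2 *
     (rate ^ 3 / real (num_psu D) + of_bool (members p \<inter> members q \<noteq> {}) * rate ^ 3
       + of_bool (members p = members q) * rate\<^sup>2)"

lemma cov_const_nonneg: "0 \<le> cov_const"
  using K_pos by (simp add: cov_const_def)

lemma weight_mult:
  assumes "p \<in> pairs" "q \<in> pairs"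
  shows "\<bar>weight p * weight q\<bar> \<le> weight_const\<^sup>2 / (real (size_I D))\<^sup>2"
proof -
  have *: "\<bar>weight p\<bar> \<le> weight_const / real (size_I D)" if "p \<in> pairs" for p
    using weight_bound[of "fst p" "snd p"] that by (simp add: weight_def pairs_def weight_const_def)
  have "\<bar>weight p * weight q\<bar> \<le> (weight_const / real (size_I D)) * (weight_const / real (size_I D))"
    unfolding abs_mult using const_pos assms by (intro mult_mono *) (auto simp: weight_const_def)
  then show ?thesis by (simp add: power2_eq_square)
qed

lemma incl_members: "p \<in> pairs \<Longrightarrow> incl_prob (members p) \<le> K2 * rate\<^sup>2"
  using incl2_bound by (auto simp: pairs_def members_def)

text \<open>The product has order \<open>rate ^ 4\<close>; as \<open>rate \<le> 1\<close>, it can be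
  weakened to the order of the joint inclusion probability to which it is added.\<close>

lemma incl_members_mult:
  assumes "p \<in> pairs" "q \<in> pairs" "k \<le> 4"
  shows "incl_prob (members p) * incl_prob (members q) \<le> K2\<^sup>2 * rate ^ k"
proof -
  have "incl_prob (members p) * incl_prob (members q) \<le> (K2 * rate\<^sup>2) * (K2 * rate\<^sup>2)"
    using assms incl_members K_pos by (intro mult_mono) auto
  also have "\<dots> = K2\<^sup>2 * rate ^ 4" by (simp add: eval_nat_numeral)
  also have "\<dots> \<le> K2\<^sup>2 * rate ^ k"
    using rate_pos rate_le_1 assms(3) by (intro mult_left_mono power_decreasing) auto
  finally show ?thesis .
qed

lemma pair_term_mean_mult:
  assumes "p \<in> pairs" "q \<in> pairs"
  shows "expectation (pair_term p) * expectation (pair_term q) = weight p * weight q *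
    (incl_prob (members p) * incl_prob (members q) * (mean_dsq p * mean_dsq q))"
  using assms by (simp add: pair_term_mean)

text \<open>Given the sample, the terms of disjoint pairs are independent. Their second-stage means
  factor out, and what remains is the covariance of the first-stage inclusion events, to which
  \<open>incl4_bound\<close> applies.\<close>

lemma pair_term_cov_disjoint:
  assumes p: "p \<in> pairs" and q: "q \<in> pairs" and disj: "members p \<inter> members q = {}"
  shows "\<bar>expectation (\<lambda>w. pair_term p w * pair_term q w) - expectation (pair_term p) * expectation (pair_term q)\<bar>
    \<le> weight_const\<^sup>2 / (real (size_I D))\<^sup>2 * (K4 * (rate ^ 3 / real (num_psu D)))
      * (4 * (pair_moment4 p + pair_moment4 q))"
proof -
  obtain i j k l where eq: "p = (i, j)" "q = (k, l)" by (cases p, cases q)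
  have "\<bar>incl_prob {i, j, k, l} - incl_prob {i, j} * incl_prob {k, l}\<bar>
      \<le> K4 * (rate ^ 3 / real (num_psu D))"
    using assms by (intro incl4_bound) (auto simp: eq pairs_def members_def)
  then have *: "\<bar>incl_prob (members p \<union> members q) - incl_prob (members p) * incl_prob (members q)\<bar>
      \<le> K4 * (rate ^ 3 / real (num_psu D))"
    by (simp add: eq members_def insert_commute)
  have "expectation (\<lambda>w. pair_term p w * pair_term q w) - expectation (pair_term p) * expectation (pair_term q)
    = weight p * weight q *
      (incl_prob (members p \<union> members q) - incl_prob (members p) * incl_prob (members q))
      * (mean_dsq p * mean_dsq q)"
    unfolding pair_term_mean_mult[OF p q] pair_term_mult_eq[OF p q disj] by (simp add: algebra_simps)
  also have "\<bar>\<dots>\<bar> = \<bar>weight p * weight q\<bar> *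
      \<bar>incl_prob (members p \<union> members q) - incl_prob (members p) * incl_prob (members q)\<bar>
      * \<bar>mean_dsq p * mean_dsq q\<bar>"
    by (simp add: abs_mult)
  also have "\<dots> \<le> weight_const\<^sup>2 / (real (size_I D))\<^sup>2 * (K4 * (rate ^ 3 / real (num_psu D)))
      * (4 * (pair_moment4 p + pair_moment4 q))"
    using K_pos rate_pos by (intro mult_mono weight_mult mean_dsq_mult * p q) auto
  finally show ?thesis .
qed

text \<open>No cancellation is sought: the mixed moment and the product of the means are bounded
  separately, with \<open>B\<close> covering both inclusion probabilities.\<close>

lemma pair_term_cov_overlap:
  assumes p: "p \<in> pairs" and q: "q \<in> pairs"
    and B: "incl_prob (members p \<union> members q) + incl_prob (members p) * incl_prob (members q) \<le> B"
  shows "\<bar>expectation (\<lambda>w. pair_term p w * pair_term q w) - expectation (pair_term p) * expectation (pair_term q)\<bar>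
    \<le> weight_const\<^sup>2 / (real (size_I D))\<^sup>2 * B * (4 * (pair_moment4 p + pair_moment4 q))"
proof -
  let ?W = "weight_const\<^sup>2 / (real (size_I D))\<^sup>2" and ?R = "4 * (pair_moment4 p + pair_moment4 q)"
  have R: "0 \<le> ?R" using pair_moment4_nonneg[of p] pair_moment4_nonneg[of q] by simp
  have 1: "\<bar>expectation (\<lambda>w. pair_term p w * pair_term q w)\<bar> \<le> ?W * (incl_prob (members p \<union> members q) * ?R)"
    using R by (intro order_trans[OF pair_term_mult_le[OF p q]] mult_right_mono weight_mult p q) auto
  have "\<bar>expectation (pair_term p) * expectation (pair_term q)\<bar> = \<bar>weight p * weight q\<bar> *
    (incl_prob (members p) * incl_prob (members q) * \<bar>mean_dsq p * mean_dsq q\<bar>)"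
    unfolding pair_term_mean_mult[OF p q] by (simp add: abs_mult)
  also have "\<dots> \<le> ?W * (incl_prob (members p) * incl_prob (members q) * ?R)"
    by (intro mult_mono weight_mult mean_dsq_mult p q) auto
  finally have 2: "\<bar>expectation (pair_term p) * expectation (pair_term q)\<bar>
      \<le> ?W * (incl_prob (members p) * incl_prob (members q) * ?R)" .
  have "\<bar>expectation (\<lambda>w. pair_term p w * pair_term q w) - expectation (pair_term p) * expectation (pair_term q)\<bar>
     \<le> \<bar>expectation (\<lambda>w. pair_term p w * pair_term q w)\<bar> + \<bar>expectation (pair_term p) * expectation (pair_term q)\<bar>"
    by (rule abs_triangle_ineq4)
  also have "\<dots> \<le> ?W * (incl_prob (members p \<union> members q) * ?R)
      + ?W * (incl_prob (members p) * incl_prob (members q) * ?R)"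
    using 1 2 by (rule add_mono)
  also have "\<dots> = ?W * (incl_prob (members p \<union> members q) + incl_prob (members p) * incl_prob (members q)) * ?R"
    by (simp only: distrib_left distrib_right mult.assoc)
  also have "\<dots> \<le> ?W * B * ?R"
    using B R by (intro mult_right_mono mult_left_mono) auto
  finally show ?thesis .
qed

lemma pair_term_cov_bound:
  assumes p: "p \<in> pairs" and q: "q \<in> pairs"
  shows "\<bar>expectation (\<lambda>w. pair_term p w * pair_term q w) - expectation (pair_term p) * expectation (pair_term q)\<bar>
    \<le> cov_factor p q * (pair_moment4 p + pair_moment4 q)"
proof -
  define K where "K = K2 + K3 + K4 + K2\<^sup>2"
  define Q where "Q = rate ^ 3 / real (num_psu D) + of_bool (members p \<inter> members q \<noteq> {}) * rate ^ 3
       + of_bool (members p = members q) * rate\<^sup>2"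
  define E where "E = \<bar>expectation (\<lambda>w. pair_term p w * pair_term q w)
       - expectation (pair_term p) * expectation (pair_term q)\<bar>"
  have R: "0 \<le> 4 * (pair_moment4 p + pair_moment4 q)"
    using pair_moment4_nonneg[of p] pair_moment4_nonneg[of q] by simp
  have cf: "weight_const\<^sup>2 / (real (size_I D))\<^sup>2 * (K * Q) * (4 * (pair_moment4 p + pair_moment4 q))
      = cov_factor p q * (pair_moment4 p + pair_moment4 q)"
    by (simp add: cov_factor_def cov_const_def K_def Q_def)
  \<comment> \<open>Each case only has to supply a bound \<open>B\<close> of the form constant times
    power of \<open>rate\<close>, which \<open>KQ\<close> compares with
    \<open>K * Q\<close>.\<close>
  have finish: "E \<le> cov_factor p q * (pair_moment4 p + pair_moment4 q)"
    if "E \<le> weight_const\<^sup>2 / (real (size_I D))\<^sup>2 * B * (4 * (pair_moment4 p + pair_moment4 q))"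
      "B \<le> K * Q" for B
    using that(2) R unfolding cf[symmetric]
    by (intro order_trans[OF that(1)] mult_right_mono mult_left_mono) auto
  have r3: "0 \<le> rate ^ 3 / real (num_psu D)" "0 \<le> rate ^ 3" "0 \<le> rate\<^sup>2"
    using rate_pos by auto
  have Q: "rate ^ 3 / real (num_psu D) \<le> Q" "members p \<inter> members q \<noteq> {} \<Longrightarrow> rate ^ 3 \<le> Q"
    "members p = members q \<Longrightarrow> rate\<^sup>2 \<le> Q"
    using r3 by (auto simp: Q_def)
  have Q0: "0 \<le> Q" using Q(1) r3(1) by linarith
  have KQ: "c * x \<le> K * Q" if "0 \<le> c" "c \<le> K" "x \<le> Q" for c x
    using that Q0 by (meson mult_left_mono mult_right_mono order_trans)
  consider "members p \<inter> members q = {}" | "members p = members q"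
    | "members p \<inter> members q \<noteq> {}" "members p \<noteq> members q" by blast
  then have "E \<le> cov_factor p q * (pair_moment4 p + pair_moment4 q)"
  proof cases
    case 1
    show ?thesis
      using pair_term_cov_disjoint[OF p q 1, folded E_def]
      by (rule finish, intro KQ) (use K_pos Q in \<open>auto simp: K_def\<close>)
  next
    case 2
    have "incl_prob (members p \<union> members q) + incl_prob (members p) * incl_prob (members q)
        \<le> (K2 + K2\<^sup>2) * rate\<^sup>2"
      using incl_members[OF p] incl_members_mult[OF p q, of 2] 2 by (simp add: distrib_right)
    from pair_term_cov_overlap[OF p q this, folded E_def] show ?thesis
      by (rule finish, intro KQ) (use K_pos Q 2 in \<open>auto simp: K_def\<close>)
  next
    case 3
    obtain i j k l where eq: "p = (i, j)" "q = (k, l)" by (cases p, cases q)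
    \<comment> \<open>Two pairs that meet without having the same members share exactly one label,
      so their union has three labels and \<open>incl3_bound\<close> applies.\<close>
    have "\<exists>x y z. members p \<union> members q = {x, y, z} \<and> distinct [x, y, z] \<and>
        x < num_psu D \<and> y < num_psu D \<and> z < num_psu D"
      using 3 p q unfolding eq pairs_def members_def
      by (cases "i = k"; cases "i = l"; cases "j = k"; cases "j = l") (auto 0 3 intro: exI[of _ i] exI[of _ j])
    then obtain x y z where xyz: "members p \<union> members q = {x, y, z}" "distinct [x, y, z]"
        "x < num_psu D" "y < num_psu D" "z < num_psu D" by blast
    have "incl_prob (members p \<union> members q) + incl_prob (members p) * incl_prob (members q)
        \<le> (K3 + K2\<^sup>2) * rate ^ 3"
      using incl3_bound[OF xyz(3-5,2)] incl_members_mult[OF p q, of 3]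
      by (simp add: distrib_right xyz(1))
    from pair_term_cov_overlap[OF p q this, folded E_def] show ?thesis
      by (rule finish, intro KQ) (use K_pos Q 3 in \<open>auto simp: K_def\<close>)
  qed
  then show ?thesis by (simp only: E_def)
qed

lemma cov_factor_commute: "cov_factor p q = cov_factor q p"
  by (simp add: cov_factor_def Int_commute eq_commute)

text \<open>There are at most \<open>N\<^sup>2\<close> pairs, at most \<open>4 * N\<close> with
  \<open>i\<close> or \<open>j\<close> in one of the two coordinates, and two with the same members,
  \<open>(i, j)\<close> and \<open>(j, i)\<close>. Since \<open>N * rate = n\<close>, these counts
  yield 1, 4 and, after \<open>1 \<le> n\<close>, 2 times \<open>n * rate\<^sup>2\<close>, which
  explains the 7.\<close>

lemma sum_cov_factor:
  assumes p: "p \<in> pairs"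
  shows "(\<Sum>q\<in>pairs. cov_factor p q) \<le> 7 * cov_const * rate\<^sup>2 / real (size_I D)"
proof -
  define N n where "N = real (num_psu D)" and "n = real (size_I D)"
  have N: "N \<ge> 1" "n \<ge> 1" using num_psu_pos size_I_pos by (auto simp: N_def n_def)
  have r: "rate = n / N" by (simp add: rate_def N_def n_def)
  obtain i j where p_eq: "p = (i, j)" by (cases p)
  have "card pairs \<le> card ({..<num_psu D} \<times> {..<num_psu D})"
    using pairs_subset by (intro card_mono) auto
  then have c1: "real (card pairs) \<le> N\<^sup>2"
    by (simp add: N_def power2_eq_square flip: of_nat_mult)
  have "card {q \<in> pairs. members p \<inter> members q \<noteq> {}} \<le>
      card ({i, j} \<times> {..<num_psu D} \<union> {..<num_psu D} \<times> {i, j})"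
    by (intro card_mono) (auto simp: pairs_def members_def p_eq)
  also have "\<dots> \<le> card ({i, j} \<times> {..<num_psu D}) + card ({..<num_psu D} \<times> {i, j})"
    by (rule card_Un_le)
  also have "\<dots> \<le> 4 * num_psu D"
    by (auto simp: card_cartesian_product card_insert_if)
  finally have c2: "real (card {q \<in> pairs. members p \<inter> members q \<noteq> {}}) \<le> 4 * N"
    by (simp add: N_def)
  have "card {q \<in> pairs. members p = members q} \<le> card {(i, j), (j, i)}"
    by (intro card_mono) (auto simp: pairs_def members_def p_eq doubleton_eq_iff)
  also have "\<dots> \<le> 2" using card_insert_le_m1[of 2 "{(j, i)}" "(i, j)"] by simp
  finally have c3: "real (card {q \<in> pairs. members p = members q}) \<le> 2" by simp
  have ob: "(\<Sum>q\<in>pairs. of_bool (P q) * c) = real (card {q \<in> pairs. P q}) * c"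
    for P and c :: real
    by (simp add: sum_of_bool_mult_eq Int_def)
  have "(\<Sum>q\<in>pairs. cov_factor p q) = cov_const / n\<^sup>2 * (real (card pairs) * (rate ^ 3 / N)
      + real (card {q \<in> pairs. members p \<inter> members q \<noteq> {}}) * rate ^ 3
      + real (card {q \<in> pairs. members p = members q}) * rate\<^sup>2)"
    unfolding cov_factor_def sum_distrib_left[symmetric] sum.distrib ob
    by (simp add: N_def n_def)
  also have "\<dots> \<le> cov_const / n\<^sup>2 * (N\<^sup>2 * (rate ^ 3 / N) + 4 * N * rate ^ 3 + 2 * rate\<^sup>2)"
    using c1 c2 c3 rate_pos N cov_const_nonneg
    by (intro mult_left_mono add_mono mult_right_mono) auto
  also have "\<dots> = cov_const / n\<^sup>2 * (5 * n * rate\<^sup>2 + 2 * rate\<^sup>2)"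
    using N by (simp add: r field_simps eval_nat_numeral)
  also have "\<dots> \<le> cov_const / n\<^sup>2 * (5 * n * rate\<^sup>2 + 2 * n * rate\<^sup>2)"
    using N cov_const_nonneg by (intro mult_left_mono add_mono mult_right_mono) auto
  also have "\<dots> = 7 * cov_const * rate\<^sup>2 / n"
    using N by (simp add: field_simps power2_eq_square)
  finally show ?thesis by (simp add: n_def)
qed

lemma sum_pair_moment4: "(\<Sum>p\<in>pairs. pair_moment4 p) \<le> 2 * real (num_psu D) * (\<Sum>i<num_psu D. moment4 i)"
proof -
  have "(\<Sum>p\<in>pairs. pair_moment4 p) \<le> (\<Sum>p\<in>{..<num_psu D} \<times> {..<num_psu D}. pair_moment4 p)"
    using pairs_subset pair_moment4_nonneg by (intro sum_mono2) auto
  also have "\<dots> = (\<Sum>i<num_psu D. \<Sum>j<num_psu D. moment4 i + moment4 j)"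
    unfolding sum.cartesian_product by (intro sum.cong) (auto simp: pair_moment4_def)
  also have "\<dots> = 2 * real (num_psu D) * (\<Sum>i<num_psu D. moment4 i)"
    by (simp add: sum.distrib flip: sum_distrib_left)
  finally show ?thesis .
qed

text \<open>As in Schur's test, the symmetry of \<open>cov_factor\<close> makes the moments of
  \<open>p\<close> and of \<open>q\<close> contribute equally, each multiplied by a row sum. The
  constant is \<open>2 * 7 * 2\<close>: two equal halves, the row sum, and at most
  \<open>2 * N\<close> ordered pairs containing a given PSU.\<close>

lemma sum_pair_term_variance:
  "expectation (\<lambda>w. ((\<Sum>p\<in>pairs. pair_term p w) - (\<Sum>p\<in>pairs. expectation (pair_term p)))\<^sup>2)
    \<le> 28 * cov_const * rate * (\<Sum>i<num_psu D. moment4 i)"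
proof -
  define N n where "N = real (num_psu D)" and "n = real (size_I D)"
  have N: "N \<ge> 1" "n \<ge> 1" using num_psu_pos size_I_pos by (auto simp: N_def n_def)
  let ?X = "7 * cov_const * rate\<^sup>2 / n"
  have "expectation (\<lambda>w. ((\<Sum>p\<in>pairs. pair_term p w) - (\<Sum>p\<in>pairs. expectation (pair_term p)))\<^sup>2)
    = (\<Sum>p\<in>pairs. \<Sum>q\<in>pairs. expectation (\<lambda>w. pair_term p w * pair_term q w)
        - expectation (pair_term p) * expectation (pair_term q))"
    by (intro expectation_sum_centered_square pair_term_integrable pair_term_mult_integrable)
  also have "\<dots> \<le> (\<Sum>p\<in>pairs. \<Sum>q\<in>pairs. cov_factor p q * (pair_moment4 p + pair_moment4 q))"
    by (intro sum_mono order_trans[OF abs_ge_self pair_term_cov_bound])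
  also have "\<dots> = (\<Sum>p\<in>pairs. \<Sum>q\<in>pairs. cov_factor p q * pair_moment4 p)
      + (\<Sum>p\<in>pairs. \<Sum>q\<in>pairs. cov_factor p q * pair_moment4 q)"
    by (simp add: distrib_left sum.distrib)
  also have "(\<Sum>p\<in>pairs. \<Sum>q\<in>pairs. cov_factor p q * pair_moment4 q)
      = (\<Sum>p\<in>pairs. \<Sum>q\<in>pairs. cov_factor p q * pair_moment4 p)"
    by (subst sum.swap) (simp add: cov_factor_commute)
  also have "(\<Sum>p\<in>pairs. \<Sum>q\<in>pairs. cov_factor p q * pair_moment4 p)
      + (\<Sum>p\<in>pairs. \<Sum>q\<in>pairs. cov_factor p q * pair_moment4 p)
      = 2 * (\<Sum>p\<in>pairs. (\<Sum>q\<in>pairs. cov_factor p q) * pair_moment4 p)"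
    by (simp add: sum_distrib_right)
  also have "\<dots> \<le> 2 * (\<Sum>p\<in>pairs. ?X * pair_moment4 p)"
    using sum_cov_factor pair_moment4_nonneg
    by (intro mult_left_mono sum_mono mult_right_mono) (auto simp: n_def)
  also have "\<dots> = 2 * ?X * (\<Sum>p\<in>pairs. pair_moment4 p)"
    by (simp add: sum_distrib_left mult.assoc)
  also have "\<dots> \<le> 2 * ?X * (2 * N * (\<Sum>i<num_psu D. moment4 i))"
    unfolding N_def using sum_pair_moment4 cov_const_nonneg N by (intro mult_left_mono) auto
  also have "\<dots> = 28 * cov_const * rate * (\<Sum>i<num_psu D. moment4 i)"
    using N by (simp add: rate_def power2_eq_square field_simps flip: N_def n_def)
  finally show ?thesis .
qed

text \<open>The first-stage size is fixed, so the rows of the matrix \<open>Delta_I D\<close> sum to zero; this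
  turns the Yates--Grundy form of the variance into the Horvitz--Thompson one.\<close>

lemma sum_pair_term_mean:
  "(\<Sum>p\<in>pairs. expectation (pair_term p)) =
    - 2 * ((\<Sum>i<num_psu D. \<Sum>j<num_psu D. Delta_I D i j * (\<mu> i / pi_I D i) * (\<mu> j / pi_I D j))
      + (\<Sum>i<num_psu D. (1 - pi_I D i) / pi_I D i * v i))"
proof -
  let ?N = "num_psu D" and ?a = "\<lambda>i. \<mu> i / pi_I D i" and ?\<Delta> = "Delta_I D"
  let ?d = "\<lambda>i. v i / (pi_I D i)\<^sup>2 + (?a i)\<^sup>2"
  have diag: "{p \<in> {..<?N} \<times> {..<?N}. fst p = snd p} = (\<lambda>i. (i, i)) ` {..<?N}" by auto
  have pi0: "pi_I D i \<noteq> 0" if "i < ?N" for i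
    using incl_pos[OF that] by (simp add: pi_I_eq)
  have split: "{..<?N} \<times> {..<?N} = pairs \<union> {p \<in> {..<?N} \<times> {..<?N}. fst p = snd p}"
    by (auto simp: pairs_def)
  have "(\<Sum>i<?N. \<Sum>j<?N. ?\<Delta> i j * mean_dsq (i, j)) =
      (\<Sum>p\<in>{..<?N} \<times> {..<?N}. ?\<Delta> (fst p) (snd p) * mean_dsq p)"
    unfolding sum.cartesian_product by (intro sum.cong) auto
  also have "\<dots> = (\<Sum>p\<in>pairs. ?\<Delta> (fst p) (snd p) * mean_dsq p)
     + (\<Sum>p\<in>{p \<in> {..<?N} \<times> {..<?N}. fst p = snd p}. ?\<Delta> (fst p) (snd p) * mean_dsq p)"
    using finite_pairs by (subst split, intro sum.union_disjoint) (auto simp: pairs_def)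
  also have "(\<Sum>p\<in>{p \<in> {..<?N} \<times> {..<?N}. fst p = snd p}. ?\<Delta> (fst p) (snd p) * mean_dsq p)
      = (\<Sum>i<?N. ?\<Delta> i i * mean_dsq (i, i))"
    unfolding diag by (subst sum.reindex) (auto simp: inj_on_def)
  \<comment> \<open>On the diagonal \<open>mean_dsq (i, i)\<close> is
    \<open>2 * v i / (pi_I D i)\<^sup>2\<close>, not the mean of \<open>dsq (i, i)\<close>, which is
    zero: the formula treats the two entries as independent. Completing the sum to all
    \<open>i\<close> and \<open>j\<close> therefore produces the second-stage variance term.\<close>
  also have "\<dots> = 2 * (\<Sum>i<?N. (1 - pi_I D i) / pi_I D i * v i)"
    unfolding sum_distrib_left
    using pi0 by (intro sum.cong refl) (simp add: mean_dsq_def Delta_I_self field_simps power2_eq_square)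
  finally have 1: "(\<Sum>p\<in>pairs. ?\<Delta> (fst p) (snd p) * mean_dsq p) =
      (\<Sum>i<?N. \<Sum>j<?N. ?\<Delta> i j * mean_dsq (i, j))
      - 2 * (\<Sum>i<?N. (1 - pi_I D i) / pi_I D i * v i)"
    by simp
  have "(\<Sum>i<?N. \<Sum>j<?N. ?\<Delta> i j * mean_dsq (i, j)) =
     (\<Sum>i<?N. \<Sum>j<?N. ?\<Delta> i j * ?d i) + (\<Sum>i<?N. \<Sum>j<?N. ?\<Delta> i j * ?d j)
     - 2 * (\<Sum>i<?N. \<Sum>j<?N. ?\<Delta> i j * ?a i * ?a j)"
    unfolding sum.distrib[symmetric] sum_subtractf[symmetric] sum_distrib_left
    by (intro sum.cong refl) (simp only: mean_dsq_def fst_conv snd_conv power2_diff, algebra)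
  also have "(\<Sum>i<?N. \<Sum>j<?N. ?\<Delta> i j * ?d j) = (\<Sum>i<?N. \<Sum>j<?N. ?\<Delta> i j * ?d i)"
    by (subst sum.swap) (simp add: Delta_I_commute)
  also have "(\<Sum>i<?N. \<Sum>j<?N. ?\<Delta> i j * ?d i) = (\<Sum>i<?N. (\<Sum>j<?N. ?\<Delta> i j) * ?d i)"
    by (simp add: sum_distrib_right)
  also have "\<dots> = 0" using sum_Delta_I by simp
  finally have 2: "(\<Sum>i<?N. \<Sum>j<?N. ?\<Delta> i j * mean_dsq (i, j)) =
     - 2 * (\<Sum>i<?N. \<Sum>j<?N. ?\<Delta> i j * ?a i * ?a j)" by simp
  have "(\<Sum>p\<in>pairs. expectation (pair_term p)) = (\<Sum>p\<in>pairs. ?\<Delta> (fst p) (snd p) * mean_dsq p)"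
  proof (intro sum.cong refl)
    fix p assume p: "p \<in> pairs"
    have "incl_prob (members p) = pi_I2 D (fst p) (snd p)"
      by (simp add: pi_I2_eq members_def)
    with members_incl_pos[OF p] show "expectation (pair_term p) = ?\<Delta> (fst p) (snd p) * mean_dsq p"
      unfolding pair_term_mean[OF p] weight_def by simp
  qed
  then show ?thesis unfolding 1 2 by simp
qed

section \<open>Mean squared error of the Yates--Grundy form\<close>

definition yates_grundy :: "'w \<Rightarrow> real" where
  "yates_grundy w =
     - (1/2) * (\<Sum>i\<in>sample_I D w. \<Sum>j\<in>sample_I D w - {i}.
        Delta_I D i j / pi_I2 D i j * (Y i w / pi_I D i - Y j w / pi_I D j)\<^sup>2)"

lemma yates_grundy_eq:
  assumes "w \<in> space (prob_sp D)"
  shows "yates_grundy w = - (1/2) * (\<Sum>p\<in>pairs. pair_term p w)"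
proof -
  define S where "S = sample_I D w"
  have S: "S \<subseteq> {..<num_psu D}" "finite S"
    using sample_in_samples[OF assms] sample_finite[of S] unfolding S_def samples_def by blast+
  have "(\<Sum>i\<in>S. \<Sum>j\<in>S - {i}. Delta_I D i j / pi_I2 D i j * (Y i w / pi_I D i - Y j w / pi_I D j)\<^sup>2)
      = (\<Sum>p\<in>Sigma S (\<lambda>i. S - {i}). weight p * dsq p w)"
    using S by (subst sum.Sigma) (auto simp: weight_def dsq_def intro!: sum.cong)
  also have "\<dots> = (\<Sum>p\<in>Sigma S (\<lambda>i. S - {i}). pair_term p w)"
    by (intro sum.cong) (auto simp: pair_term_def members_def S_def)
  also have "\<dots> = (\<Sum>p\<in>pairs. pair_term p w)"
    using S finite_pairs
    by (intro sum.mono_neutral_left) (auto simp: pairs_def pair_term_def members_def S_def)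
  finally show ?thesis by (simp add: yates_grundy_def S_def)
qed

lemma
  defines "V \<equiv> (\<Sum>i<num_psu D. \<Sum>j<num_psu D. Delta_I D i j * (\<mu> i / pi_I D i) * (\<mu> j / pi_I D j))
      + (\<Sum>i<num_psu D. (1 - pi_I D i) / pi_I D i * v i)"
  shows yates_grundy_integrable: "integrable (prob_sp D) (\<lambda>w. (yates_grundy w - V)\<^sup>2)"
    and yates_grundy_variance: "expectation (\<lambda>w. (yates_grundy w - V)\<^sup>2)
      \<le> 7 * cov_const * rate * (\<Sum>i<num_psu D. moment4 i)"
    and yates_grundy_measurable: "yates_grundy \<in> borel_measurable (prob_sp D)"
proof -
  let ?Z = "\<lambda>w. ((\<Sum>p\<in>pairs. pair_term p w) - (\<Sum>p\<in>pairs. expectation (pair_term p)))\<^sup>2"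
  \<comment> \<open>By \<open>sum_pair_term_mean\<close> the pair terms have total mean
    \<open>-2 * V\<close>, so the estimator is centered at \<open>V\<close>. The factor
    \<open>-1/2\<close> is squared to \<open>1/4\<close>, which turns the constant 28 into
    7.\<close>
  have eq: "(yates_grundy w - V)\<^sup>2 = 1/4 * ?Z w" if "w \<in> space (prob_sp D)" for w
    unfolding yates_grundy_eq[OF that] sum_pair_term_mean V_def[symmetric]
    by (simp add: power2_eq_square algebra_simps)
  have int: "integrable (prob_sp D) ?Z"
    by (intro integrable_sum_centered_square pair_term_integrable pair_term_mult_integrable)
  then have "integrable (prob_sp D) (\<lambda>w. 1/4 * ?Z w)" by simp
  then show "integrable (prob_sp D) (\<lambda>w. (yates_grundy w - V)\<^sup>2)"
    using eq by (subst Bochner_Integration.integrable_cong[OF refl]) auto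
  have "expectation (\<lambda>w. (yates_grundy w - V)\<^sup>2) = expectation (\<lambda>w. 1/4 * ?Z w)"
    using eq by (intro Bochner_Integration.integral_cong) auto
  then show "expectation (\<lambda>w. (yates_grundy w - V)\<^sup>2)
      \<le> 7 * cov_const * rate * (\<Sum>i<num_psu D. moment4 i)"
    using sum_pair_term_variance by simp
  have [measurable]: "pair_term p \<in> borel_measurable (prob_sp D)" if "p \<in> pairs" for p
    using pair_term_integrable[OF that] by auto
  have "(\<lambda>w. - (1/2) * (\<Sum>p\<in>pairs. pair_term p w)) \<in> borel_measurable (prob_sp D)" by measurable
  then show "yates_grundy \<in> borel_measurable (prob_sp D)"
    using yates_grundy_eq by (subst measurable_cong) auto
qed

end

section \<open>The Horvitz--Thompson estimator\<close>

context first_stage_bounds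
begin

definition horvitz_thompson :: "(nat \<Rightarrow> 'w \<Rightarrow> real) \<Rightarrow> 'w \<Rightarrow> real" where
  "horvitz_thompson Z w = (\<Sum>i\<in>sample_I D w. Z i w / pi_I D i)"

text \<open>The method used for pairs, now with single PSUs. A diagonal term is at most
  \<open>d i / pi_I D i\<close>, of order \<open>1 / (cL * rate)\<close> times \<open>d i\<close>.
  Off the diagonal conditional independence leaves only the first-stage covariance, and the sum over
  the second index brings it to the same order, with constant
  \<open>C2 / cL\<^sup>2\<close>.\<close>

lemma
  fixes Z :: "nat \<Rightarrow> 'w \<Rightarrow> real" and \<nu> d :: "nat \<Rightarrow> real"
  assumes meas: "\<And>i. i < num_psu D \<Longrightarrow> Z i \<in> borel_measurable (prob_sp D)"
    and indep: "\<And>s. s \<in> samples \<Longrightarrow> sample_prob s > 0 \<Longrightarrow>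
      prob_space.indep_vars (cond_first_stage D s) (\<lambda>_. borel) Z s"
    and int2: "\<And>s i. s \<in> samples \<Longrightarrow> sample_prob s > 0 \<Longrightarrow> i \<in> s \<Longrightarrow>
      integrable (cond_first_stage D s) (\<lambda>w. (Z i w)\<^sup>2)"
    and mean: "\<And>s i. s \<in> samples \<Longrightarrow> sample_prob s > 0 \<Longrightarrow> i \<in> s \<Longrightarrow>
      integral\<^sup>L (cond_first_stage D s) (Z i) = \<nu> i"
    and moment2: "\<And>s i. s \<in> samples \<Longrightarrow> sample_prob s > 0 \<Longrightarrow> i \<in> s \<Longrightarrow>
      integral\<^sup>L (cond_first_stage D s) (\<lambda>w. (Z i w)\<^sup>2) \<le> d i"
  shows horvitz_thompson_measurable: "horvitz_thompson Z \<in> borel_measurable (prob_sp D)"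
    and horvitz_thompson_integrable:
      "integrable (prob_sp D) (\<lambda>w. (horvitz_thompson Z w - (\<Sum>i<num_psu D. \<nu> i))\<^sup>2)"
    and horvitz_thompson_variance:
      "expectation (\<lambda>w. (horvitz_thompson Z w - (\<Sum>i<num_psu D. \<nu> i))\<^sup>2)
        \<le> (1 / cL + C2 / cL\<^sup>2) / rate * (\<Sum>i<num_psu D. d i)"
proof -
  define T where "T i w = of_bool ({i} \<subseteq> sample_I D w) * (Z i w / pi_I D i)" for i w
  let ?N = "num_psu D"
  have s_less: "i < ?N" if "s \<in> samples" "i \<in> s" for s i
    using that by (auto simp: samples_def)
  have int1: "integrable (cond_first_stage D s) (Z i)"
    if "s \<in> samples" "sample_prob s > 0" "i \<in> s" for s i
  proof -
    interpret C: prob_space "cond_first_stage D s" by (rule cond_prob_space[OF that(2)])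
    show ?thesis
      using meas[OF s_less[OF that(1,3)]] int2[OF that] by (auto intro: C.square_integrable_imp_integrable[of "Z i"])
  qed
  have pi: "pi_I D i = incl_prob {i}" "0 < pi_I D i" "cL * rate \<le> pi_I D i" if "i < ?N" for i
    using incl_pos[OF that] incl_lower[OF that] by (auto simp: pi_I_eq)
  have T_int: "integrable (prob_sp D) (T i)" if "i < ?N" for i
    unfolding T_def using int1 meas[OF that] by (intro integrable_incl) auto
  have T_mean: "expectation (T i) = \<nu> i" if "i < ?N" for i
  proof -
    have "expectation (T i) = incl_prob {i} * (\<nu> i / pi_I D i)"
      unfolding T_def using int1 mean meas[OF that] by (intro expectation_incl_eq) auto
    then show ?thesis using pi(1,2)[OF that] by simp
  qed
  have T_sq_eq: "(\<lambda>w. T i w * T i w) =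
      (\<lambda>w. of_bool ({i} \<subseteq> sample_I D w) * ((Z i w)\<^sup>2 / (pi_I D i)\<^sup>2))" for i
    by (auto simp: T_def fun_eq_iff power2_eq_square)
  have T_sq_int: "integrable (prob_sp D) (\<lambda>w. T i w * T i w)" if "i < ?N" for i
    unfolding T_sq_eq using int2 meas[OF that] by (intro integrable_incl) auto
  have T_sq_mean: "expectation (\<lambda>w. T i w * T i w) \<le> d i / pi_I D i" if "i < ?N" for i
  proof -
    have "expectation (\<lambda>w. T i w * T i w) \<le> incl_prob {i} * (d i / (pi_I D i)\<^sup>2)"
      unfolding T_sq_eq using int2 moment2 meas[OF that]
      by (intro expectation_incl_le) (auto intro!: divide_right_mono)
    then show ?thesis using pi(1,2)[OF that] by (simp add: power2_eq_square)
  qed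
  have T_prod_eq: "(\<lambda>w. T i w * T j w) =
      (\<lambda>w. of_bool ({i, j} \<subseteq> sample_I D w) * (Z i w * Z j w / (pi_I D i * pi_I D j)))" for i j
    by (auto simp: T_def fun_eq_iff)
  have ZZ: "integrable (cond_first_stage D s) (\<lambda>w. Z i w * Z j w)"
    "integral\<^sup>L (cond_first_stage D s) (\<lambda>w. Z i w * Z j w) = \<nu> i * \<nu> j"
    if "s \<in> samples" "sample_prob s > 0" "{i, j} \<subseteq> s" "i \<noteq> j" for s i j
  proof -
    interpret C: prob_space "cond_first_stage D s" by (rule cond_prob_space[OF that(2)])
    have ij: "i \<in> s" "j \<in> s" using that by auto
    note s = that(1,2)
    show "integrable (cond_first_stage D s) (\<lambda>w. Z i w * Z j w)"
      "integral\<^sup>L (cond_first_stage D s) (\<lambda>w. Z i w * Z j w) = \<nu> i * \<nu> j"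
      using C.integrable_indep_mult[OF indep[OF s] ij that(4) int1[OF s ij(1)] int1[OF s ij(2)]]
        C.expectation_indep_mult[OF indep[OF s] ij that(4) int1[OF s ij(1)] int1[OF s ij(2)]]
        mean[OF s ij(1)] mean[OF s ij(2)] by auto
  qed
  have T_prod_int: "integrable (prob_sp D) (\<lambda>w. T i w * T j w)" if "i < ?N" "j < ?N" "i \<noteq> j" for i j
    unfolding T_prod_eq using ZZ that meas[OF that(1)] meas[OF that(2)] by (intro integrable_incl) auto
  have T_prod_mean: "expectation (\<lambda>w. T i w * T j w) = incl_prob {i, j} * (\<nu> i * \<nu> j / (pi_I D i * pi_I D j))"
    if "i < ?N" "j < ?N" "i \<noteq> j" for i j
    unfolding T_prod_eq using ZZ that meas[OF that(1)] meas[OF that(2)]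
    by (intro expectation_incl_eq) auto
  have T_prod_int': "integrable (prob_sp D) (\<lambda>w. T i w * T j w)" if "i < ?N" "j < ?N" for i j
    using T_prod_int[OF that] T_sq_int[OF that(1)] by (cases "i = j") auto
  \<comment> \<open>Evaluated on one sample containing \<open>i\<close>; thus \<open>d\<close> also
    controls the means that occur off the diagonal.\<close>
  have d: "(\<nu> i)\<^sup>2 \<le> d i" if i: "i < ?N" for i
  proof -
    obtain s where s: "s \<in> samples" "sample_prob s > 0" "{i} \<subseteq> s"
      using incl_prob_pos_sample[OF incl_pos[OF i]] by blast
    interpret C: prob_space "cond_first_stage D s" by (rule cond_prob_space[OF s(2)])
    have "(\<nu> i)\<^sup>2 \<le> integral\<^sup>L (cond_first_stage D s) (\<lambda>w. (Z i w)\<^sup>2)"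
      using C.power2_expectation_le[of "Z i"] meas[OF i] int2[OF s(1,2)] mean[OF s(1,2)] s(3) by simp
    also have "\<dots> \<le> d i" using moment2[OF s(1,2)] s(3) by simp
    finally show ?thesis .
  qed
  have d0: "0 \<le> d i" if "i < ?N" for i
    using d[OF that] zero_le_power2[of "\<nu> i"] by linarith
  \<comment> \<open>\<open>a\<close> bounds \<open>1 / pi_I D i\<close>. \<open>b\<close> is the
    covariance bound divided by the squared lower bound of the first order probabilities, so
    \<open>b * N\<close> is again of order \<open>1 / rate\<close>.\<close>
  define a b where "a = 1 / (cL * rate)" and "b = C2 / (cL\<^sup>2 * real (size_I D))"
  have ab: "0 \<le> a" "0 \<le> b" using const_pos rate_pos by (auto simp: a_def b_def)
  have cov: "expectation (\<lambda>w. T i w * T j w) - expectation (T i) * expectation (T j)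
      \<le> of_bool (i = j) * (a * d i) + b / 2 * (d i + d j)" if ij: "i < ?N" "j < ?N" for i j
  proof (cases "i = j")
    case True
    have "expectation (\<lambda>w. T i w * T i w) - expectation (T i) * expectation (T i) \<le> d i / pi_I D i"
      using T_sq_mean[OF ij(1)] zero_le_square[of "expectation (T i)"] by linarith
    also have "\<dots> \<le> d i / (cL * rate)"
      using pi(3)[OF ij(1)] const_pos rate_pos d0[OF ij(1)] by (intro divide_left_mono) (auto intro: mult_pos_pos pi(2)[OF ij(1)])
    also have "\<dots> = of_bool (i = j) * (a * d i)" using True by (simp add: a_def)
    also have "\<dots> \<le> of_bool (i = j) * (a * d i) + b / 2 * (d i + d j)"
      using ab d0[OF ij(1)] d0[OF ij(2)] by simp
    finally show ?thesis using True by simp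
  next
    case False
    let ?c = "incl_prob {i, j} - incl_prob {i} * incl_prob {j}"
    note pij = pi[OF ij(1)] pi[OF ij(2)]
    have "expectation (\<lambda>w. T i w * T j w) - expectation (T i) * expectation (T j)
       = ?c / (pi_I D i * pi_I D j) * (\<nu> i * \<nu> j)"
      using pij by (simp add: T_prod_mean[OF ij False] T_mean ij field_simps)
    also have "\<dots> \<le> \<bar>?c\<bar> / (pi_I D i * pi_I D j) * \<bar>\<nu> i * \<nu> j\<bar>"
      using pij by (intro order_trans[OF abs_ge_self eq_refl]) (simp add: abs_mult)
    also have "\<dots> \<le> (C2 * (rate\<^sup>2 / real (size_I D))) / ((cL * rate) * (cL * rate)) * ((d i + d j) / 2)"
    proof (rule mult_mono[OF frac_le])
      show "\<bar>?c\<bar> \<le> C2 * (rate\<^sup>2 / real (size_I D))" by (rule cov2_bound[OF ij False])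
      show "cL * rate * (cL * rate) \<le> pi_I D i * pi_I D j"
        using pij const_pos rate_pos by (intro mult_mono) auto
      have "2 * \<bar>\<nu> i\<bar> * \<bar>\<nu> j\<bar> \<le> \<bar>\<nu> i\<bar>\<^sup>2 + \<bar>\<nu> j\<bar>\<^sup>2" by (rule sum_squares_bound)
      then show "\<bar>\<nu> i * \<nu> j\<bar> \<le> (d i + d j) / 2"
        using d[OF ij(1)] d[OF ij(2)] by (simp add: abs_mult)
    qed (use const_pos rate_pos pij in auto)
    also have "\<dots> = b / 2 * (d i + d j)"
      using rate_pos const_pos by (simp add: b_def power2_eq_square)
    finally show ?thesis using False by simp
  qed
  have sum_eq: "horvitz_thompson Z w = (\<Sum>i<?N. T i w)" if "w \<in> space (prob_sp D)" for w
  proof -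
    have S: "sample_I D w \<subseteq> {..<?N}"
      using sample_in_samples[OF that] by (auto simp: samples_def)
    have "horvitz_thompson Z w = (\<Sum>i\<in>sample_I D w. T i w)"
      unfolding horvitz_thompson_def T_def by (intro sum.cong) auto
    also have "\<dots> = (\<Sum>i<?N. T i w)"
      using S by (intro sum.mono_neutral_left) (auto simp: T_def)
    finally show ?thesis .
  qed
  let ?Q = "\<lambda>w. ((\<Sum>i<?N. T i w) - (\<Sum>i<?N. expectation (T i)))\<^sup>2"
  have nu: "(\<Sum>i<?N. expectation (T i)) = (\<Sum>i<?N. \<nu> i)" using T_mean by simp
  have int: "integrable (prob_sp D) ?Q"
    using T_int T_prod_int' by (intro integrable_sum_centered_square) auto
  then show "integrable (prob_sp D) (\<lambda>w. (horvitz_thompson Z w - (\<Sum>i<?N. \<nu> i))\<^sup>2)"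
    using sum_eq nu by (subst Bochner_Integration.integrable_cong[OF refl]) auto
  have [measurable]: "T i \<in> borel_measurable (prob_sp D)" if "i \<in> {..<?N}" for i
    using T_int[of i] that by auto
  have "(\<lambda>w. \<Sum>i<?N. T i w) \<in> borel_measurable (prob_sp D)" by measurable
  then show "horvitz_thompson Z \<in> borel_measurable (prob_sp D)"
    using sum_eq by (subst measurable_cong) auto
  have "expectation (\<lambda>w. (horvitz_thompson Z w - (\<Sum>i<?N. \<nu> i))\<^sup>2) = expectation ?Q"
    using sum_eq nu by (intro Bochner_Integration.integral_cong) auto
  also have "\<dots> = (\<Sum>i<?N. \<Sum>j<?N. expectation (\<lambda>w. T i w * T j w) - expectation (T i) * expectation (T j))"
    using T_int T_prod_int' by (intro expectation_sum_centered_square) auto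
  also have "\<dots> \<le> (\<Sum>i<?N. \<Sum>j<?N. of_bool (i = j) * (a * d i) + b / 2 * (d i + d j))"
    using cov by (intro sum_mono) auto
  also have "\<dots> = (a + b * real ?N) * (\<Sum>i<?N. d i)"
  proof -
    have "(\<Sum>i<?N. \<Sum>j<?N. of_bool (i = j) * (a * d i)) = a * (\<Sum>i<?N. d i)"
      by (simp add: of_bool_def if_distrib[of "\<lambda>x. x * _"] sum_distrib_left cong: if_cong)
    moreover have "(\<Sum>i<?N. \<Sum>j<?N. b / 2 * (d i + d j)) = b * real ?N * (\<Sum>i<?N. d i)"
      by (simp add: sum.distrib distrib_left sum_divide_distrib[symmetric] flip: sum_distrib_left)
    ultimately show ?thesis by (simp only: sum.distrib distrib_right)
  qed
  also have "a + b * real ?N = (1 / cL + C2 / cL\<^sup>2) / rate"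
    using num_psu_pos size_I_pos const_pos by (simp add: a_def b_def rate_def field_simps)
  finally show "expectation (\<lambda>w. (horvitz_thompson Z w - (\<Sum>i<?N. \<nu> i))\<^sup>2)
        \<le> (1 / cL + C2 / cL\<^sup>2) / rate * (\<Sum>i<?N. d i)" .
qed

end

section \<open>Second-stage moments\<close>

text \<open>Cauchy--Schwarz twice. The crude power is harmless: it is applied to \<open>m\<close>
  draws that are each divided by \<open>m\<close> through \<open>pi_II\<close>, and the resulting
  \<open>m ^ 4\<close> cancels.\<close>

lemma sum_power4_le:
  fixes X :: "'i \<Rightarrow> real"
  shows "(\<Sum>l\<in>I. X l) ^ 4 \<le> real (card I) ^ 3 * (\<Sum>l\<in>I. X l ^ 4)"
proof -
  have "((\<Sum>l\<in>I. X l)\<^sup>2)\<^sup>2 \<le> ((\<Sum>l\<in>I. (X l)\<^sup>2) * real (card I))\<^sup>2"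
    by (intro power_mono sum_squared_le_sum_of_squares) auto
  also have "\<dots> = (\<Sum>l\<in>I. (X l)\<^sup>2)\<^sup>2 * (real (card I))\<^sup>2" by (simp add: power_mult_distrib)
  also have "\<dots> \<le> ((\<Sum>l\<in>I. ((X l)\<^sup>2)\<^sup>2) * real (card I)) * (real (card I))\<^sup>2"
    by (intro mult_right_mono sum_squared_le_sum_of_squares) auto
  finally show ?thesis by (simp add: eval_nat_numeral ac_simps)
qed

text \<open>This is \<open>m\<close> times the usual unbiased sample variance: it estimates the
  variance of the sum of the \<open>m\<close> draws, not that of a single draw.\<close>

definition sample_var :: "nat \<Rightarrow> (nat \<Rightarrow> real) \<Rightarrow> real" where
  "sample_var m x = real m / (real m - 1) * (\<Sum>l<m. (x l - (\<Sum>k<m. x k) / real m)\<^sup>2)"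

lemma sample_var_eq:
  assumes "0 < m"
  shows "sample_var m x = real m / (real m - 1) * ((\<Sum>l<m. (x l)\<^sup>2) - (\<Sum>l<m. x l)\<^sup>2 / real m)"
proof -
  let ?t = "\<Sum>k<m. x k"
  have "(\<Sum>l<m. (x l - ?t / real m)\<^sup>2) = (\<Sum>l<m. (x l)\<^sup>2 - 2 * ?t / real m * x l + (?t / real m)\<^sup>2)"
    by (intro sum.cong refl) (simp add: power2_diff algebra_simps)
  also have "\<dots> = (\<Sum>l<m. (x l)\<^sup>2) - ?t\<^sup>2 / real m"
    unfolding sum.distrib sum_subtractf sum_distrib_left[symmetric]
    using assms by (simp add: power2_eq_square)
  finally show ?thesis by (simp add: sample_var_def)
qed

text \<open>For \<open>2 \<le> m\<close> the factor \<open>m / (m - 1)\<close> is at most 2, and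
  dropping the squared sum only increases the value; the Cauchy--Schwarz inequality does the
  rest.\<close>

lemma sample_var_square_le:
  assumes "2 \<le> m"
  shows "(sample_var m x)\<^sup>2 \<le> 4 * real m * (\<Sum>l<m. x l ^ 4)"
proof -
  have nn: "0 \<le> sample_var m x"
    unfolding sample_var_def using assms by (intro mult_nonneg_nonneg sum_nonneg) auto
  have "sample_var m x \<le> 2 * (\<Sum>l<m. (x l)\<^sup>2)"
    unfolding sample_var_eq[OF order_less_le_trans[OF pos2 assms]]
  proof (rule mult_mono)
    show "real m / (real m - 1) \<le> 2" using assms by (simp add: field_simps)
    show "0 \<le> (\<Sum>l<m. (x l)\<^sup>2) - (\<Sum>l<m. x l)\<^sup>2 / real m"
      using sum_squared_le_sum_of_squares[of x "{..<m}"] assms by (simp add: field_simps)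
  qed (auto intro: sum_nonneg)
  then have "(sample_var m x)\<^sup>2 \<le> (2 * (\<Sum>l<m. (x l)\<^sup>2))\<^sup>2"
    using nn by (intro power_mono)
  also have "\<dots> = 4 * (\<Sum>l<m. (x l)\<^sup>2)\<^sup>2" by (simp add: power_mult_distrib)
  also have "\<dots> \<le> 4 * ((\<Sum>l<m. ((x l)\<^sup>2)\<^sup>2) * real m)"
    using sum_squared_le_sum_of_squares[of "\<lambda>l. (x l)\<^sup>2" "{..<m}"] by simp
  finally show ?thesis by (simp add: ac_simps flip: power_mult)
qed

text \<open>Independence of the draws matters only through products of two different draws, so these
  mixed moments are recorded instead. The parameters \<open>a\<close>, \<open>e\<close> and
  \<open>d\<close> are the mean, the second moment and a bound for the fourth moment of one
  draw.\<close>

locale iid_moments = prob_space M for M :: "'b measure" +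
  fixes X :: "nat \<Rightarrow> 'b \<Rightarrow> real" and m :: nat and a e d :: real
  assumes size: "2 \<le> m"
    and X_measurable: "l < m \<Longrightarrow> X l \<in> borel_measurable M"
    and X_integrable4: "l < m \<Longrightarrow> integrable M (\<lambda>w. X l w ^ 4)"
    and X_mean: "l < m \<Longrightarrow> expectation (X l) = a"
    and X_moment2: "l < m \<Longrightarrow> expectation (\<lambda>w. (X l w)\<^sup>2) = e"
    and X_moment4: "l < m \<Longrightarrow> expectation (\<lambda>w. X l w ^ 4) \<le> d"
    and X_mult_integrable: "l < m \<Longrightarrow> k < m \<Longrightarrow> l \<noteq> k \<Longrightarrow> integrable M (\<lambda>w. X l w * X k w)"
    and X_mult_mean: "l < m \<Longrightarrow> k < m \<Longrightarrow> l \<noteq> k \<Longrightarrow> expectation (\<lambda>w. X l w * X k w) = a\<^sup>2"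
begin

lemma X_integrable: "l < m \<Longrightarrow> integrable M (X l)"
  using integrable_power_le[OF X_measurable X_integrable4, of l 1] by simp

lemma X_integrable2: "l < m \<Longrightarrow> integrable M (\<lambda>w. (X l w)\<^sup>2)"
  using integrable_power_le[OF X_measurable X_integrable4, of l 2] by simp

lemma mean_sum: "expectation (\<lambda>w. \<Sum>l<m. X l w) = real m * a"
  using X_integrable X_mean by (simp add: Bochner_Integration.integral_sum)

lemma
  shows sum_square_integrable: "integrable M (\<lambda>w. (\<Sum>l<m. X l w)\<^sup>2)"
    and sum_square_mean: "expectation (\<lambda>w. (\<Sum>l<m. X l w)\<^sup>2) = real m * e + real m * (real m - 1) * a\<^sup>2"
proof -
  have eq: "(\<Sum>l<m. X l w)\<^sup>2 = (\<Sum>l<m. \<Sum>k<m. X l w * X k w)" for w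
    by (simp add: power2_eq_square sum_product)
  \<comment> \<open>One formula for equal and for different draws: the diagonal adds the variance
    \<open>e - a\<^sup>2\<close> of a single draw.\<close>
  have *: "integrable M (\<lambda>w. X l w * X k w)" "expectation (\<lambda>w. X l w * X k w) = a\<^sup>2 + of_bool (l = k) * (e - a\<^sup>2)"
    if "l < m" "k < m" for l k
    using X_integrable2[OF that(1)] X_moment2[OF that(1)] X_mult_integrable[OF that] X_mult_mean[OF that]
    by (cases "l = k"; simp add: power2_eq_square)+
  show "integrable M (\<lambda>w. (\<Sum>l<m. X l w)\<^sup>2)" unfolding eq using * by (intro Bochner_Integration.integrable_sum) auto
  have "expectation (\<lambda>w. (\<Sum>l<m. X l w)\<^sup>2) = (\<Sum>l<m. \<Sum>k<m. a\<^sup>2 + of_bool (l = k) * (e - a\<^sup>2))"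
  proof -
    have "expectation (\<lambda>w. \<Sum>k<m. X l w * X k w) = (\<Sum>k<m. a\<^sup>2 + of_bool (l = k) * (e - a\<^sup>2))"
      if "l < m" for l
      using * that by (subst Bochner_Integration.integral_sum) auto
    then show ?thesis
      unfolding eq using *
      by (subst Bochner_Integration.integral_sum)
        (auto intro!: Bochner_Integration.integrable_sum sum.cong)
  qed
  also have "\<dots> = real m * (real m * a\<^sup>2) + real m * (e - a\<^sup>2)"
    by (simp add: sum.distrib of_bool_def if_distrib[of "\<lambda>x. x * _"] distrib_left cong: if_cong)
  finally show "expectation (\<lambda>w. (\<Sum>l<m. X l w)\<^sup>2) = real m * e + real m * (real m - 1) * a\<^sup>2"
    by (simp add: algebra_simps)
qed

lemma
  shows sum_power4_integrable: "integrable M (\<lambda>w. (\<Sum>l<m. X l w) ^ 4)"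
    and sum_power4_mean: "expectation (\<lambda>w. (\<Sum>l<m. X l w) ^ 4) \<le> real m ^ 4 * d"
proof -
  let ?B = "\<lambda>w. real m ^ 3 * (\<Sum>l<m. X l w ^ 4)"
  have le: "(\<Sum>l<m. X l w) ^ 4 \<le> ?B w" for w
    using sum_power4_le[of "\<lambda>l. X l w" "{..<m}"] by simp
  have intB: "integrable M ?B"
    using X_integrable4 by (intro integrable_mult_right Bochner_Integration.integrable_sum) auto
  have [measurable]: "X l \<in> borel_measurable M" if "l \<in> {..<m}" for l using X_measurable that by simp
  show int: "integrable M (\<lambda>w. (\<Sum>l<m. X l w) ^ 4)"
  proof (rule Bochner_Integration.integrable_bound[OF intB])
    show "(\<lambda>w. (\<Sum>l<m. X l w) ^ 4) \<in> borel_measurable M" by measurable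
    have "norm ((\<Sum>l<m. X l w) ^ 4) \<le> norm (?B w)" for w
      using le[of w] by (simp del: norm_mult add: power_abs)
    then show "AE w in M. norm ((\<Sum>l<m. X l w) ^ 4) \<le> norm (?B w)" by (intro AE_I2)
  qed
  have "expectation (\<lambda>w. (\<Sum>l<m. X l w) ^ 4) \<le> expectation ?B"
    using int intB le by (intro integral_mono)
  also have "\<dots> = real m ^ 3 * (\<Sum>l<m. expectation (\<lambda>w. X l w ^ 4))"
    using X_integrable4 by (simp add: Bochner_Integration.integral_sum)
  also have "\<dots> \<le> real m ^ 3 * (\<Sum>l<m. d)"
    using X_moment4 by (intro mult_left_mono sum_mono) auto
  finally show "expectation (\<lambda>w. (\<Sum>l<m. X l w) ^ 4) \<le> real m ^ 4 * d"
    by (simp add: eval_nat_numeral ac_simps)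
qed

lemma
  shows sample_var_measurable: "(\<lambda>w. sample_var m (\<lambda>l. X l w)) \<in> borel_measurable M"
    and sample_var_mean: "expectation (\<lambda>w. sample_var m (\<lambda>l. X l w)) = real m * (e - a\<^sup>2)"
    and sample_var_integrable2: "integrable M (\<lambda>w. (sample_var m (\<lambda>l. X l w))\<^sup>2)"
    and sample_var_moment2: "expectation (\<lambda>w. (sample_var m (\<lambda>l. X l w))\<^sup>2) \<le> 4 * (real m ^ 4 * d)"
proof -
  have [measurable]: "X l \<in> borel_measurable M" if "l \<in> {..<m}" for l using X_measurable that by simp
  show meas: "(\<lambda>w. sample_var m (\<lambda>l. X l w)) \<in> borel_measurable M"
    unfolding sample_var_def by measurable
  have m: "0 < m" "real m - 1 > 0" using size by auto
  have "expectation (\<lambda>w. sample_var m (\<lambda>l. X l w)) =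
      real m / (real m - 1) * (real m * e - (real m * e + real m * (real m - 1) * a\<^sup>2) / real m)"
  proof -
    have "integrable M (\<lambda>w. \<Sum>l<m. (X l w)\<^sup>2)" "expectation (\<lambda>w. \<Sum>l<m. (X l w)\<^sup>2) = real m * e"
      using X_integrable2 X_moment2
      by (auto simp: Bochner_Integration.integral_sum intro!: Bochner_Integration.integrable_sum)
    then show ?thesis
      unfolding sample_var_eq[OF m(1)] using sum_square_integrable by (simp add: sum_square_mean)
  qed
  also have "(real m * e + real m * (real m - 1) * a\<^sup>2) / real m = e + (real m - 1) * a\<^sup>2"
    using m by (simp add: add_divide_distrib)
  also have "real m / (real m - 1) * (real m * e - (e + (real m - 1) * a\<^sup>2))
      = real m / (real m - 1) * ((real m - 1) * (e - a\<^sup>2))"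
    by (simp add: algebra_simps)
  also have "\<dots> = real m * (e - a\<^sup>2)" using m by simp
  finally show "expectation (\<lambda>w. sample_var m (\<lambda>l. X l w)) = real m * (e - a\<^sup>2)" .
  let ?B = "\<lambda>w. 4 * real m * (\<Sum>l<m. X l w ^ 4)"
  have le: "(sample_var m (\<lambda>l. X l w))\<^sup>2 \<le> ?B w" for w
    using sample_var_square_le[OF size] .
  have intB: "integrable M ?B"
    using X_integrable4 by (intro integrable_mult_right Bochner_Integration.integrable_sum) auto
  show int: "integrable M (\<lambda>w. (sample_var m (\<lambda>l. X l w))\<^sup>2)"
  proof (rule Bochner_Integration.integrable_bound[OF intB])
    show "(\<lambda>w. (sample_var m (\<lambda>l. X l w))\<^sup>2) \<in> borel_measurable M" using meas by measurable
    have "norm ((sample_var m (\<lambda>l. X l w))\<^sup>2) \<le> norm (?B w)" for w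
      using le[of w] by (simp del: norm_mult)
    then show "AE w in M. norm ((sample_var m (\<lambda>l. X l w))\<^sup>2) \<le> norm (?B w)" by (intro AE_I2)
  qed
  have "0 \<le> expectation (\<lambda>w. X 0 w ^ 4)" by (intro Bochner_Integration.integral_nonneg) auto
  then have d: "0 \<le> d" using X_moment4[OF m(1)] by linarith
  have "expectation (\<lambda>w. (sample_var m (\<lambda>l. X l w))\<^sup>2) \<le> expectation ?B"
    using int intB le by (intro integral_mono)
  also have "\<dots> = 4 * real m * (\<Sum>l<m. expectation (\<lambda>w. X l w ^ 4))"
    using X_integrable4 by (simp add: Bochner_Integration.integral_sum)
  also have "\<dots> \<le> 4 * real m * (\<Sum>l<m. d)"
    using X_moment4 by (intro mult_left_mono sum_mono) auto
  also have "\<dots> = 4 * (real m ^ 2 * d)" by (simp add: power2_eq_square)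
  \<comment> \<open>The square of \<open>m\<close> is weakened to the fourth power, which cancels
    the \<open>1 / m ^ 4\<close> in the moments of the draws, as for
    \<open>sum_power4_mean\<close>.\<close>
  also have "\<dots> \<le> 4 * (real m ^ 4 * d)"
    using m d by (intro mult_left_mono mult_right_mono power_increasing) auto
  finally show "expectation (\<lambda>w. (sample_var m (\<lambda>l. X l w))\<^sup>2) \<le> 4 * (real m ^ 4 * d)" .
qed

end

section \<open>A single design with explicit constants\<close>

locale two_stage_design = first_stage_bounds D cL cU C2 C3 C4 c2
  for D :: "('a::euclidean_space, 'w) two_stage" and cL cU C2 C3 C4 c2 +
  fixes F :: "'a set" and \<rho> :: "'a \<Rightarrow> real" and cf P M :: real
  assumes two_stage: "two_stage_sampling F D"
    and F_pos: "0 < measure lebesgue F"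
    and rho_integrable: "set_integrable lebesgue F \<rho>"
    and rho4_integrable: "set_integrable lebesgue F (\<lambda>x. \<rho> x ^ 4)"
    and rho4_le: "(LINT x:F|lebesgue. \<rho> x ^ 4) \<le> M * measure lebesgue F"
    and cf_pos: "0 < cf"
    and psu_pos: "i < num_psu D \<Longrightarrow> 0 < measure lebesgue (psu D i)"
    and psu_le: "i < num_psu D \<Longrightarrow>
      measure lebesgue (psu D i) \<le> P * measure lebesgue F / real (num_psu D)"
    and dens_lower: "i < num_psu D \<Longrightarrow> x \<in> psu D i \<Longrightarrow>
      cf / measure lebesgue (psu D i) \<le> dens_II D i x"
    and size_II_ge: "i < num_psu D \<Longrightarrow> 2 \<le> size_II D i"
begin

abbreviation area :: "nat \<Rightarrow> real" where
  "area i \<equiv> measure lebesgue (psu D i)"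

definition ratio :: "nat \<Rightarrow> 'a \<Rightarrow> real" where
  "ratio i x = \<rho> x / pi_II D i x"

definition ratio_moment2 :: "nat \<Rightarrow> real" where
  "ratio_moment2 i = (LINT x|lebesgue. dens_II D i x * (ratio i x)\<^sup>2)"

text \<open>Bounds the fourth moment of an estimated total. In the integral of
  \<open>f * (\<rho> / (m * f)) ^ 4\<close> the density \<open>f\<close> survives as
  \<open>1 / f ^ 3\<close>, which its lower bound controls by \<open>(area i / cf) ^ 3\<close>. The
  factor \<open>1 / m ^ 4\<close> cancels when \<open>m\<close> draws are added, so the second-stage
  size does not occur.\<close>

definition total_moment4 :: "nat \<Rightarrow> real" where
  "total_moment4 i = (area i / cf) ^ 3 * (LINT x:psu D i|lebesgue. \<rho> x ^ 4)"

lemma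
  shows psu_sets: "i < num_psu D \<Longrightarrow> psu D i \<in> sets lebesgue"
    and psu_disjoint: "disjoint_family_on (psu D) {..<num_psu D}"
    and psu_Union: "(\<Union>i<num_psu D. psu D i) = F"
    and psu_subset: "i < num_psu D \<Longrightarrow> psu D i \<subseteq> F"
  using two_stage by (auto simp: two_stage_sampling_def psu_partition_def)

lemma
  assumes "i < num_psu D"
  shows dens_measurable: "dens_II D i \<in> borel_measurable lebesgue"
    and dens_nonneg: "0 \<le> dens_II D i x"
    and dens_outside: "x \<notin> psu D i \<Longrightarrow> dens_II D i x = 0"
    and dens_integrable: "integrable lebesgue (dens_II D i)"
    and dens_integral: "(LINT x|lebesgue. dens_II D i x) = 1"
  using two_stage assms by (auto simp: two_stage_sampling_def density_on_def)

lemma dens_pos: "i < num_psu D \<Longrightarrow> x \<in> psu D i \<Longrightarrow> 0 < dens_II D i x"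
  using dens_lower psu_pos cf_pos by (meson divide_pos_pos less_le_trans)

lemma cond_sampling:
  assumes "sample_prob s > 0"
  shows "prob_space.indep_vars (cond_first_stage D s) (\<lambda>_. lebesgue)
      (\<lambda>(i, l). point D i l) (SIGMA i:s. {..<size_II D i})"
    and "i \<in> s \<Longrightarrow> l < size_II D i \<Longrightarrow>
      distributed (cond_first_stage D s) lebesgue (point D i l) (\<lambda>x. ennreal (dens_II D i x))"
  using two_stage assms by (auto simp: two_stage_sampling_def sample_prob_def sample_event_def)

text \<open>Division by zero makes \<open>ratio\<close> vanish outside the PSU, hence it is measurable
  although \<open>\<rho>\<close> is unrestricted there.\<close>

lemma ratio_measurable:
  assumes i: "i < num_psu D"
  shows "ratio i \<in> borel_measurable lebesgue"
proof -
  have eq: "ratio i = (\<lambda>x. (indicator (psu D i) x *\<^sub>R \<rho> x) / (real (size_II D i) * dens_II D i x))"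
    using dens_outside[OF i] by (auto simp: ratio_def pi_II_def fun_eq_iff indicator_def)
  have "set_integrable lebesgue (psu D i) \<rho>"
    using rho_integrable psu_sets[OF i] psu_subset[OF i] by (rule set_integrable_subset)
  then have "(\<lambda>x. indicator (psu D i) x *\<^sub>R \<rho> x) \<in> borel_measurable lebesgue"
    unfolding set_integrable_def by (rule borel_measurable_integrable)
  then show ?thesis
    unfolding eq using dens_measurable[OF i] by (intro borel_measurable_divide borel_measurable_times) auto
qed

lemma
  assumes i: "i < num_psu D"
  shows dens_ratio_integrable: "integrable lebesgue (\<lambda>x. dens_II D i x * ratio i x)"
    and dens_ratio_integral: "(LINT x|lebesgue. dens_II D i x * ratio i x) =
      tau_psu \<rho> D i / real (size_II D i)"
proof -
  have eq: "(\<lambda>x. dens_II D i x * ratio i x) = (\<lambda>x. indicator (psu D i) x *\<^sub>R \<rho> x / real (size_II D i))"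
    using dens_outside[OF i] dens_pos[OF i] size_II_ge[OF i]
    by (force simp: ratio_def pi_II_def fun_eq_iff indicator_def)
  have int: "set_integrable lebesgue (psu D i) \<rho>"
    using rho_integrable psu_sets[OF i] psu_subset[OF i] by (rule set_integrable_subset)
  then show "integrable lebesgue (\<lambda>x. dens_II D i x * ratio i x)"
    unfolding eq set_integrable_def by simp
  show "(LINT x|lebesgue. dens_II D i x * ratio i x) = tau_psu \<rho> D i / real (size_II D i)"
    unfolding eq tau_psu_def set_lebesgue_integral_def by simp
qed

lemma
  assumes i: "i < num_psu D"
  shows dens_ratio4_integrable: "integrable lebesgue (\<lambda>x. dens_II D i x * ratio i x ^ 4)"
    and dens_ratio4_integral: "(LINT x|lebesgue. dens_II D i x * ratio i x ^ 4) \<le>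
      total_moment4 i / real (size_II D i) ^ 4"
proof -
  define m where "m = real (size_II D i)"
  have m: "0 < m" using size_II_ge[OF i] by (simp add: m_def)
  let ?B = "\<lambda>x. (area i / cf) ^ 3 / m ^ 4 * (indicator (psu D i) x *\<^sub>R \<rho> x ^ 4)"
  have le: "dens_II D i x * ratio i x ^ 4 \<le> ?B x" for x
  proof (cases "x \<in> psu D i")
    case True
    define f where "f = dens_II D i x"
    have f: "0 < f" "cf / area i \<le> f"
      using dens_pos[OF i True] dens_lower[OF i True] by (auto simp: f_def)
    have "1 / f \<le> area i / cf"
      using f psu_pos[OF i] cf_pos by (simp add: field_simps)
    then have "(1 / f) ^ 3 \<le> (area i / cf) ^ 3"
      using f by (intro power_mono) auto
    then have "(1 / f) ^ 3 * (\<rho> x ^ 4 / m ^ 4) \<le> (area i / cf) ^ 3 * (\<rho> x ^ 4 / m ^ 4)"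
      using m by (intro mult_right_mono) auto
    moreover have "f * (\<rho> x / (m * f)) ^ 4 = (1 / f) ^ 3 * (\<rho> x ^ 4 / m ^ 4)"
      using f m by (simp add: field_simps eval_nat_numeral)
    ultimately show ?thesis
      using True by (simp add: ratio_def pi_II_def f_def m_def)
  next
    case False
    then show ?thesis using dens_outside[OF i] by simp
  qed
  have "set_integrable lebesgue (psu D i) (\<lambda>x. \<rho> x ^ 4)"
    using rho4_integrable psu_sets[OF i] psu_subset[OF i] by (rule set_integrable_subset)
  then have intB: "integrable lebesgue ?B"
    unfolding set_integrable_def by (rule integrable_mult_right)
  show int: "integrable lebesgue (\<lambda>x. dens_II D i x * ratio i x ^ 4)"
  proof (rule Bochner_Integration.integrable_bound[OF intB])
    show "(\<lambda>x. dens_II D i x * ratio i x ^ 4) \<in> borel_measurable lebesgue"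
      using dens_measurable[OF i] ratio_measurable[OF i] by measurable
    have "norm (dens_II D i x * ratio i x ^ 4) \<le> norm (?B x)" for x
    proof -
      have "norm (dens_II D i x * ratio i x ^ 4) = dens_II D i x * ratio i x ^ 4"
        using dens_nonneg[OF i, of x] by simp
      also have "\<dots> \<le> norm (?B x)" using le[of x] by (metis abs_ge_self order_trans real_norm_def)
      finally show ?thesis .
    qed
    then show "AE x in lebesgue. norm (dens_II D i x * ratio i x ^ 4) \<le> norm (?B x)"
      by (intro AE_I2)
  qed
  have "(LINT x|lebesgue. dens_II D i x * ratio i x ^ 4) \<le> (LINT x|lebesgue. ?B x)"
    using int intB le by (intro integral_mono)
  also have "\<dots> = total_moment4 i / m ^ 4"
    by (simp add: total_moment4_def set_lebesgue_integral_def)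
  finally show "(LINT x|lebesgue. dens_II D i x * ratio i x ^ 4) \<le>
      total_moment4 i / real (size_II D i) ^ 4" by (simp only: m_def)
qed

lemma dens_ratio2_integrable:
  assumes i: "i < num_psu D"
  shows "integrable lebesgue (\<lambda>x. dens_II D i x * (ratio i x)\<^sup>2)"
proof -
  have int: "integrable lebesgue (\<lambda>x. dens_II D i x + dens_II D i x * ratio i x ^ 4)"
    using dens_integrable[OF i] dens_ratio4_integrable[OF i] by simp
  show ?thesis
  proof (rule Bochner_Integration.integrable_bound[OF int])
    show "(\<lambda>x. dens_II D i x * (ratio i x)\<^sup>2) \<in> borel_measurable lebesgue"
      using dens_measurable[OF i] ratio_measurable[OF i] by measurable
    have "norm (dens_II D i x * (ratio i x)\<^sup>2) \<le> norm (dens_II D i x + dens_II D i x * ratio i x ^ 4)" for x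
    proof -
      have "2 * 1 * (ratio i x)\<^sup>2 \<le> 1\<^sup>2 + ((ratio i x)\<^sup>2)\<^sup>2"
        by (rule sum_squares_bound)
      then have "2 * (ratio i x)\<^sup>2 \<le> 1 + ratio i x ^ 4" by simp
      then have "(ratio i x)\<^sup>2 \<le> 1 + ratio i x ^ 4"
        using zero_le_power2[of "ratio i x"] by linarith
      then have "dens_II D i x * (ratio i x)\<^sup>2 \<le> dens_II D i x * (1 + ratio i x ^ 4)"
        using dens_nonneg[OF i] by (intro mult_left_mono)
      then show ?thesis using dens_nonneg[OF i, of x] by (simp add: distrib_left)
    qed
    then show "AE x in lebesgue. norm (dens_II D i x * (ratio i x)\<^sup>2)
        \<le> norm (dens_II D i x + dens_II D i x * ratio i x ^ 4)"
      by (intro AE_I2)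
  qed
qed

text \<open>In this form, \<open>m\<close> times the variance of one draw, \<open>V_psu\<close> is
  recognized both in the variance of \<open>tau_psu_hat\<close> and in the mean of
  \<open>sample_var\<close>.\<close>

lemma V_psu_eq:
  assumes i: "i < num_psu D"
  shows "V_psu \<rho> D i = real (size_II D i) *
    (ratio_moment2 i - (tau_psu \<rho> D i / real (size_II D i))\<^sup>2)"
proof -
  define m t where "m = real (size_II D i)" and "t = tau_psu \<rho> D i / real (size_II D i)"
  have "V_psu \<rho> D i = (LINT x|lebesgue. m * (dens_II D i x * (ratio i x)\<^sup>2
      - 2 * t * (dens_II D i x * ratio i x) + t\<^sup>2 * dens_II D i x))"
    unfolding V_psu_def set_lebesgue_integral_def
  proof (rule Bochner_Integration.integral_cong[OF refl])
    fix x
    have pi: "pi_II D i x = m * dens_II D i x" by (simp add: pi_II_def m_def)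
    \<comment> \<open>Outside the PSU the density is zero and both sides vanish, so the integral
      extends to the whole space.\<close>
    show "indicator (psu D i) x *\<^sub>R
        (pi_II D i x * (\<rho> x / pi_II D i x - tau_psu \<rho> D i / real (size_II D i))\<^sup>2) =
      m * (dens_II D i x * (ratio i x)\<^sup>2 - 2 * t * (dens_II D i x * ratio i x) + t\<^sup>2 * dens_II D i x)"
      unfolding ratio_def[symmetric] t_def[symmetric] unfolding pi using dens_outside[OF i, of x]
      by (cases "x \<in> psu D i") (simp_all add: power2_diff algebra_simps)
  qed
  also have "\<dots> = m * (ratio_moment2 i - 2 * t * t + t\<^sup>2)"
    using dens_ratio2_integrable[OF i] dens_ratio_integrable[OF i] dens_integrable[OF i]
    by (simp add: dens_ratio_integral[OF i] dens_integral[OF i] ratio_moment2_def t_def)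
  finally show ?thesis by (simp add: m_def t_def power2_eq_square)
qed

lemma total_moment4_nonneg: "0 \<le> total_moment4 i"
  unfolding total_moment4_def set_lebesgue_integral_def
  using cf_pos by (intro mult_nonneg_nonneg Bochner_Integration.integral_nonneg) auto

section \<open>The draws given a first-stage sample\<close>

definition draw :: "nat \<times> nat \<Rightarrow> 'w \<Rightarrow> real" where
  "draw p w = ratio (fst p) (point D (fst p) (snd p) w)"

lemma tau_psu_hat_eq: "tau_psu_hat \<rho> D i w = (\<Sum>l<size_II D i. draw (i, l) w)"
  by (simp add: tau_psu_hat_def draw_def ratio_def)

lemma V_psu_hat_eq: "V_psu_hat \<rho> D i w = sample_var (size_II D i) (\<lambda>l. draw (i, l) w)"
  unfolding V_psu_hat_def tau_psu_hat_eq sample_var_def by (simp add: draw_def ratio_def)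

text \<open>The design describes the points only under conditional laws. Every PSU belongs to a
  sample of positive probability, and conditioning keeps the sigma-algebra, so measurability carries
  over.\<close>

lemma draw_measurable:
  assumes "i < num_psu D" "l < size_II D i"
  shows "draw (i, l) \<in> borel_measurable (prob_sp D)"
proof -
  obtain s where s: "s \<in> samples" "sample_prob s > 0" "{i} \<subseteq> s"
    using incl_prob_pos_sample[OF incl_pos[OF assms(1)]] by blast
  have "point D i l \<in> measurable (cond_first_stage D s) lebesgue"
    using cond_sampling(2)[OF s(2)] s(3) assms(2) by (auto simp: distributed_def)
  then have "point D i l \<in> measurable (prob_sp D) lebesgue"
    by (simp cong: measurable_cong_sets)
  from measurable_compose[OF this ratio_measurable[OF assms(1)]] show ?thesis
    by (simp add: draw_def[abs_def])
qed

context
  fixes s assumes s: "s \<in> samples" "sample_prob s > 0"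
begin

interpretation C: prob_space "cond_first_stage D s"
  by (rule cond_prob_space[OF s(2)])

lemma psu_in_sample: "i \<in> s \<Longrightarrow> i < num_psu D"
  using s by (auto simp: samples_def)

lemma draw_indep: "C.indep_vars (\<lambda>_. borel) draw (SIGMA i:s. {..<size_II D i})"
proof -
  have "C.indep_vars (\<lambda>_. borel) (\<lambda>p w. ratio (fst p) ((case p of (i, l) \<Rightarrow> point D i l) w))
      (SIGMA i:s. {..<size_II D i})"
    using ratio_measurable psu_in_sample
    by (intro C.indep_vars_compose2[OF cond_sampling(1)[OF s(2)]]) auto
  then show ?thesis
    by (simp add: draw_def[abs_def] case_prod_beta)
qed

lemma draw_moments:
  assumes i: "i \<in> s"
  shows "iid_moments (cond_first_stage D s) (\<lambda>l. draw (i, l)) (size_II D i)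
    (tau_psu \<rho> D i / real (size_II D i)) (ratio_moment2 i) (total_moment4 i / real (size_II D i) ^ 4)"
proof -
  note iN = psu_in_sample[OF i]
  have nn: "0 \<le> dens_II D i x" for x using dens_nonneg[OF iN] .
  \<comment> \<open>Moments of a draw become integrals against its density. The sample
    \<open>s\<close> has disappeared from them, which provides the moments common to all samples
    that \<open>second_stage\<close> demands.\<close>
  have dist: "integrable (cond_first_stage D s) (\<lambda>w. g (draw (i, l) w)) \<longleftrightarrow>
        integrable lebesgue (\<lambda>x. dens_II D i x * g (ratio i x))"
      "integral\<^sup>L (cond_first_stage D s) (\<lambda>w. g (draw (i, l) w)) =
        (LINT x|lebesgue. dens_II D i x * g (ratio i x))"
    if "l < size_II D i" "g \<in> borel_measurable borel" for l and g :: "real \<Rightarrow> real"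
  proof -
    have g: "(\<lambda>x. g (ratio i x)) \<in> borel_measurable lebesgue"
      using measurable_compose[OF ratio_measurable[OF iN] that(2)] .
    note d = cond_sampling(2)[OF s(2) i that(1)]
    show "integrable (cond_first_stage D s) (\<lambda>w. g (draw (i, l) w)) \<longleftrightarrow>
        integrable lebesgue (\<lambda>x. dens_II D i x * g (ratio i x))"
      using distributed_integrable[OF d g] nn by (simp add: draw_def)
    show "integral\<^sup>L (cond_first_stage D s) (\<lambda>w. g (draw (i, l) w)) =
        (LINT x|lebesgue. dens_II D i x * g (ratio i x))"
      using distributed_integral[OF d g] nn by (simp add: draw_def)
  qed
  have int1: "integrable (cond_first_stage D s) (draw (i, l))"
    and mean: "C.expectation (draw (i, l)) = tau_psu \<rho> D i / real (size_II D i)"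
    if "l < size_II D i" for l
    using dist[OF that, of "\<lambda>x. x"] dens_ratio_integrable[OF iN] dens_ratio_integral[OF iN] by auto
  have prod: "integrable (cond_first_stage D s) (\<lambda>w. draw (i, l) w * draw (i, k) w)"
    "C.expectation (\<lambda>w. draw (i, l) w * draw (i, k) w) = (tau_psu \<rho> D i / real (size_II D i))\<^sup>2"
    if "l < size_II D i" "k < size_II D i" "l \<noteq> k" for l k
    using C.integrable_indep_mult[OF draw_indep, of "(i, l)" "(i, k)"]
      C.expectation_indep_mult[OF draw_indep, of "(i, l)" "(i, k)"] int1 mean that i
    by (auto simp: power2_eq_square)
  show ?thesis
  proof
    show "2 \<le> size_II D i" by (rule size_II_ge[OF iN])
  next
    fix l assume l: "l < size_II D i"
    show "draw (i, l) \<in> borel_measurable (cond_first_stage D s)"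
      using draw_measurable[OF iN l] by simp
    show "integrable (cond_first_stage D s) (\<lambda>w. draw (i, l) w ^ 4)"
      using dist(1)[OF l, of "\<lambda>x. x ^ 4"] dens_ratio4_integrable[OF iN] by simp
    show "C.expectation (draw (i, l)) = tau_psu \<rho> D i / real (size_II D i)" by (rule mean[OF l])
    show "C.expectation (\<lambda>w. (draw (i, l) w)\<^sup>2) = ratio_moment2 i"
      using dist(2)[OF l, of "\<lambda>x. x\<^sup>2"] by (simp add: ratio_moment2_def)
    show "C.expectation (\<lambda>w. draw (i, l) w ^ 4) \<le> total_moment4 i / real (size_II D i) ^ 4"
      using dist(2)[OF l, of "\<lambda>x. x ^ 4"] dens_ratio4_integral[OF iN] by simp
  qed (use prod in auto)
qed

text \<open>The indices of all draws split into disjoint blocks, one for each sampled PSU, and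
  functions of different blocks are independent. It is applied to the estimated totals and to the
  estimated variances.\<close>

lemma block_indep:
  assumes \<phi>: "\<And>i. i \<in> s \<Longrightarrow>
    \<phi> i \<in> borel_measurable (PiM ({i} \<times> {..<size_II D i}) (\<lambda>_. borel))"
  shows "C.indep_vars (\<lambda>_. borel)
    (\<lambda>i w. \<phi> i (restrict (\<lambda>p. draw p w) ({i} \<times> {..<size_II D i})) :: real) s"
proof -
  have "C.indep_vars (\<lambda>i. PiM ({i} \<times> {..<size_II D i}) (\<lambda>_. borel))
      (\<lambda>i w. restrict (\<lambda>p. draw p w) ({i} \<times> {..<size_II D i})) s"
    by (rule C.indep_vars_restrict[OF draw_indep]) (auto simp: disjoint_family_on_def)
  then show ?thesis using \<phi> by (rule C.indep_vars_compose2)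
qed

lemma tau_psu_hat_indep: "C.indep_vars (\<lambda>_. borel) (tau_psu_hat \<rho> D) s"
proof -
  have "C.indep_vars (\<lambda>_. borel) (\<lambda>i w.
      (\<lambda>f. \<Sum>l<size_II D i. f (i, l)) (restrict (\<lambda>p. draw p w) ({i} \<times> {..<size_II D i}))) s"
    by (rule block_indep) measurable
  then show ?thesis by (simp add: tau_psu_hat_eq[abs_def])
qed

lemma V_psu_hat_indep: "C.indep_vars (\<lambda>_. borel) (V_psu_hat \<rho> D) s"
proof -
  have "C.indep_vars (\<lambda>_. borel) (\<lambda>i w.
      (\<lambda>f. sample_var (size_II D i) (\<lambda>l. f (i, l)))
        (restrict (\<lambda>p. draw p w) ({i} \<times> {..<size_II D i}))) s"
    unfolding sample_var_def by (rule block_indep) measurable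
  then show ?thesis by (simp add: V_psu_hat_eq[abs_def] sample_var_def)
qed

end

sublocale second_stage D cL cU C2 C3 C4 c2 "tau_psu_hat \<rho> D" "tau_psu \<rho> D" "V_psu \<rho> D"
  total_moment4
proof
  show "tau_psu_hat \<rho> D i \<in> borel_measurable (prob_sp D)" if "i < num_psu D" for i
    unfolding tau_psu_hat_eq[abs_def] using draw_measurable[OF that] by (intro borel_measurable_sum) auto
  show "0 \<le> total_moment4 i" for i by (rule total_moment4_nonneg)
next
  fix s assume s: "s \<in> samples" "sample_prob s > 0"
  show "prob_space.indep_vars (cond_first_stage D s) (\<lambda>_. borel) (tau_psu_hat \<rho> D) s"
    by (rule tau_psu_hat_indep[OF s])
  fix i assume i: "i \<in> s"
  note iN = psu_in_sample[OF s i]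
  interpret I: iid_moments "cond_first_stage D s" "\<lambda>l. draw (i, l)" "size_II D i"
    "tau_psu \<rho> D i / real (size_II D i)" "ratio_moment2 i" "total_moment4 i / real (size_II D i) ^ 4"
    by (rule draw_moments[OF s i])
  have m: "0 < real (size_II D i)" using size_II_ge[OF iN] by simp
  show "integrable (cond_first_stage D s) (\<lambda>w. tau_psu_hat \<rho> D i w ^ 4)"
    unfolding tau_psu_hat_eq by (rule I.sum_power4_integrable)
  show "integral\<^sup>L (cond_first_stage D s) (tau_psu_hat \<rho> D i) = tau_psu \<rho> D i"
    unfolding tau_psu_hat_eq[abs_def] using I.mean_sum m by simp
  \<comment> \<open>With \<open>t = tau_psu \<rho> D i / m\<close> and \<open>e\<close> the second
    moment of a draw, \<open>m * e + m * (m - 1) * t\<^sup>2\<close> regroups as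
    \<open>m * (e - t\<^sup>2) + (m * t)\<^sup>2\<close>.\<close>
  show "integral\<^sup>L (cond_first_stage D s) (\<lambda>w. (tau_psu_hat \<rho> D i w)\<^sup>2) =
      V_psu \<rho> D i + (tau_psu \<rho> D i)\<^sup>2"
    unfolding tau_psu_hat_eq I.sum_square_mean V_psu_eq[OF iN]
    using m by (simp add: field_simps power2_eq_square)
  show "integral\<^sup>L (cond_first_stage D s) (\<lambda>w. tau_psu_hat \<rho> D i w ^ 4) \<le> total_moment4 i"
    unfolding tau_psu_hat_eq using I.sum_power4_mean m by simp
qed

lemma V_psu_hat_measurable:
  assumes "i < num_psu D"
  shows "V_psu_hat \<rho> D i \<in> borel_measurable (prob_sp D)"
proof -
  have [measurable]: "draw (i, l) \<in> borel_measurable (prob_sp D)" if "l \<in> {..<size_II D i}" for l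
    using draw_measurable[OF assms] that by simp
  show ?thesis unfolding V_psu_hat_eq[abs_def] sample_var_def by measurable
qed

lemma
  assumes s: "s \<in> samples" "sample_prob s > 0" and i: "i \<in> s"
  shows V_psu_hat_integrable2: "integrable (cond_first_stage D s) (\<lambda>w. (V_psu_hat \<rho> D i w)\<^sup>2)"
    and V_psu_hat_mean: "integral\<^sup>L (cond_first_stage D s) (V_psu_hat \<rho> D i) = V_psu \<rho> D i"
    and V_psu_hat_moment2: "integral\<^sup>L (cond_first_stage D s) (\<lambda>w. (V_psu_hat \<rho> D i w)\<^sup>2)
      \<le> 4 * total_moment4 i"
proof -
  note iN = psu_in_sample[OF s i]
  interpret I: iid_moments "cond_first_stage D s" "\<lambda>l. draw (i, l)" "size_II D i"
    "tau_psu \<rho> D i / real (size_II D i)" "ratio_moment2 i" "total_moment4 i / real (size_II D i) ^ 4"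
    by (rule draw_moments[OF s i])
  have m: "0 < real (size_II D i)" using size_II_ge[OF iN] by simp
  show "integrable (cond_first_stage D s) (\<lambda>w. (V_psu_hat \<rho> D i w)\<^sup>2)"
    unfolding V_psu_hat_eq by (rule I.sample_var_integrable2)
  show "integral\<^sup>L (cond_first_stage D s) (V_psu_hat \<rho> D i) = V_psu \<rho> D i"
    unfolding V_psu_hat_eq[abs_def] I.sample_var_mean V_psu_eq[OF iN] ..
  show "integral\<^sup>L (cond_first_stage D s) (\<lambda>w. (V_psu_hat \<rho> D i w)\<^sup>2) \<le> 4 * total_moment4 i"
    unfolding V_psu_hat_eq using I.sample_var_moment2 m by simp
qed

section \<open>Error bounds for the variance estimators\<close>

lemma VYGA_hat_eq: "VYGA_hat \<rho> D = yates_grundy"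
  by (simp add: fun_eq_iff VYGA_hat_def yates_grundy_def)

lemma VB_hat_eq: "VB_hat \<rho> D = horvitz_thompson (V_psu_hat \<rho> D)"
  by (simp add: fun_eq_iff VB_hat_def horvitz_thompson_def)

text \<open>The cube comes from \<open>total_moment4\<close> and the areas, \<open>M\<close> from
  the integral of \<open>\<rho> ^ 4\<close>. In \<open>YGA_const\<close> the power
  \<open>cL ^ 4\<close> comes from dividing totals by first order inclusion probabilities.\<close>

definition moment_const :: real where
  "moment_const = (P / cf) ^ 3 * M"

definition YGA_const :: real where
  "YGA_const = 7 * cov_const * moment_const / cL ^ 4"

definition B_const :: real where
  "B_const = 4 * (1 / cL + C2 / cL\<^sup>2) * moment_const"

text \<open>The areas are at most \<open>P * A / N\<close>, which gives the cube, while the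
  integrals of \<open>\<rho> ^ 4\<close> over the PSUs add up to the one over the region; how they
  are shared among the PSUs is irrelevant.\<close>

lemma sum_total_moment4:
  "(\<Sum>i<num_psu D. total_moment4 i) \<le> moment_const * measure lebesgue F ^ 4 / real (num_psu D) ^ 3"
proof -
  let ?A = "measure lebesgue F" and ?N = "real (num_psu D)"
  have int: "set_integrable lebesgue (psu D i) (\<lambda>x. \<rho> x ^ 4)" if "i < num_psu D" for i
    using rho4_integrable psu_sets[OF that] psu_subset[OF that] by (rule set_integrable_subset)
  have nn: "0 \<le> (LINT x:psu D i|lebesgue. \<rho> x ^ 4)" for i
    unfolding set_lebesgue_integral_def by (intro Bochner_Integration.integral_nonneg) auto
  have P: "0 \<le> P * ?A / ?N"
    using psu_pos[OF num_psu_pos] psu_le[OF num_psu_pos] by linarith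
  have "(\<Sum>i<num_psu D. total_moment4 i) \<le>
      (\<Sum>i<num_psu D. (P * ?A / ?N / cf) ^ 3 * (LINT x:psu D i|lebesgue. \<rho> x ^ 4))"
    unfolding total_moment4_def using psu_le cf_pos nn
    by (intro sum_mono mult_right_mono power_mono divide_right_mono) auto
  also have "\<dots> = (P * ?A / ?N / cf) ^ 3 * (LINT x:F|lebesgue. \<rho> x ^ 4)"
    using int psu_sets psu_disjoint unfolding psu_Union[symmetric]
    by (subst set_integral_finite_Union) (auto simp: sum_distrib_left)
  also have "\<dots> \<le> (P * ?A / ?N / cf) ^ 3 * (M * ?A)"
    by (intro mult_left_mono zero_le_power divide_nonneg_pos[OF P cf_pos] rho4_le)
  also have "\<dots> = moment_const * ?A ^ 4 / ?N ^ 3"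
    by (simp add: moment_const_def power_divide power_mult_distrib eval_nat_numeral ac_simps)
  finally show ?thesis .
qed

lemma size_power_le: "real (size_I D) ^ k \<le> real (num_psu D) ^ k"
  using size_I_le by (intro power_mono) auto

lemma
  shows VYGA_hat_integrable: "integrable (prob_sp D) (\<lambda>w. (VYGA_hat \<rho> D w - V1 \<rho> D - V2 \<rho> D)\<^sup>2)"
    and VYGA_hat_variance: "expectation (\<lambda>w. (VYGA_hat \<rho> D w - V1 \<rho> D - V2 \<rho> D)\<^sup>2)
      \<le> YGA_const * measure lebesgue F ^ 4 / real (size_I D) ^ 3"
proof -
  let ?A = "measure lebesgue F" and ?N = "real (num_psu D)" and ?n = "real (size_I D)"
  have eq: "VYGA_hat \<rho> D w - V1 \<rho> D - V2 \<rho> D = yates_grundy w - (V1 \<rho> D + V2 \<rho> D)" for w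
    by (simp add: VYGA_hat_eq)
  show "integrable (prob_sp D) (\<lambda>w. (VYGA_hat \<rho> D w - V1 \<rho> D - V2 \<rho> D)\<^sup>2)"
    unfolding eq unfolding V1_def V2_def by (rule yates_grundy_integrable)
  have "(\<Sum>i<num_psu D. moment4 i) \<le> (\<Sum>i<num_psu D. total_moment4 i / (cL * rate) ^ 4)"
    unfolding moment4_def using incl_lower const_pos rate_pos total_moment4_nonneg
    by (intro sum_mono divide_left_mono power_mono)
      (auto simp: pi_I_eq intro!: mult_pos_pos zero_less_power incl_pos)
  also have "\<dots> \<le> moment_const * ?A ^ 4 / ?N ^ 3 / (cL * rate) ^ 4"
    unfolding sum_divide_distrib[symmetric]
    using sum_total_moment4 const_pos rate_pos by (intro divide_right_mono) auto
  finally have U: "(\<Sum>i<num_psu D. moment4 i) \<le> moment_const * ?A ^ 4 / ?N ^ 3 / (cL * rate) ^ 4" .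
  have "expectation (\<lambda>w. (VYGA_hat \<rho> D w - V1 \<rho> D - V2 \<rho> D)\<^sup>2)
      \<le> 7 * cov_const * rate * (\<Sum>i<num_psu D. moment4 i)"
    unfolding eq unfolding V1_def V2_def by (rule yates_grundy_variance)
  also have "\<dots> \<le> 7 * cov_const * rate * (moment_const * ?A ^ 4 / ?N ^ 3 / (cL * rate) ^ 4)"
    using U cov_const_nonneg rate_pos by (intro mult_left_mono) auto
  \<comment> \<open>The powers combine because \<open>rate / (N ^ 3 * rate ^ 4)\<close> equals
    \<open>1 / n ^ 3\<close>.\<close>
  also have "\<dots> = YGA_const * ?A ^ 4 / ?n ^ 3"
    using num_psu_pos size_I_pos const_pos
    by (simp add: YGA_const_def rate_def field_simps eval_nat_numeral)
  finally show "expectation (\<lambda>w. (VYGA_hat \<rho> D w - V1 \<rho> D - V2 \<rho> D)\<^sup>2)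
      \<le> YGA_const * ?A ^ 4 / ?n ^ 3" .
qed

lemma
  shows VB_hat_measurable: "VB_hat \<rho> D \<in> borel_measurable (prob_sp D)"
    and VB_hat_integrable: "integrable (prob_sp D) (\<lambda>w. (VB_hat \<rho> D w - V3 \<rho> D)\<^sup>2)"
    and VB_hat_variance: "expectation (\<lambda>w. (VB_hat \<rho> D w - V3 \<rho> D)\<^sup>2)
      \<le> B_const * measure lebesgue F ^ 4 / real (size_I D) ^ 3"
proof -
  let ?A = "measure lebesgue F" and ?N = "real (num_psu D)" and ?n = "real (size_I D)"
  let ?c = "1 / cL + C2 / cL\<^sup>2"
  note HT = V_psu_hat_measurable V_psu_hat_indep V_psu_hat_integrable2 V_psu_hat_mean V_psu_hat_moment2
  show "VB_hat \<rho> D \<in> borel_measurable (prob_sp D)"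
    unfolding VB_hat_eq using HT by (rule horvitz_thompson_measurable)
  show "integrable (prob_sp D) (\<lambda>w. (VB_hat \<rho> D w - V3 \<rho> D)\<^sup>2)"
    unfolding VB_hat_eq V3_def using HT by (rule horvitz_thompson_integrable)
  have c: "0 \<le> ?c" using const_pos by simp
  \<comment> \<open>The sign of \<open>moment_const\<close> is read off the nonnegative sum that it
    bounds; it permits the change of denominator below.\<close>
  have mc: "0 \<le> moment_const * ?A ^ 4 / ?N ^ 3"
    by (rule order_trans[OF sum_nonneg sum_total_moment4]) (rule total_moment4_nonneg)
  have "0 < ?A ^ 4 / ?N ^ 3" using F_pos num_psu_pos by simp
  then have mc: "0 \<le> moment_const"
    using mc unfolding times_divide_eq_right[symmetric] zero_le_mult_iff by linarith
  have "expectation (\<lambda>w. (VB_hat \<rho> D w - V3 \<rho> D)\<^sup>2)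
      \<le> ?c / rate * (\<Sum>i<num_psu D. 4 * total_moment4 i)"
    unfolding VB_hat_eq V3_def using HT by (rule horvitz_thompson_variance)
  also have "\<dots> \<le> ?c / rate * (4 * (moment_const * ?A ^ 4 / ?N ^ 3))"
    unfolding sum_distrib_left[symmetric]
    using c rate_pos sum_total_moment4 by (intro mult_left_mono) auto
  also have "\<dots> = B_const * ?A ^ 4 / (?n * ?N\<^sup>2)"
  proof -
    have "?c / rate * (4 * (moment_const * ?A ^ 4 / ?N ^ 3)) = 4 * ?c * moment_const * ?A ^ 4 / (rate * ?N ^ 3)"
      by (simp only: times_divide_eq_right times_divide_eq_left divide_divide_eq_left ac_simps)
    also have "rate * ?N ^ 3 = ?n * ?N\<^sup>2"
      using num_psu_pos by (simp add: rate_def eval_nat_numeral)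
    finally show ?thesis by (simp only: B_const_def)
  qed
  \<comment> \<open>The second-stage term has the smaller order \<open>1 / (n * N\<^sup>2)\<close>;
    by \<open>n \<le> N\<close> it is weakened to the order of the Yates--Grundy part.\<close>
  also have "\<dots> \<le> B_const * ?A ^ 4 / (?n * ?n\<^sup>2)"
    using c mc size_I_pos num_psu_pos size_power_le[of 2]
    by (intro divide_left_mono mult_left_mono) (auto simp: B_const_def)
  finally show "expectation (\<lambda>w. (VB_hat \<rho> D w - V3 \<rho> D)\<^sup>2) \<le> B_const * ?A ^ 4 / ?n ^ 3"
    by (simp add: power2_eq_square power3_eq_cube mult.assoc)
qed

lemma
  shows VYG_hat_measurable: "VYG_hat \<rho> D \<in> borel_measurable (prob_sp D)"
    and VYG_hat_integrable: "integrable (prob_sp D) (\<lambda>w. (VYG_hat \<rho> D w - V_total \<rho> D)\<^sup>2)"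
    and VYG_hat_variance: "expectation (\<lambda>w. (VYG_hat \<rho> D w - V_total \<rho> D)\<^sup>2)
      \<le> 2 * (YGA_const + B_const) * measure lebesgue F ^ 4 / real (size_I D) ^ 3"
proof -
  have [measurable]: "VB_hat \<rho> D \<in> borel_measurable (prob_sp D)" by (rule VB_hat_measurable)
  have [measurable]: "VYGA_hat \<rho> D \<in> borel_measurable (prob_sp D)"
    unfolding VYGA_hat_eq by (rule yates_grundy_measurable)
  show meas [measurable]: "VYG_hat \<rho> D \<in> borel_measurable (prob_sp D)"
    unfolding VYG_hat_def[abs_def] by measurable
  let ?x = "\<lambda>w. VYGA_hat \<rho> D w - V1 \<rho> D - V2 \<rho> D" and ?y = "\<lambda>w. VB_hat \<rho> D w - V3 \<rho> D"
  let ?B = "\<lambda>w. 2 * (?x w)\<^sup>2 + 2 * (?y w)\<^sup>2"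
  have eq: "VYG_hat \<rho> D w - V_total \<rho> D = ?x w + ?y w" for w
    by (simp add: VYG_hat_def V_total_def)
  have le: "(VYG_hat \<rho> D w - V_total \<rho> D)\<^sup>2 \<le> ?B w" for w
    unfolding eq using sum_squares_bound[of "?x w" "?y w"] by (simp add: power2_sum)
  have intB: "integrable (prob_sp D) ?B"
    using VYGA_hat_integrable VB_hat_integrable by simp
  show int: "integrable (prob_sp D) (\<lambda>w. (VYG_hat \<rho> D w - V_total \<rho> D)\<^sup>2)"
  proof (rule Bochner_Integration.integrable_bound[OF intB])
    show "(\<lambda>w. (VYG_hat \<rho> D w - V_total \<rho> D)\<^sup>2) \<in> borel_measurable (prob_sp D)" by measurable
    have "norm ((VYG_hat \<rho> D w - V_total \<rho> D)\<^sup>2) \<le> norm (?B w)" for w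
      using le[of w] by simp
    then show "AE w in prob_sp D. norm ((VYG_hat \<rho> D w - V_total \<rho> D)\<^sup>2) \<le> norm (?B w)"
      by (intro AE_I2)
  qed
  have "expectation (\<lambda>w. (VYG_hat \<rho> D w - V_total \<rho> D)\<^sup>2) \<le> expectation ?B"
    using int intB le by (intro integral_mono)
  also have "\<dots> = 2 * expectation (\<lambda>w. (?x w)\<^sup>2) + 2 * expectation (\<lambda>w. (?y w)\<^sup>2)"
    using VYGA_hat_integrable VB_hat_integrable by simp
  also have "\<dots> \<le> 2 * (YGA_const * measure lebesgue F ^ 4 / real (size_I D) ^ 3)
      + 2 * (B_const * measure lebesgue F ^ 4 / real (size_I D) ^ 3)"
    using VYGA_hat_variance VB_hat_variance by simp
  also have "\<dots> = 2 * (YGA_const + B_const) * measure lebesgue F ^ 4 / real (size_I D) ^ 3"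
    by (simp add: algebra_simps add_divide_distrib)
  finally show "expectation (\<lambda>w. (VYG_hat \<rho> D w - V_total \<rho> D)\<^sup>2)
      \<le> 2 * (YGA_const + B_const) * measure lebesgue F ^ 4 / real (size_I D) ^ 3" .
qed

text \<open>\<open>V2\<close> and \<open>V3\<close> are nonnegative, inclusion probabilities being
  at most 1. This carries the lower bound that \<open>VA2\<close> gives for \<open>V1\<close> over
  to the denominator of the ratio.\<close>

lemma V1_le_V_total: "V1 \<rho> D \<le> V_total \<rho> D"
proof -
  have V: "0 \<le> V_psu \<rho> D i" if "i < num_psu D" for i
    unfolding V_psu_def set_lebesgue_integral_def pi_II_def
    using dens_nonneg[OF that] by (intro Bochner_Integration.integral_nonneg) auto
  have "0 \<le> V2 \<rho> D"
    unfolding V2_def using V incl_prob_le_1 by (intro sum_nonneg mult_nonneg_nonneg) (auto simp: pi_I_eq)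
  moreover have "0 \<le> V3 \<rho> D" unfolding V3_def using V by (intro sum_nonneg) auto
  ultimately show ?thesis by (simp add: V_total_def)
qed

text \<open>The squared normalization cancels \<open>A ^ 4\<close> and two of the three powers of
  \<open>n\<close>.\<close>

lemma
  fixes X :: "'w \<Rightarrow> real"
  assumes "integrable (prob_sp D) (\<lambda>w. (X w)\<^sup>2)"
    and "expectation (\<lambda>w. (X w)\<^sup>2) \<le> K * measure lebesgue F ^ 4 / real (size_I D) ^ 3"
  shows scaled_square_integrable:
      "integrable (prob_sp D) (\<lambda>w. (real (size_I D) / (measure lebesgue F)\<^sup>2 * X w)\<^sup>2)"
    and scaled_square_le:
      "expectation (\<lambda>w. (real (size_I D) / (measure lebesgue F)\<^sup>2 * X w)\<^sup>2) \<le> K / real (size_I D)"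
proof -
  let ?A = "measure lebesgue F" and ?n = "real (size_I D)"
  show "integrable (prob_sp D) (\<lambda>w. (?n / ?A\<^sup>2 * X w)\<^sup>2)"
    unfolding power_mult_distrib by (intro integrable_mult_right assms(1))
  have "expectation (\<lambda>w. (?n / ?A\<^sup>2 * X w)\<^sup>2) = (?n / ?A\<^sup>2)\<^sup>2 * expectation (\<lambda>w. (X w)\<^sup>2)"
    unfolding power_mult_distrib by (rule integral_mult_right_zero)
  also have "\<dots> \<le> (?n / ?A\<^sup>2)\<^sup>2 * (K * ?A ^ 4 / ?n ^ 3)"
    using assms(2) by (intro mult_left_mono) auto
  also have "\<dots> = K / ?n"
    using F_pos size_I_pos by (simp add: field_simps eval_nat_numeral)
  finally show "expectation (\<lambda>w. (?n / ?A\<^sup>2 * X w)\<^sup>2) \<le> K / ?n" .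
qed

end

section \<open>Asymptotics\<close>

theorem proposition4:
  fixes F :: "'a::euclidean_space set"
    and \<rho> :: "'a \<Rightarrow> real"
    and D :: "nat \<Rightarrow> ('a, 'w) two_stage"
  assumes "bounded F" and "F \<in> sets lebesgue" and "measure lebesgue F > 0"
    and "set_integrable lebesgue F \<rho>"
    and "\<And>k. two_stage_sampling F (D k)"
    and "infill_asymptotics D"
    and "FS1 D" and "FS2 D" and "FS3 D" and "SS1 F D" and "VA1 F \<rho>"
  shows
    "((\<forall>k. integrable (prob_sp (D k))
         (\<lambda>w. (real (size_I (D k)) / (measure lebesgue F)\<^sup>2 *
           (VYGA_hat \<rho> (D k) w - V1 \<rho> (D k) - V2 \<rho> (D k)))\<^sup>2)) \<and>
      (\<lambda>k. LINT w|prob_sp (D k).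
         (real (size_I (D k)) / (measure lebesgue F)\<^sup>2 *
           (VYGA_hat \<rho> (D k) w - V1 \<rho> (D k) - V2 \<rho> (D k)))\<^sup>2)
        \<in> O(\<lambda>k. 1 / real (size_I (D k)))) \<and>
     (VA2 F \<rho> D \<longrightarrow>
      (\<forall>k. integrable (prob_sp (D k))
         (\<lambda>w. (real (size_I (D k)) / (measure lebesgue F)\<^sup>2 *
           (VYG_hat \<rho> (D k) w - V_total \<rho> (D k)))\<^sup>2)) \<and>
      (\<lambda>k. LINT w|prob_sp (D k).
         (real (size_I (D k)) / (measure lebesgue F)\<^sup>2 *
           (VYG_hat \<rho> (D k) w - V_total \<rho> (D k)))\<^sup>2)
        \<in> O(\<lambda>k. 1 / real (size_I (D k))) \<and>
      tendsto_in_probability (\<lambda>k. prob_sp (D k))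
        (\<lambda>k w. VYG_hat \<rho> (D k) w / V_total \<rho> (D k)) 1)"
proof -
  define A where "A = measure lebesgue F"
  have A: "0 < A" using assms(3) by (simp add: A_def)
  obtain f0 cL cU :: real where fs1: "f0 < 1" "0 < cL" "cL \<le> cU"
    "\<And>k. real (size_I (D k)) / real (num_psu (D k)) \<le> f0"
    "\<And>k i. i < num_psu (D k) \<Longrightarrow> cL \<le> real (num_psu (D k)) / real (size_I (D k)) * pi_I (D k) i"
    "\<And>k i. i < num_psu (D k) \<Longrightarrow> real (num_psu (D k)) / real (size_I (D k)) * pi_I (D k) i \<le> cU"
    using \<open>FS1 D\<close> unfolding FS1_def by blast
  obtain C2 C3 C4 :: real where fs2: "0 < C2" "0 < C3" "0 < C4"
    "\<And>k i j. i < num_psu (D k) \<Longrightarrow> j < num_psu (D k) \<Longrightarrow> distinct [i, j] \<Longrightarrow>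
      \<bar>LINT w|prob_sp (D k). (incl_I (D k) i w - pi_I (D k) i) * (incl_I (D k) j w - pi_I (D k) j)\<bar>
        \<le> C2 * real (size_I (D k)) / real (num_psu (D k)) ^ 2"
    "\<And>k i j i'. i < num_psu (D k) \<Longrightarrow> j < num_psu (D k) \<Longrightarrow> i' < num_psu (D k) \<Longrightarrow>
      distinct [i, j, i'] \<Longrightarrow>
      \<bar>LINT w|prob_sp (D k). (incl_I (D k) i w - pi_I (D k) i) * (incl_I (D k) j w - pi_I (D k) j)
          * (incl_I (D k) i' w - pi_I (D k) i')\<bar>
        \<le> C3 * real (size_I (D k)) ^ 2 / real (num_psu (D k)) ^ 3"
    "\<And>k i j i' j'. i < num_psu (D k) \<Longrightarrow> j < num_psu (D k) \<Longrightarrow> i' < num_psu (D k) \<Longrightarrow>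
      j' < num_psu (D k) \<Longrightarrow> distinct [i, j, i', j'] \<Longrightarrow>
      \<bar>LINT w|prob_sp (D k). (incl_I (D k) i w - pi_I (D k) i) * (incl_I (D k) j w - pi_I (D k) j)
          * (incl_I (D k) i' w - pi_I (D k) i') * (incl_I (D k) j' w - pi_I (D k) j')\<bar>
        \<le> C4 * real (size_I (D k)) ^ 2 / real (num_psu (D k)) ^ 4"
    using \<open>FS2 D\<close> unfolding FS2_def Let_def
  proof (elim exE conjE, goal_cases)
    case (1 C2 C3 C4)
    note bounds = 1(5)[THEN spec]
    show ?case
      by (rule 1(1)[OF 1(2-4)])
        (rule bounds[THEN conjunct1, rule_format]
          bounds[THEN conjunct2, THEN conjunct1, rule_format]
          bounds[THEN conjunct2, THEN conjunct2, rule_format]; assumption)+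
  qed
  obtain c2 :: real where fs3: "0 < c2"
    "\<And>k i j. i < num_psu (D k) \<Longrightarrow> j < num_psu (D k) \<Longrightarrow> i \<noteq> j \<Longrightarrow>
     c2 * real (size_I (D k)) ^ 2 / real (num_psu (D k)) ^ 2 \<le> pi_I2 (D k) i j"
    using \<open>FS3 D\<close> unfolding FS3_def by blast
  obtain p P cf :: real where ss1: "0 < p" "0 < cf"
    "\<And>k i. i < num_psu (D k) \<Longrightarrow> p * A / real (num_psu (D k)) \<le> measure lebesgue (psu (D k) i)"
    "\<And>k i. i < num_psu (D k) \<Longrightarrow> measure lebesgue (psu (D k) i) \<le> P * A / real (num_psu (D k))"
    "\<And>k i x. i < num_psu (D k) \<Longrightarrow> x \<in> psu (D k) i \<Longrightarrow>
       cf / measure lebesgue (psu (D k) i) \<le> dens_II (D k) i x"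
    "\<And>k i. i < num_psu (D k) \<Longrightarrow> 2 \<le> size_II (D k) i"
    using \<open>SS1 F D\<close> unfolding SS1_def A_def[symmetric] by metis
  obtain M :: real where va1: "set_integrable lebesgue F (\<lambda>x. \<rho> x ^ 4)"
    "(LINT x:F|lebesgue. \<rho> x ^ 4) / A \<le> M"
    using \<open>VA1 F \<rho>\<close> unfolding VA1_def A_def by blast
  have design: "two_stage_design (D k) cL cU C2 C3 C4 c2 F \<rho> cf P M" for k
  proof -
    let ?N = "num_psu (D k)" and ?n = "size_I (D k)"
    have tss: "two_stage_sampling F (D k)" by (rule assms(5))
    have "F \<noteq> {}" using assms(3) by auto
    moreover have "(\<Union>i<?N. psu (D k) i) = F"
      using tss by (simp add: two_stage_sampling_def psu_partition_def)
    ultimately have N: "0 < ?N" by (cases "?N = 0") auto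
    have n: "0 < ?n"
    proof (rule ccontr)
      assume "\<not> 0 < ?n"
      \<comment> \<open>Division by zero yields 0, so an empty first-stage sample would contradict
        the positive lower bound \<open>cL\<close>.\<close>
      then show False using fs1(5)[OF N] fs1(2) by simp
    qed
    have "real ?n / real ?N < 1" using fs1(1) fs1(4)[of k] by linarith
    then have le: "?n \<le> ?N" using N by simp
    interpret first_stage "D k"
      using tss unfolding two_stage_sampling_def by (intro first_stage.intro) blast+
    interpret first_stage_bounds "D k" cL cU C2 C3 C4 c2
    proof
      show "0 < cU" using fs1(2,3) by linarith
    next
      fix i assume i: "i < ?N"
      show "cL * (real ?n / real ?N) \<le> pi_I (D k) i"
        using fs1(5)[OF i] N n by (simp add: field_simps)
      show "pi_I (D k) i \<le> cU * (real ?n / real ?N)"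
        using fs1(6)[OF i] N n by (simp add: field_simps)
      fix j assume j: "j < ?N"
      show "\<bar>expectation (\<lambda>w. (incl_I (D k) i w - pi_I (D k) i) * (incl_I (D k) j w - pi_I (D k) j))\<bar>
          \<le> C2 * real ?n / real ?N ^ 2" if "i \<noteq> j"
        by (rule fs2(4)[OF i j]) (simp add: that)
    qed (rule N n le fs1(2) fs2(1-3) fs2(5,6) fs3; assumption)+
    show ?thesis
    proof
      fix i assume i: "i < ?N"
      have "0 < p * A / real ?N" using ss1(1) A N by simp
      then show "0 < measure lebesgue (psu (D k) i)" using ss1(3)[OF i] by linarith
      show "measure lebesgue (psu (D k) i) \<le> P * measure lebesgue F / real ?N"
        using ss1(4)[OF i] by (simp add: A_def)
    qed (use tss assms(3,4) va1 A ss1 in \<open>auto simp: A_def pos_divide_le_eq\<close>)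
  qed
  \<comment> \<open>Exported from the locale, the constants depend on its numerical parameters but
    not on \<open>D k\<close>; this makes the bounds uniform in \<open>k\<close>.\<close>
  define KA where "KA = two_stage_design.YGA_const cL cU C2 C3 C4 c2 cf P M"
  define KT where "KT = 2 * (KA + two_stage_design.B_const cL C2 cf P M)"
  let ?X = "\<lambda>k w. real (size_I (D k)) / (measure lebesgue F)\<^sup>2 *
           (VYGA_hat \<rho> (D k) w - V1 \<rho> (D k) - V2 \<rho> (D k))"
  let ?Y = "\<lambda>k w. real (size_I (D k)) / (measure lebesgue F)\<^sup>2 *
           (VYG_hat \<rho> (D k) w - V_total \<rho> (D k))"
  have X: "integrable (prob_sp (D k)) (\<lambda>w. (?X k w)\<^sup>2)"
      "(LINT w|prob_sp (D k). (?X k w)\<^sup>2) \<le> KA / real (size_I (D k))"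
    and Y: "integrable (prob_sp (D k)) (\<lambda>w. (?Y k w)\<^sup>2)"
      "(LINT w|prob_sp (D k). (?Y k w)\<^sup>2) \<le> KT / real (size_I (D k))"
    and Ym: "VYG_hat \<rho> (D k) \<in> borel_measurable (prob_sp (D k))"
    and Vle: "V1 \<rho> (D k) \<le> V_total \<rho> (D k)"
    and n_pos: "0 < size_I (D k)"
    and prob: "prob_space (prob_sp (D k))" for k
  proof -
    interpret two_stage_design "D k" cL cU C2 C3 C4 c2 F \<rho> cf P M by (rule design)
    show "integrable (prob_sp (D k)) (\<lambda>w. (?X k w)\<^sup>2)"
      by (rule scaled_square_integrable[OF VYGA_hat_integrable VYGA_hat_variance])
    show "(LINT w|prob_sp (D k). (?X k w)\<^sup>2) \<le> KA / real (size_I (D k))"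
      unfolding KA_def by (rule scaled_square_le[OF VYGA_hat_integrable VYGA_hat_variance])
    show "integrable (prob_sp (D k)) (\<lambda>w. (?Y k w)\<^sup>2)"
      by (rule scaled_square_integrable[OF VYG_hat_integrable VYG_hat_variance])
    show "(LINT w|prob_sp (D k). (?Y k w)\<^sup>2) \<le> KT / real (size_I (D k))"
      unfolding KT_def KA_def by (rule scaled_square_le[OF VYG_hat_integrable VYG_hat_variance])
    show "VYG_hat \<rho> (D k) \<in> borel_measurable (prob_sp (D k))" by (rule VYG_hat_measurable)
    show "V1 \<rho> (D k) \<le> V_total \<rho> (D k)" by (rule V1_le_V_total)
    show "0 < size_I (D k)" by (rule size_I_pos)
    show "prob_space (prob_sp (D k))" by (rule prob_space_D)
  qed
  \<comment> \<open>The same constant serves for every \<open>k\<close>, and the norm on the left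
    disappears because the integral is nonnegative.\<close>
  have bigo: "(\<lambda>k. LINT w|prob_sp (D k). (Z k w)\<^sup>2) \<in> O(\<lambda>k. 1 / real (size_I (D k)))"
    if "\<And>k. (LINT w|prob_sp (D k). (Z k w)\<^sup>2) \<le> K / real (size_I (D k))"
    for Z :: "nat \<Rightarrow> 'w \<Rightarrow> real" and K
  proof (rule bigoI[of _ K], rule always_eventually, rule allI)
    fix k
    have "0 \<le> (LINT w|prob_sp (D k). (Z k w)\<^sup>2)"
      by (intro Bochner_Integration.integral_nonneg) auto
    then show "norm (LINT w|prob_sp (D k). (Z k w)\<^sup>2) \<le> K * norm (1 / real (size_I (D k)))"
      using that[of k] by simp
  qed
  have "tendsto_in_probability (\<lambda>k. prob_sp (D k))
        (\<lambda>k w. VYG_hat \<rho> (D k) w / V_total \<rho> (D k)) 1" if va2: "VA2 F \<rho> D"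
  proof -
    obtain m2 where m2: "0 < m2" "\<And>k. m2 \<le> real (size_I (D k)) / A\<^sup>2 * V1 \<rho> (D k)"
      using va2 unfolding VA2_def A_def by blast
    show ?thesis
      unfolding tendsto_in_probability_def
    proof (intro conjI allI impI)
      fix k
      show "(\<lambda>w. VYG_hat \<rho> (D k) w / V_total \<rho> (D k)) \<in> borel_measurable (prob_sp (D k))"
        using Ym[of k] by measurable
    next
      fix \<epsilon> :: real assume \<epsilon>: "0 < \<epsilon>"
      let ?p = "\<lambda>k. measure (prob_sp (D k))
        {w \<in> space (prob_sp (D k)). \<epsilon> < \<bar>VYG_hat \<rho> (D k) w / V_total \<rho> (D k) - 1\<bar>}"
      have le: "?p k \<le> KT / (\<epsilon> * m2)\<^sup>2 * (1 / real (size_I (D k)))" for k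
      proof -
        interpret prob_space "prob_sp (D k)" by (rule prob)
        have [measurable]: "VYG_hat \<rho> (D k) \<in> borel_measurable (prob_sp (D k))" by (rule Ym)
        let ?V = "V_total \<rho> (D k)" and ?n = "real (size_I (D k))"
        have c: "0 < ?n / A\<^sup>2" using n_pos[of k] A by simp
        have V: "m2 \<le> ?n / A\<^sup>2 * ?V"
          using m2(2)[of k] mult_left_mono[OF Vle[of k], of "?n / A\<^sup>2"] c by linarith
        have V0: "0 < ?V"
          using V m2(1) c by (metis less_le_trans zero_less_mult_pos)
        \<comment> \<open>The normalized error \<open>?Y k w\<close> is the deviation of the ratio
          from 1 multiplied by the normalized variance, which is at least \<open>m2\<close>. A
          deviation above \<open>\<epsilon>\<close> thus forces an error of at least
          \<open>\<epsilon> * m2\<close>, and Chebyshev's inequality applies to the latter.\<close>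
        have "?p k \<le> prob {w \<in> space (prob_sp (D k)). \<epsilon> * m2 \<le> \<bar>?Y k w\<bar>}"
        proof (rule finite_measure_mono)
          show "{w \<in> space (prob_sp (D k)). \<epsilon> * m2 \<le> \<bar>?Y k w\<bar>} \<in> events" by measurable
          show "{w \<in> space (prob_sp (D k)). \<epsilon> < \<bar>VYG_hat \<rho> (D k) w / ?V - 1\<bar>}
              \<subseteq> {w \<in> space (prob_sp (D k)). \<epsilon> * m2 \<le> \<bar>?Y k w\<bar>}"
          proof safe
            fix w assume w: "\<epsilon> < \<bar>VYG_hat \<rho> (D k) w / ?V - 1\<bar>"
            have "?V * (VYG_hat \<rho> (D k) w / ?V - 1) = VYG_hat \<rho> (D k) w - ?V"
              using V0 by (simp add: right_diff_distrib)
            then have "?Y k w = ?n / A\<^sup>2 * ?V * (VYG_hat \<rho> (D k) w / ?V - 1)"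
              by (simp only: A_def mult.assoc)
            then have "\<bar>?Y k w\<bar> = (?n / A\<^sup>2 * ?V) * \<bar>VYG_hat \<rho> (D k) w / ?V - 1\<bar>"
              using c V0 by (simp add: abs_mult)
            moreover have "m2 * \<epsilon> \<le> (?n / A\<^sup>2 * ?V) * \<bar>VYG_hat \<rho> (D k) w / ?V - 1\<bar>"
              using V w m2(1) \<epsilon> by (intro mult_mono) auto
            ultimately show "\<epsilon> * m2 \<le> \<bar>?Y k w\<bar>" by (simp only: mult.commute)
          qed
        qed
        also have "\<dots> \<le> (LINT w|prob_sp (D k). (?Y k w)\<^sup>2) / (\<epsilon> * m2)\<^sup>2"
          using Y(1)[of k] \<epsilon> m2(1) by (intro second_moment_method) auto
        also have "\<dots> \<le> KT / ?n / (\<epsilon> * m2)\<^sup>2"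
          by (intro divide_right_mono Y(2)) auto
        finally show ?thesis by (simp add: mult.commute)
      qed
      have "filterlim (\<lambda>k. real (size_I (D k))) at_top sequentially"
        using \<open>infill_asymptotics D\<close> unfolding infill_asymptotics_def
        by (intro filterlim_compose[OF filterlim_real_sequentially]) auto
      then have "(\<lambda>k. 1 / real (size_I (D k))) \<longlonglongrightarrow> 0"
        by (intro tendsto_divide_0[OF tendsto_const] filterlim_at_top_imp_at_infinity)
      then have lim: "(\<lambda>k. KT / (\<epsilon> * m2)\<^sup>2 * (1 / real (size_I (D k)))) \<longlonglongrightarrow> 0"
        by (rule tendsto_mult_right_zero)
      show "?p \<longlonglongrightarrow> 0"
      proof (rule tendsto_sandwich[OF always_eventually always_eventually tendsto_const lim])
        show "\<forall>k. 0 \<le> ?p k" by simp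
        show "\<forall>k. ?p k \<le> KT / (\<epsilon> * m2)\<^sup>2 * (1 / real (size_I (D k)))"
          using le by blast
      qed
    qed
  qed
  then show ?thesis
    by (intro conjI allI impI X(1) Y(1) bigo[OF X(2)] bigo[OF Y(2)])
qed

end
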